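(* Consider the mean field game with common noise described in the context, and suppose: (a) for every $\mu\in L$ there exists a unique optimal pair $(X^\mu,\alpha^\mu)$ for $\inf_{\alpha\in\mathcal A}J(\alpha,\mu)$; (b) for $\mathbb P\otimes dt$-a.a. $(\omega,t)$ and $\phi\in\{f(\omega,t,\cdot,\cdot),g(\omega,\cdot,\cdot)\}$, $\phi(\bar x,\bar y)-\phi(x,\bar y)\le\phi(\bar x,y)-\phi(x,y)$ for all real $\bar x\ge x$ and $\bar y\ge y$. Then the set of solutions of the MFG with common noise is a nonempty complete lattice.
   Context: Let $T>0$ and let $W=(W_t)_{t\in[0,T]}$, $B=(B_t)_{t\in[0,T]}$ be two independent Brownian motions on a complete filtered probability space $(\Omega,\mathcal F,(\mathcal F_t)_{t\in[0,T]},\mathbb P)$. Let $\xi\in L^2(\Omega,\mathcal F_0,\mathbb P)$, $\sigma\ge0$, $\sigma_0>0$, $U\subset\mathbb R$, and let $\mathcal A$ be the set of square integrable progressively measurable processes $\alpha:\Omega\times[0,T]\to U$. Let $b:\Omega\times[0,T]\times\mathbb R\times U\to\mathbb R$ be bounded and measurable, with $b(\cdot,\cdot,x,a)$ progressively measurable for each $(x,a)$, and Lipschitz in $x$: $|b(\omega,t,x,a)-b(\omega,t,y,a)|\le C_1|x-y|$ for a constant $C_1>0$ and all $\omega,t,a,x,y$. For $\alpha\in\mathcal A$, $X^\alpha$ is the unique strong solution of $$dX_t=b(t,X_t,\alpha_t)dt+\sigma dW_t+\sigma_0dB_t,\quad X_0=\xi .$$ Put $Y_t:=|\xi|+t\|b\|_\infty+\sigma|W_t|+\sigma_0|B_t|$;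 then $\mathbb P$-a.s. $|X^\alpha_t|\le Y_t$ for all $t\in[0,T]$ and $\alpha\in\mathcal A$. Let $\mathbb F^B=(\mathcal F^B_t)$ be the natural filtration of $B$ augmented by all $\mathbb P$-null sets. $L$ is the set of all real-valued $\mathbb F^B$-progressively measurable processes $\mu=(\mu_t)_{t\in[0,T]}$ such that $|\mu_t|\le Y_t$ $\mathbb P$-a.s., for each $t\in[0,T]$. Order on $L$: $\mu\le\bar\mu$ iff $\mu_t\le\bar\mu_t$ $\mathbb P\otimes dt$-a.e. Costs are measurable functions $f:\Omega\times[0,T]\times\mathbb R^2\to\mathbb R$, $l:\Omega\times[0,T]\times\mathbb R\times U\to\mathbb R$, $g:\Omega\times\mathbb R^2\to\mathbb R$, with $f,l$ progressively measurable in $(\omega,t)$ and $g$ $\mathcal F_T$-measurable in $\omega$ for fixed values of the other variables. For $\mu\in L$, $$J(\alpha,\mu)=\mathbb E\Big[\int_0^T[f(t,X^\alpha_t,\mu_t)+l(t,X^\alpha_t,\alpha_t)]dt+g(X^\alpha_T,\mu_T)\Big],\quad\alpha\in\mathcal A.$$ An optimal pair for $\mu$ is $(X^\mu,\alpha^\mu)$ with $\alpha^\mu\in\mathcal A$, $-\infty<J(\alpha^\mu,\mu)\le J(\alpha,\mu)$ for all $\alpha\in\mathcal A$, and $X^\mu=X^{\alpha^\mu}$. A process $\mu\in L$ is a solution of the MFG with common noise if $\mu_t=\mathbb E[X^\mu_t\,|\,\mathcal F^B_T]$ for each $t\in[0,T]$. A partially ordered set is a complete lattice if each of its subsets has a least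 upper bound and a greatest lower bound in it.
   Formalization: In the definition of L the bound |μ_t| ≤ Y_t is replaced by |μ_t| ≤ E[Y_t | F^B_T], also in hypothesis (a): with the original bound the claim fails, since a solution has μ_0 = E[ξ], which can exceed Y_0 = |ξ| with positive probability. *)

theory Defs
  imports "HOL-Probability.Probability" "HOL-Algebra.Complete_Lattice"
begin

text \<open>
  Processes are functions \<open>X t \<omega>\<close> of a real time \<open>t\<close>; only the times in \<open>[0, T]\<close>, with
  \<open>T = horizon D\<close>, and the points of the sample space matter.  Coefficients are functions of
  \<open>(\<omega>, t, x, a)\<close>, in this order.
\<close>

record 'w mfg =
  Pm :: "'w measure"
  Filt :: "real \<Rightarrow> 'w measure"
  horizon :: real
  idio :: "real \<Rightarrow> 'w \<Rightarrow> real"                        \<comment> \<open>\<open>W\<close>\<close>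
  common :: "real \<Rightarrow> 'w \<Rightarrow> real"                      \<comment> \<open>\<open>B\<close>\<close>
  initial :: "'w \<Rightarrow> real"                             \<comment> \<open>\<open>\<xi>\<close>\<close>
  vol :: real                                        \<comment> \<open>\<open>\<sigma>\<close>\<close>
  vol0 :: real                                       \<comment> \<open>\<open>\<sigma>\<^sub>0\<close>\<close>
  ctrls :: "real set"                                \<comment> \<open>\<open>U\<close>\<close>
  drift :: "'w \<Rightarrow> real \<Rightarrow> real \<Rightarrow> real \<Rightarrow> real"          \<comment> \<open>\<open>b(\<omega>, t, x, a)\<close>\<close>
  cost_f :: "'w \<Rightarrow> real \<Rightarrow> real \<Rightarrow> real \<Rightarrow> real"         \<comment> \<open>\<open>f(\<omega>, t, x, y)\<close>\<close>
  cost_l :: "'w \<Rightarrow> real \<Rightarrow> real \<Rightarrow> real \<Rightarrow> real"         \<comment> \<open>\<open>l(\<omega>, t, x, a)\<close>\<close>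
  cost_g :: "'w \<Rightarrow> real \<Rightarrow> real \<Rightarrow> real"                 \<comment> \<open>\<open>g(\<omega>, x, y)\<close>\<close>

definition progressive :: "real \<Rightarrow> (real \<Rightarrow> 'w measure) \<Rightarrow> (real \<Rightarrow> 'w \<Rightarrow> real) \<Rightarrow> bool" where
  "progressive T F X \<longleftrightarrow>
     (\<forall>t\<in>{0..T}. (\<lambda>(\<omega>, s). X s \<omega>) \<in> borel_measurable (F t \<Otimes>\<^sub>M restrict_space borel {0..t}))"

definition brownian_motion ::
    "'w measure \<Rightarrow> real \<Rightarrow> (real \<Rightarrow> 'w measure) \<Rightarrow> (real \<Rightarrow> 'w \<Rightarrow> real) \<Rightarrow> bool" where
  "brownian_motion M T F W \<longleftrightarrow>
     (\<forall>t\<in>{0..T}. W t \<in> borel_measurable (F t)) \<and>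
     (AE \<omega> in M. W 0 \<omega> = 0) \<and>
     (AE \<omega> in M. continuous_on {0..T} (\<lambda>t. W t \<omega>)) \<and>
     (\<forall>s t. 0 \<le> s \<and> s < t \<and> t \<le> T \<longrightarrow>
        distributed M lborel (\<lambda>\<omega>. W t \<omega> - W s \<omega>) (normal_density 0 (sqrt (t - s))) \<and>
        prob_space.indep_set M (sets (F s))
          (sets (vimage_algebra (space M) (\<lambda>\<omega>. W t \<omega> - W s \<omega>) borel)))"

definition path :: "real \<Rightarrow> (real \<Rightarrow> 'w \<Rightarrow> real) \<Rightarrow> 'w \<Rightarrow> real \<Rightarrow> real" where
  "path T W \<omega> = (\<lambda>t\<in>{0..T}. W t \<omega>)"

definition time_measure :: "'w mfg \<Rightarrow> real measure" where
  "time_measure D = restrict_space lborel {0..horizon D}"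

definition prod_measure :: "'w mfg \<Rightarrow> ('w \<times> real) measure" where
  "prod_measure D = Pm D \<Otimes>\<^sub>M time_measure D"

locale mfg_setting =
  fixes D :: "'w mfg"
  assumes horizon_pos: "0 < horizon D"
    and prob: "prob_space (Pm D)"
    and complete: "complete_measure (Pm D)"
    and filt_sub: "\<And>t. t \<in> {0..horizon D} \<Longrightarrow> subalgebra (Pm D) (Filt D t)"
    and filt_mono: "\<And>s t. 0 \<le> s \<Longrightarrow> s \<le> t \<Longrightarrow> t \<le> horizon D \<Longrightarrow>
                      subalgebra (Filt D t) (Filt D s)"
    and filt_null: "null_sets (Pm D) \<subseteq> sets (Filt D 0)"
    and BM_idio: "brownian_motion (Pm D) (horizon D) (Filt D) (idio D)"
    and BM_common: "brownian_motion (Pm D) (horizon D) (Filt D) (common D)"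
    and BM_indep: "prob_space.indep_var (Pm D)
                     (PiM {0..horizon D} (\<lambda>_. borel)) (path (horizon D) (idio D))
                     (PiM {0..horizon D} (\<lambda>_. borel)) (path (horizon D) (common D))"
    and initial_meas: "initial D \<in> borel_measurable (Filt D 0)"
    and initial_L2: "integrable (Pm D) (\<lambda>\<omega>. (initial D \<omega>)\<^sup>2)"
    and vol_nonneg: "0 \<le> vol D"
    and vol0_pos: "0 < vol0 D"
    and drift_bounded: "\<exists>K. \<forall>\<omega>\<in>space (Pm D). \<forall>t\<in>{0..horizon D}. \<forall>x. \<forall>a\<in>ctrls D.
                          \<bar>drift D \<omega> t x a\<bar> \<le> K"
    and drift_meas: "(\<lambda>(\<omega>, t, x, a). drift D \<omega> t x a) \<in> borel_measurable
                       (Pm D \<Otimes>\<^sub>M restrict_space borel {0..horizon D} \<Otimes>\<^sub>M borel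
                        \<Otimes>\<^sub>M restrict_space borel (ctrls D))"
    and drift_prog: "\<And>x a. a \<in> ctrls D \<Longrightarrow>
                       progressive (horizon D) (Filt D) (\<lambda>t \<omega>. drift D \<omega> t x a)"
    and drift_lipschitz: "\<exists>C>0. \<forall>\<omega>\<in>space (Pm D). \<forall>t\<in>{0..horizon D}. \<forall>a\<in>ctrls D. \<forall>x y.
                            \<bar>drift D \<omega> t x a - drift D \<omega> t y a\<bar> \<le> C * \<bar>x - y\<bar>"
    and f_meas: "(\<lambda>(\<omega>, t, x, y). cost_f D \<omega> t x y) \<in> borel_measurable
                   (Pm D \<Otimes>\<^sub>M restrict_space borel {0..horizon D} \<Otimes>\<^sub>M borel \<Otimes>\<^sub>M borel)"
    and f_prog: "\<And>x y. progressive (horizon D) (Filt D) (\<lambda>t \<omega>. cost_f D \<omega> t x y)"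
    and l_meas: "(\<lambda>(\<omega>, t, x, a). cost_l D \<omega> t x a) \<in> borel_measurable
                   (Pm D \<Otimes>\<^sub>M restrict_space borel {0..horizon D} \<Otimes>\<^sub>M borel
                    \<Otimes>\<^sub>M restrict_space borel (ctrls D))"
    and l_prog: "\<And>x a. a \<in> ctrls D \<Longrightarrow>
                   progressive (horizon D) (Filt D) (\<lambda>t \<omega>. cost_l D \<omega> t x a)"
    and g_meas: "(\<lambda>(\<omega>, x, y). cost_g D \<omega> x y) \<in> borel_measurable (Pm D \<Otimes>\<^sub>M borel \<Otimes>\<^sub>M borel)"
    and g_adapted: "\<And>x y. (\<lambda>\<omega>. cost_g D \<omega> x y) \<in> borel_measurable (Filt D (horizon D))"

definition admissible :: "'w mfg \<Rightarrow> (real \<Rightarrow> 'w \<Rightarrow> real) set" where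
  "admissible D = {\<alpha>. progressive (horizon D) (Filt D) \<alpha> \<and>
     (\<forall>t\<in>{0..horizon D}. \<forall>\<omega>\<in>space (Pm D). \<alpha> t \<omega> \<in> ctrls D) \<and>
     (\<integral>\<^sup>+\<omega>. (\<integral>\<^sup>+t. ennreal ((\<alpha> t \<omega>)\<^sup>2) \<partial>time_measure D) \<partial>Pm D) < \<infinity>}"

text \<open>Both volatilities are constant, so no stochastic integral is needed.\<close>

definition strong_solution ::
    "'w mfg \<Rightarrow> (real \<Rightarrow> 'w \<Rightarrow> real) \<Rightarrow> (real \<Rightarrow> 'w \<Rightarrow> real) \<Rightarrow> bool" where
  "strong_solution D \<alpha> X \<longleftrightarrow>
     progressive (horizon D) (Filt D) X \<and>
     (AE \<omega> in Pm D. continuous_on {0..horizon D} (\<lambda>t. X t \<omega>)) \<and>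
     (AE \<omega> in Pm D. \<forall>t\<in>{0..horizon D}.
        X t \<omega> = initial D \<omega> + (LINT s:{0..t}|lborel. drift D \<omega> s (X s \<omega>) (\<alpha> s \<omega>))
                + vol D * idio D t \<omega> + vol0 D * common D t \<omega>)"

text \<open>\<open>X\<^sup>\<alpha>\<close>; the strong solution is unique up to indistinguishability, and the choice of the
  version has no influence below.\<close>

definition state :: "'w mfg \<Rightarrow> (real \<Rightarrow> 'w \<Rightarrow> real) \<Rightarrow> real \<Rightarrow> 'w \<Rightarrow> real" where
  "state D \<alpha> = (SOME X. strong_solution D \<alpha> X)"

definition indistinguishable ::
    "'w mfg \<Rightarrow> (real \<Rightarrow> 'w \<Rightarrow> real) \<Rightarrow> (real \<Rightarrow> 'w \<Rightarrow> real) \<Rightarrow> bool" where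
  "indistinguishable D X X' \<longleftrightarrow> (AE \<omega> in Pm D. \<forall>t\<in>{0..horizon D}. X t \<omega> = X' t \<omega>)"

text \<open>The sup norm; the element \<open>0\<close> only serves to give the empty supremum its usual value.\<close>

definition drift_norm :: "'w mfg \<Rightarrow> real" where
  "drift_norm D = Sup (insert 0 {\<bar>drift D \<omega> t x a\<bar> | \<omega> t x a.
     \<omega> \<in> space (Pm D) \<and> t \<in> {0..horizon D} \<and> a \<in> ctrls D})"

definition Ybound :: "'w mfg \<Rightarrow> real \<Rightarrow> 'w \<Rightarrow> real" where
  "Ybound D t \<omega> = \<bar>initial D \<omega>\<bar> + t * drift_norm D
                   + vol D * \<bar>idio D t \<omega>\<bar> + vol0 D * \<bar>common D t \<omega>\<bar>"

definition FB :: "'w mfg \<Rightarrow> real \<Rightarrow> 'w measure" where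
  "FB D t = sigma (space (Pm D))
     ({common D s -` A \<inter> space (Pm D) | s A. s \<in> {0..t} \<and> A \<in> sets borel} \<union> null_sets (Pm D))"

text \<open>
  The bound on \<open>\<mu>\<^sub>t\<close> is the conditional one, \<open>E[Y\<^sub>t | F\<^sup>B\<^sub>T]\<close>, which is what \<open>\<bar>X\<^sub>t\<bar> \<le> Y\<^sub>t\<close> gives for
  \<open>E[X\<^sub>t | F\<^sup>B\<^sub>T]\<close>.  The unconditional bound \<open>\<bar>\<mu>\<^sub>t\<bar> \<le> Y\<^sub>t\<close>, which implies this one for
  \<open>F\<^sup>B\<close>-adapted \<open>\<mu>\<close>, is too strong: since \<open>\<xi>\<close> and \<open>B\<close> are independent,
  \<open>E[X\<^sub>0 | F\<^sup>B\<^sub>T]\<close> is the constant \<open>E \<xi>\<close>, which can exceed \<open>Y\<^sub>0 = \<bar>\<xi>\<bar>\<close> with positive probability,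
  and then no \<open>\<mu>\<close> with the unconditional bound is a solution, whatever the costs are.
\<close>

definition mfg_L :: "'w mfg \<Rightarrow> (real \<Rightarrow> 'w \<Rightarrow> real) set" where
  "mfg_L D = {\<mu>. progressive (horizon D) (FB D) \<mu> \<and>
     (\<forall>t\<in>{0..horizon D}. AE \<omega> in Pm D.
        \<bar>\<mu> t \<omega>\<bar> \<le> real_cond_exp (Pm D) (FB D (horizon D)) (Ybound D t) \<omega>)}"

definition mfg_le :: "'w mfg \<Rightarrow> (real \<Rightarrow> 'w \<Rightarrow> real) \<Rightarrow> (real \<Rightarrow> 'w \<Rightarrow> real) \<Rightarrow> bool" where
  "mfg_le D \<mu> \<nu> \<longleftrightarrow> (AE (\<omega>, t) in prod_measure D. \<mu> t \<omega> \<le> \<nu> t \<omega>)"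

definition mfg_eq :: "'w mfg \<Rightarrow> (real \<Rightarrow> 'w \<Rightarrow> real) \<Rightarrow> (real \<Rightarrow> 'w \<Rightarrow> real) \<Rightarrow> bool" where
  "mfg_eq D \<mu> \<nu> \<longleftrightarrow> (AE (\<omega>, t) in prod_measure D. \<mu> t \<omega> = \<nu> t \<omega>)"

text \<open>
  The extended-real-valued integral \<open>\<integral>h\<^sup>+ - \<integral>h\<^sup>-\<close>.  If both parts are infinite, the integral does not
  exist and is given the value \<open>-\<infinity>\<close>; so \<open>ext_integral M h > -\<infinity>\<close> means that the integral exists
  and is not \<open>-\<infinity>\<close>.  Hence an optimal pair can exist only if all costs \<open>J(\<alpha>, \<mu>)\<close> are well
  defined.
\<close>

definition ext_integral :: "'a measure \<Rightarrow> ('a \<Rightarrow> ereal) \<Rightarrow> ereal" where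
  "ext_integral M h =
     (let p = (\<integral>\<^sup>+x. e2ennreal (h x) \<partial>M); n = (\<integral>\<^sup>+x. e2ennreal (- h x) \<partial>M)
      in if n = \<infinity> then -\<infinity> else enn2ereal p - enn2ereal n)"

definition J :: "'w mfg \<Rightarrow> (real \<Rightarrow> 'w \<Rightarrow> real) \<Rightarrow> (real \<Rightarrow> 'w \<Rightarrow> real) \<Rightarrow> ereal" where
  "J D \<alpha> \<mu> = ext_integral (Pm D) (\<lambda>\<omega>.
     ext_integral (time_measure D)
       (\<lambda>t. ereal (cost_f D \<omega> t (state D \<alpha> t \<omega>) (\<mu> t \<omega>) + cost_l D \<omega> t (state D \<alpha> t \<omega>) (\<alpha> t \<omega>)))
     + ereal (cost_g D \<omega> (state D \<alpha> (horizon D) \<omega>) (\<mu> (horizon D) \<omega>)))"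

definition optimal_pair ::
    "'w mfg \<Rightarrow> (real \<Rightarrow> 'w \<Rightarrow> real) \<Rightarrow> (real \<Rightarrow> 'w \<Rightarrow> real) \<Rightarrow> (real \<Rightarrow> 'w \<Rightarrow> real) \<Rightarrow> bool" where
  "optimal_pair D \<mu> X \<alpha> \<longleftrightarrow>
     \<alpha> \<in> admissible D \<and> strong_solution D \<alpha> X \<and>
     -\<infinity> < J D \<alpha> \<mu> \<and> (\<forall>\<beta>\<in>admissible D. J D \<alpha> \<mu> \<le> J D \<beta> \<mu>)"

text \<open>Controls are identified \<open>P \<otimes> dt\<close>-almost everywhere, states up to indistinguishability.\<close>

definition unique_optimal_pair :: "'w mfg \<Rightarrow> (real \<Rightarrow> 'w \<Rightarrow> real) \<Rightarrow> bool" where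
  "unique_optimal_pair D \<mu> \<longleftrightarrow>
     (\<exists>X \<alpha>. optimal_pair D \<mu> X \<alpha>) \<and>
     (\<forall>X \<alpha> X' \<alpha>'. optimal_pair D \<mu> X \<alpha> \<and> optimal_pair D \<mu> X' \<alpha>' \<longrightarrow>
        indistinguishable D X X' \<and> mfg_eq D \<alpha> \<alpha>')"

definition mfg_solutions :: "'w mfg \<Rightarrow> (real \<Rightarrow> 'w \<Rightarrow> real) set" where
  "mfg_solutions D = {\<mu> \<in> mfg_L D. \<exists>X \<alpha>. optimal_pair D \<mu> X \<alpha> \<and>
     (\<forall>t\<in>{0..horizon D}. AE \<omega> in Pm D.
        \<mu> t \<omega> = real_cond_exp (Pm D) (FB D (horizon D)) (X t) \<omega>)}"

text \<open>
  \<open>mfg_le\<close> is antisymmetric only up to \<open>mfg_eq\<close>; the partially ordered set of solutions consists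
  of the classes of solutions modulo \<open>mfg_eq\<close>.
\<close>

definition solution_order :: "'w mfg \<Rightarrow> (real \<Rightarrow> 'w \<Rightarrow> real) set gorder" where
  "solution_order D =
     \<lparr> carrier = mfg_solutions D //
         {(\<mu>, \<nu>). \<mu> \<in> mfg_solutions D \<and> \<nu> \<in> mfg_solutions D \<and> mfg_eq D \<mu> \<nu>},
       eq = (=),
       le = (\<lambda>p q. \<exists>\<mu>\<in>p. \<exists>\<nu>\<in>q. mfg_le D \<mu> \<nu>) \<rparr>"

end

theory Submission
  imports Defs
begin

text \<open>
  A solution is a fixed point of the best response map \<open>R\<close>, which sends a flow \<open>\<mu>\<close> to the flow of
  conditional means \<open>E[X\<^sup>\<mu>\<^sub>t | F\<^sup>B\<^sub>T]\<close> of the optimal state for \<open>\<mu>\<close>.  If \<open>R\<close> is a monotone self-map of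
  a complete lattice, then its fixed points form a nonempty complete lattice by Tarski's theorem.

  Monotonicity comes from submodularity.  Given \<open>\<mu> \<le> \<mu>'\<close> with optimal states \<open>X\<close> and \<open>X'\<close>, the maximum and
  the minimum of \<open>X\<close> and \<open>X'\<close> are again states: they result from switching between the two optimal controls
  according to which state is larger (\<open>switch_solution\<close>).  This holds because all states are driven by the
  same noises, so \<open>X - X'\<close> is an absolutely continuous process starting at \<open>0\<close>.  By submodularity, pairing the maximum
  with \<open>\<mu>'\<close> and the minimum with \<open>\<mu>\<close> does not increase the sum of the costs (\<open>switch_optimal\<close>);
  hence the maximum is optimal for \<open>\<mu>'\<close>, and by uniqueness it is \<open>X'\<close>, that is, \<open>X \<le> X'\<close>.

  For \<open>R\<close> to map \<open>L\<close> into itself, the conditional means need a version that is progressive for the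
  filtration of the common noise.  It exists because conditioning the time-\<open>t\<close> state on the future of the common
  noise has no effect (\<open>real_cond_exp_FB_horizon\<close>) and because the state is Hoelder continuous in \<open>L\<^sup>1\<close>,
  so that it can be approximated by sampling on grids (\<open>progressive_projection\<close>).

  There is one obstacle.  The terminal cost depends on \<open>\<mu>\<^sub>T\<close>, whereas flows are compared
  \<open>P \<otimes> dt\<close>-almost everywhere, which says nothing about \<open>\<mu>\<^sub>T\<close>; so \<open>R\<close> need not respect the order on \<open>L\<close>.  The
  proof works with the preorder \<open>terminal_le\<close>, which also compares the terminal values.  Infima
  for it are essential infima (\<open>mfg_L_Inf\<close>), \<open>R\<close> is monotone for it, and on the solutions, which are
  continuous in \<open>L\<^sup>1\<close>, it coincides with the original order (\<open>mfg_le_solutions_iff\<close>).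
\<close>

section \<open>Fixed points and quotients of preorders\<close>

text \<open>
  Tarski's fixed point theorem without antisymmetry: the infimum \<open>w\<close> of all upper bounds \<open>v\<close> of
  \<open>A\<close> with \<open>R v \<le> v\<close> is again such a \<open>v\<close>, and so is \<open>R w\<close>; hence \<open>w\<close> and \<open>R w\<close> are equivalent.
  A preorder is needed because processes are only compared almost everywhere, and which of
  the equivalent versions of \<open>w\<close> is a solution can only be decided at the level of processes.
\<close>

lemma preorder_Tarski:
  fixes le :: "'a \<Rightarrow> 'a \<Rightarrow> bool" and L :: "'a set" and R :: "'a \<Rightarrow> 'a"
  assumes trans: "\<And>x y z. x \<in> L \<Longrightarrow> y \<in> L \<Longrightarrow> z \<in> L \<Longrightarrow> le x y \<Longrightarrow> le y z \<Longrightarrow> le x z"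
    and inf: "\<And>U. U \<subseteq> L \<Longrightarrow> U \<noteq> {} \<Longrightarrow>
      \<exists>w\<in>L. (\<forall>u\<in>U. le w u) \<and> (\<forall>v\<in>L. (\<forall>u\<in>U. le v u) \<longrightarrow> le v w)"
    and top: "m \<in> L" "\<And>x. x \<in> L \<Longrightarrow> le x m"
    and R: "\<And>x. x \<in> L \<Longrightarrow> R x \<in> L"
    and mono: "\<And>x y. x \<in> L \<Longrightarrow> y \<in> L \<Longrightarrow> le x y \<Longrightarrow> le (R x) (R y)"
    and A: "A \<subseteq> L" "\<And>a. a \<in> A \<Longrightarrow> le a (R a)"
  shows "\<exists>w\<in>L. le w (R w) \<and> le (R w) w \<and> (\<forall>a\<in>A. le a w) \<and>
           (\<forall>v\<in>L. le (R v) v \<longrightarrow> (\<forall>a\<in>A. le a v) \<longrightarrow> le w v)"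
proof -
  define U where "U = {v \<in> L. le (R v) v \<and> (\<forall>a\<in>A. le a v)}"
  have UL: "U \<subseteq> L" unfolding U_def by blast
  have "m \<in> U" unfolding U_def using top R A by blast
  then have "U \<noteq> {}" by blast
  from inf[OF UL this] obtain w where w: "w \<in> L" "\<forall>u\<in>U. le w u"
      "\<forall>v\<in>L. (\<forall>u\<in>U. le v u) \<longrightarrow> le v w"
    by (elim bexE conjE)
  have Aw: "le a w" if "a \<in> A" for a
    using w(3)[rule_format, of a] that A(1) unfolding U_def by blast
  have "le (R w) u" if u: "u \<in> U" for u
  proof (rule trans)
    show "le (R w) (R u)" using w(1) w(2) u UL by (intro mono) auto
    show "le (R u) u" using u unfolding U_def by blast
  qed (use u UL R w(1) in auto)
  then have Rw: "le (R w) w" using w(3) R[OF w(1)] by blast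
  have "le a (R w)" if a: "a \<in> A" for a
  proof (rule trans)
    show "le a (R a)" by (rule A(2)[OF a])
    show "le (R a) (R w)" using a A(1) w(1) Aw by (intro mono) auto
  qed (use a A(1) R w(1) in auto)
  then have "R w \<in> U" unfolding U_def using mono[OF R[OF w(1)] w(1) Rw] R[OF w(1)] by blast
  then have "le w (R w)" using w(2) by blast
  moreover have "le w v" if "v \<in> L" "le (R v) v" "\<forall>a\<in>A. le a v" for v
    using w(2) that unfolding U_def by blast
  ultimately show ?thesis using w(1) Rw Aw by blast
qed

text \<open>
  Suprema of arbitrary subsets suffice, since the infimum of a set is the supremum of its lower
  bounds.  The relation between classes is stated with two existential quantifiers, which amounts
  to a comparison of arbitrary representatives.
\<close>

lemma quotient_complete_lattice:
  fixes le eqv :: "'a \<Rightarrow> 'a \<Rightarrow> bool"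
  assumes refl: "\<And>a. a \<in> S \<Longrightarrow> le a a"
    and trans: "\<And>a b c. a \<in> S \<Longrightarrow> b \<in> S \<Longrightarrow> c \<in> S \<Longrightarrow> le a b \<Longrightarrow> le b c \<Longrightarrow> le a c"
    and eqv: "\<And>a b. a \<in> S \<Longrightarrow> b \<in> S \<Longrightarrow> eqv a b \<longleftrightarrow> le a b \<and> le b a"
    and sup: "\<And>A. A \<subseteq> S \<Longrightarrow>
      \<exists>w\<in>S. (\<forall>a\<in>A. le a w) \<and> (\<forall>v\<in>S. (\<forall>a\<in>A. le a v) \<longrightarrow> le w v)"
  shows "complete_lattice \<lparr> carrier = S // {(a, b). a \<in> S \<and> b \<in> S \<and> eqv a b},
           eq = (=), le = (\<lambda>p q. \<exists>a\<in>p. \<exists>b\<in>q. le a b) \<rparr>"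
    (is "complete_lattice ?Q")
proof -
  define Q where "Q = ?Q"
  define E where "E = {(a, b). a \<in> S \<and> b \<in> S \<and> eqv a b}"
  have car: "carrier Q = (\<lambda>a. E `` {a}) ` S"
    unfolding E_def Q_def quotient_def by auto
  have eqQ: "(.=\<^bsub>Q\<^esub>) = (=)" unfolding Q_def by simp
  have leQ: "p \<sqsubseteq>\<^bsub>Q\<^esub> q \<longleftrightarrow> (\<exists>a\<in>p. \<exists>b\<in>q. le a b)" for p q unfolding Q_def by simp
  have memE: "b \<in> E `` {a} \<longleftrightarrow> a \<in> S \<and> b \<in> S \<and> le a b \<and> le b a" for a b
    unfolding E_def using eqv by auto
  have le_cls: "(E `` {a}) \<sqsubseteq>\<^bsub>Q\<^esub> (E `` {b}) \<longleftrightarrow> le a b" if "a \<in> S" "b \<in> S" for a b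
  proof
    assume "(E `` {a}) \<sqsubseteq>\<^bsub>Q\<^esub> (E `` {b})"
    then obtain a' b' where "a' \<in> E `` {a}" "b' \<in> E `` {b}" "le a' b'" unfolding leQ by auto
    then show "le a b" unfolding memE using trans by blast
  next
    assume "le a b"
    moreover have "a \<in> E `` {a}" "b \<in> E `` {b}" using that refl by (simp_all only: memE)
    ultimately show "(E `` {a}) \<sqsubseteq>\<^bsub>Q\<^esub> (E `` {b})" unfolding leQ by (intro bexI)
  qed
  have eq_cls: "E `` {a} = E `` {b}" if "a \<in> S" "b \<in> S" "le a b" "le b a" for a b
  proof (rule Set.set_eqI)
    fix c
    show "c \<in> E `` {a} \<longleftrightarrow> c \<in> E `` {b}"
      unfolding memE using that trans[of b a c] trans[of a b c] trans[of c a b] trans[of c b a]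
      by blast
  qed
  interpret partial_order Q
  proof unfold_locales
    fix x y z assume x: "x \<in> carrier Q"
    then obtain a where a: "a \<in> S" "x = E `` {a}" unfolding car by blast
    show "x \<sqsubseteq>\<^bsub>Q\<^esub> x" using a le_cls refl by blast
    assume y: "y \<in> carrier Q"
    then obtain b where b: "b \<in> S" "y = E `` {b}" unfolding car by blast
    show "x .=\<^bsub>Q\<^esub> y" if "x \<sqsubseteq>\<^bsub>Q\<^esub> y" "y \<sqsubseteq>\<^bsub>Q\<^esub> x"
      using that le_cls[OF a(1) b(1)] le_cls[OF b(1) a(1)] eq_cls[OF a(1) b(1)] unfolding a b eqQ
          by blast
    assume z: "z \<in> carrier Q"
    then obtain c where c: "c \<in> S" "z = E `` {c}" unfolding car by blast
    show "x \<sqsubseteq>\<^bsub>Q\<^esub> z" if "x \<sqsubseteq>\<^bsub>Q\<^esub> y" "y \<sqsubseteq>\<^bsub>Q\<^esub> z"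
    proof -
      have "le a b" "le b c"
        using that le_cls[OF a(1) b(1)] le_cls[OF b(1) c(1)] unfolding a(2) b(2) c(2) by blast+
      then have "le a c" by (rule trans[OF a(1) b(1) c(1)])
      then show ?thesis using le_cls[OF a(1) c(1)] unfolding a(2) c(2) by blast
    qed
  qed (auto simp: eqQ)
  have sup_ex: "\<exists>s. least Q s (Upper Q P)" if P: "P \<subseteq> carrier Q" for P
  proof -
    define A where "A = {a \<in> S. E `` {a} \<in> P}"
    have PA: "P = (\<lambda>a. E `` {a}) ` A" using P unfolding car A_def by blast
    have AS: "A \<subseteq> S" unfolding A_def by blast
    from sup[OF AS] obtain w
      where w: "w \<in> S" "\<forall>a\<in>A. le a w" "\<forall>v\<in>S. (\<forall>a\<in>A. le a v) \<longrightarrow> le w v"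
      by (elim bexE conjE)
    have "least Q (E `` {w}) (Upper Q P)"
    proof (rule least_UpperI)
      fix p assume "p \<in> P"
      then obtain a where a: "a \<in> A" "p = E `` {a}" unfolding PA by (elim imageE)
      have "a \<in> S" using AS a(1) by (rule subsetD)
      moreover have "le a w" using w(2) a(1) by (rule bspec)
      ultimately show "p \<sqsubseteq>\<^bsub>Q\<^esub> (E `` {w})" unfolding a(2) using le_cls w(1) by simp
    next
      fix y assume y: "y \<in> Upper Q P"
      then have "y \<in> carrier Q" unfolding Upper_def by blast
      then obtain v where v: "v \<in> S" "y = E `` {v}" unfolding car by blast
      have "le a v" if "a \<in> A" for a
      proof -
        have "E `` {a} \<in> P" unfolding PA using that by (rule imageI)
        then have "(E `` {a}) \<sqsubseteq>\<^bsub>Q\<^esub> y" using y P unfolding Upper_def by blast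
        then show ?thesis unfolding v(2) le_cls[OF subsetD[OF AS that] v(1)] .
      qed
      then have "le w v" using w(3) v(1) by simp
      then show "(E `` {w}) \<sqsubseteq>\<^bsub>Q\<^esub> y" unfolding v(2) le_cls[OF w(1) v(1)] .
    next
      show "E `` {w} \<in> carrier Q" unfolding car using w by blast
    qed (use P in auto)
    then show ?thesis by blast
  qed
  have "complete_lattice Q"
  proof (rule complete_latticeI)
    fix P assume P: "P \<subseteq> carrier Q"
    show "\<exists>s. least Q s (Upper Q P)" by (rule sup_ex[OF P])
    obtain i where i: "least Q i (Upper Q (Lower Q P))"
      using sup_ex[of "Lower Q P"] by auto
    have "greatest Q i (Lower Q P)"
    proof (rule greatest_LowerI)
      fix p assume p: "p \<in> P"
      then have "p \<in> Upper Q (Lower Q P)"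
        using P by (intro Upper_memI) (auto simp: Lower_def)
      then show "i \<sqsubseteq>\<^bsub>Q\<^esub> p" by (rule least_le[OF i])
    next
      fix y assume y: "y \<in> Lower Q P"
      then show "y \<sqsubseteq>\<^bsub>Q\<^esub> i" by (intro least_Upper_above[OF i]) auto
    next
      show "i \<in> carrier Q" using i by blast
    qed (use P in auto)
    then show "\<exists>i. greatest Q i (Lower Q P)" by blast
  qed
  then show ?thesis unfolding Q_def .
qed

section \<open>Essential infima\<close>

text \<open>
  Countably many members \<open>f c\<close> already have the essential infimum of the whole family as their
  pointwise infimum.  The integral of the infimum of a bounded strictly increasing
  transform \<open>h\<close> of the \<open>f c\<close> is minimised over countable \<open>C\<close>; a minimiser exists because countable
  unions are countable, and adding one more member cannot lower the integral any further, hence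
  it cannot lower the infimum on a set of positive measure.  Stated with lower bounds \<open>y\<close>, the
  conclusion makes sense even where the infimum is \<open>-\<infinity>\<close>, and it remains true when \<open>C\<close> is enlarged.
\<close>

lemma (in finite_measure) essential_infimum_countable:
  fixes f :: "'i \<Rightarrow> 'a \<Rightarrow> real"
  assumes meas: "\<And>i. i \<in> I \<Longrightarrow> f i \<in> borel_measurable M" and ne: "I \<noteq> {}"
  shows "\<exists>C\<subseteq>I. countable C \<and> C \<noteq> {} \<and>
    (\<forall>i\<in>I. AE x in M. \<forall>y. (\<forall>c\<in>C. y \<le> f c x) \<longrightarrow> y \<le> f i x)"
proof -
  define h :: "real \<Rightarrow> ennreal" where "h r = ennreal (arctan r + pi / 2)" for r
  have h_pos: "0 < arctan r + pi / 2" for r using arctan_bounded[of r] by linarith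
  have h_le: "h r \<le> h s \<longleftrightarrow> r \<le> s" for r s
    unfolding h_def using h_pos[of r] h_pos[of s] by (simp add: ennreal_le_iff arctan_le_iff)
  have h_bd: "h r \<le> ennreal pi" for r
    unfolding h_def using arctan_ubound[of r] by (intro ennreal_leI) linarith
  have h_m: "h \<in> borel_measurable borel" unfolding h_def by measurable
  define V where "V C = (\<integral>\<^sup>+x. (INF c\<in>C. h (f c x)) \<partial>M)" for C
  define \<C> where "\<C> = {C. C \<subseteq> I \<and> countable C \<and> C \<noteq> {}}"
  have hfm: "(\<lambda>x. h (f i x)) \<in> borel_measurable M" if "i \<in> I" for i
    using measurable_compose[OF meas[OF that] h_m] .
  have INF_m: "(\<lambda>x. INF c\<in>C. h (f c x)) \<in> borel_measurable M" if "C \<in> \<C>" for C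
    using that hfm unfolding \<C>_def by (intro borel_measurable_INF) auto
  have anti: "V C' \<le> V C" if "C \<subseteq> C'" for C C'
    unfolding V_def by (intro nn_integral_mono INF_superset_mono that) auto
  obtain i0 where "i0 \<in> I" using ne by blast
  then have "{i0} \<in> \<C>" unfolding \<C>_def by simp
  then have "\<C> \<noteq> {}" by blast
  then obtain g where g: "\<And>n. g n \<in> V ` \<C>" "g \<longlonglongrightarrow> Inf (V ` \<C>)"
    using Inf_as_limit[of "V ` \<C>"] by (metis image_is_empty)
  then have "\<forall>n. \<exists>C. C \<in> \<C> \<and> g n = V C" by blast
  then obtain K where K: "\<And>n. K n \<in> \<C>" "\<And>n. g n = V (K n)" by metis
  define C where "C = (\<Union>n. K n)"
  have C: "C \<in> \<C>" using K(1) unfolding C_def \<C>_def by (auto simp: subset_iff) 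
  have "V C \<le> g n" for n unfolding K(2) by (rule anti) (auto simp: C_def)
  then have VC: "V C \<le> Inf (V ` \<C>)" using g(2) by (meson LIMSEQ_le_const)
  have fin: "V C < \<infinity>"
  proof -
    obtain c where c: "c \<in> C" using C unfolding \<C>_def by blast
    have "V C \<le> (\<integral>\<^sup>+x. ennreal pi \<partial>M)"
      unfolding V_def by (intro nn_integral_mono INF_lower2[OF c] h_bd)
    also have "\<dots> < \<infinity>"
      using emeasure_finite by (simp add: ennreal_mult_eq_top_iff less_top[symmetric])
    finally show ?thesis .
  qed
  have "AE x in M. \<forall>y. (\<forall>c\<in>C. y \<le> f c x) \<longrightarrow> y \<le> f i x" if i: "i \<in> I" for i
  proof -
    have Ci: "insert i C \<in> \<C>" using C i unfolding \<C>_def by auto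
    then have "V C \<le> V (insert i C)" using VC by (meson INF_lower order_trans)
    then have eq: "(\<integral>\<^sup>+x. (INF c\<in>insert i C. h (f c x)) \<partial>M) = (\<integral>\<^sup>+x. (INF c\<in>C. h (f c x)) \<partial>M)"
      using anti[of C "insert i C"] unfolding V_def by (auto intro: antisym)
    have "AE x in M. (INF c\<in>C. h (f c x)) \<le> (INF c\<in>insert i C. h (f c x))"
    proof (rule ccontr)
      assume "\<not> ?thesis"
      moreover have "AE x in M. (INF c\<in>insert i C. h (f c x)) \<le> (INF c\<in>C. h (f c x))"
        by (intro AE_I2 INF_superset_mono) auto
      ultimately have "(\<integral>\<^sup>+x. (INF c\<in>insert i C. h (f c x)) \<partial>M) < (\<integral>\<^sup>+x. (INF c\<in>C. h (f c x)) \<partial>M)"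
        using fin C Ci eq unfolding V_def
        by (intro nn_integral_less INF_m) auto
      then show False using eq by simp
    qed
    then show ?thesis
    proof eventually_elim
      case (elim x)
      show ?case
      proof (intro allI impI)
        fix y assume "\<forall>c\<in>C. y \<le> f c x"
        then have "h y \<le> (INF c\<in>C. h (f c x))" by (intro INF_greatest) (simp add: h_le)
        also have "\<dots> \<le> h (f i x)" using elim by (rule order_trans) (rule INF_lower, simp)
        finally show "y \<le> f i x" by (simp add: h_le)
      qed
    qed
  qed
  then show ?thesis using C unfolding \<C>_def by blast
qed

section \<open>Gronwall's lemma and positive parts of integrals\<close>

lemma integrable_on_Icc_of_bounded:
  fixes d :: "real \<Rightarrow> real"
  assumes "set_borel_measurable borel {0..T} d" "\<And>s. s \<in> {0..T} \<Longrightarrow> \<bar>d s\<bar> \<le> K"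
    and "{a..b} \<subseteq> {0..T}"
  shows "set_integrable lborel {a..b} d"
proof -
  have "set_integrable lborel {0..T} d"
    unfolding set_integrable_def
  proof (rule Bochner_Integration.integrable_bound[where f = "\<lambda>s. indicator {0..T} s *\<^sub>R K"])
    show "integrable lborel (\<lambda>s. indicator {0..T} s *\<^sub>R K)" by (simp add: emeasure_lborel_Icc_eq)
    show "(\<lambda>s. indicat_real {0..T} s *\<^sub>R d s) \<in> borel_measurable lborel"
      using assms(1) unfolding set_borel_measurable_def by simp
    show "AE s in lborel. norm (indicat_real {0..T} s *\<^sub>R d s) \<le> norm (indicat_real {0..T} s *\<^sub>R K)"
      using assms(2) by (auto simp: indicator_def intro: order_trans[OF _ abs_ge_self])
  qed
  then show ?thesis by (rule set_integrable_subset) (use assms in auto)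
qed

lemma abs_integral_Ioc_le:
  fixes h :: "real \<Rightarrow> real"
  assumes "s \<le> t" "\<And>r. s < r \<Longrightarrow> r \<le> t \<Longrightarrow> \<bar>h r\<bar> \<le> c"
  shows "\<bar>LINT r:{s<..t}|lborel. h r\<bar> \<le> c * (t - s)"
proof (cases "set_integrable lborel {s<..t} h")
  case True
  have "\<bar>LINT r:{s<..t}|lborel. h r\<bar> \<le> (LINT r:{s<..t}|lborel. \<bar>h r\<bar>)"
    using set_integral_norm_bound[OF True] by simp
  also have "\<dots> \<le> (LINT r:{s<..t}|lborel. c)"
    using assms True by (intro set_integral_mono set_integrable_abs) (auto simp: set_integrable_def)
  also have "\<dots> = c * (t - s)" using assms by (simp add: set_integral_const)
  finally show ?thesis .
next
  case False
  then have "(LINT r:{s<..t}|lborel. h r) = 0"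
    unfolding set_integrable_def set_lebesgue_integral_def by (rule not_integrable_integral_eq)
  moreover have "0 \<le> c * (t - s)"
    using assms(2)[of t] assms(1) by (cases "s = t") (auto intro!: mult_nonneg_nonneg)
  ultimately show ?thesis by simp
qed

lemma set_integral_Icc_split:
  fixes f :: "real \<Rightarrow> real"
  assumes "0 \<le> s" "s \<le> t" "t \<le> T" "set_integrable lborel {0..T} f"
  shows "(LINT r:{0..t}|lborel. f r) = (LINT r:{0..s}|lborel. f r) + (LINT r:{s<..t}|lborel. f r)"
proof -
  have eq: "{0..t} = {0..s} \<union> {s<..t}" using assms by auto
  show ?thesis
    unfolding eq using assms by (intro set_integral_Un set_integrable_subset[OF assms(4)]) auto
qed

lemma set_integral_Icc_lipschitz:
  fixes d :: "real \<Rightarrow> real"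
  assumes "set_borel_measurable borel {0..T} d" "\<And>s. s \<in> {0..T} \<Longrightarrow> \<bar>d s\<bar> \<le> K"
    and st: "0 \<le> s" "s \<le> t" "t \<le> T"
  shows "\<bar>(LINT r:{0..t}|lborel. d r) - (LINT r:{0..s}|lborel. d r)\<bar> \<le> K * (t - s)"
proof -
  have "(LINT r:{0..t}|lborel. d r) - (LINT r:{0..s}|lborel. d r) = (LINT r:{s<..t}|lborel. d r)"
    using set_integral_Icc_split[OF st integrable_on_Icc_of_bounded[OF assms(1,2)]] by simp
  also have "\<bar>\<dots>\<bar> \<le> K * (t - s)" using assms by (intro abs_integral_Ioc_le) auto
  finally show ?thesis .
qed

text \<open>
  Gronwall's lemma in its homogeneous form.  If \<open>v m\<close> is the maximum of \<open>v s = u s exp (- 2 C s)\<close>,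
  then integrating \<open>u s \<le> v m exp (2 C s)\<close> gives \<open>v m \<le> v m / 2\<close>.
\<close>

lemma gronwall_zero:
  fixes u :: "real \<Rightarrow> real"
  assumes C: "0 < C" and cont: "continuous_on {0..T} u"
    and nonneg: "\<And>t. t \<in> {0..T} \<Longrightarrow> 0 \<le> u t"
    and le: "\<And>t. t \<in> {0..T} \<Longrightarrow> u t \<le> C * (LINT s:{0..t}|lborel. u s)"
    and t: "t \<in> {0..T}"
  shows "u t = 0"
proof -
  define v where "v s = u s * exp (- 2 * C * s)" for s
  have "continuous_on {0..T} v" unfolding v_def by (intro continuous_intros cont)
  then obtain m where m: "m \<in> {0..T}" "\<And>s. s \<in> {0..T} \<Longrightarrow> v s \<le> v m"
    using continuous_attains_sup[of "{0..T}" v] t by auto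
  have u_le: "u s \<le> v m * exp (2 * C * s)" if "s \<in> {0..T}" for s
  proof -
    have "u s = v s * exp (2 * C * s)" unfolding v_def by (simp add: exp_add[symmetric])
    then show ?thesis using m(2)[OF that] by simp
  qed
  have I: "((\<lambda>s. v m * exp (2 * C * s)) has_integral
      v m * exp (2 * C * m) / (2 * C) - v m * exp (2 * C * 0) / (2 * C)) {0..m}"
    using m(1) C by (intro fundamental_theorem_of_calculus)
      (auto intro!: derivative_eq_intros simp flip: has_real_derivative_iff_has_vector_derivative)
  have vm: "0 \<le> v m" unfolding v_def using nonneg m(1) by simp
  have si: "set_integrable lborel {0..m} u"
    using cont m(1) by (intro borel_integrable_atLeastAtMost' continuous_on_subset[OF cont]) auto
  have sj: "set_integrable lborel {0..m} (\<lambda>s. v m * exp (2 * C * s))"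
    by (intro borel_integrable_atLeastAtMost' continuous_intros)
  have "u m \<le> C * (LINT s:{0..m}|lborel. u s)" by (rule le[OF m(1)])
  also have "\<dots> \<le> C * (LINT s:{0..m}|lborel. v m * exp (2 * C * s))"
    using C m(1) by (intro mult_left_mono set_integral_mono si sj u_le) auto
  also have "(LINT s:{0..m}|lborel. v m * exp (2 * C * s)) =
      v m * exp (2 * C * m) / (2 * C) - v m * exp (2 * C * 0) / (2 * C)"
    by (rule trans[OF set_borel_integral_eq_integral(2)[OF sj] integral_unique[OF I]])
  also have "C * \<dots> \<le> u m / 2"
    using C vm unfolding v_def by (simp add: field_simps exp_add[symmetric])
  finally have "u m \<le> 0" by simp
  then have "v m \<le> 0" unfolding v_def by (simp add: mult_nonpos_nonneg)
  then have "u t \<le> 0" using u_le[OF t] vm by simp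
  then show ?thesis using nonneg[OF t] by simp
qed

text \<open>
  Such a function has derivative zero everywhere.
\<close>

lemma constant_of_quadratic_increments:
  fixes G :: "real \<Rightarrow> real"
  assumes quad: "\<And>s t. 0 \<le> s \<Longrightarrow> s \<le> t \<Longrightarrow> t \<le> T \<Longrightarrow> \<bar>G t - G s\<bar> \<le> c * (t - s)\<^sup>2"
    and t: "t \<in> {0..T}"
  shows "G t = G 0"
proof -
  have "(G has_real_derivative 0) (at x within {0..T})" if x: "x \<in> {0..T}" for x
    unfolding has_field_derivative_iff
  proof (rule Lim_null_comparison[where g = "\<lambda>y. \<bar>c\<bar> * \<bar>y - x\<bar>"])
    have "norm ((G y - G x) / (y - x) - 0) \<le> \<bar>c\<bar> * \<bar>y - x\<bar>" if "y \<in> {0..T}" "y \<noteq> x" for y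
    proof -
      have "\<bar>G y - G x\<bar> \<le> c * (y - x)\<^sup>2"
      proof (cases "x \<le> y")
        case True
        then show ?thesis using quad[of x y] x that by auto
      next
        case False
        then show ?thesis using quad[of y x] x that by (auto simp: abs_minus_commute power2_commute)
      qed
      also have "\<dots> \<le> \<bar>c\<bar> * (\<bar>y - x\<bar> * \<bar>y - x\<bar>)"
        by (simp add: power2_eq_square mult_right_mono)
      finally show ?thesis using that by (simp add: divide_le_eq abs_divide algebra_simps)
    qed
    then show "\<forall>\<^sub>F y in at x within {0..T}. norm ((G y - G x) / (y - x)) \<le> \<bar>c\<bar> * \<bar>y - x\<bar>"
      by (auto simp: eventually_at_topological intro!: exI[of _ UNIV])
    show "((\<lambda>y. \<bar>c\<bar> * \<bar>y - x\<bar>) \<longlongrightarrow> 0) (at x within {0..T})"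
      by (auto intro!: tendsto_eq_intros)
  qed
  then have "\<exists>k. \<forall>x\<in>{0..T}. G x = k"
    by (intro has_field_derivative_zero_constant) auto
  then show ?thesis using t by force
qed

text \<open>
  A smoothing of the positive part: \<open>ramp e x = x\<^sup>2 / (x + e)\<close> for \<open>x \<ge> 0\<close>, written so that no case
  distinction occurs.  Its derivative \<open>ramp' e\<close> vanishes on the negative half line \<^emph>\<open>and at \<open>0\<close>\<close>, so
  that it tends to the indicator of \<open>x > 0\<close> and not to a value in between at \<open>x = 0\<close>.
\<close>

definition ramp :: "real \<Rightarrow> real \<Rightarrow> real" where
  "ramp e x = max 0 x - e + e\<^sup>2 / (max 0 x + e)"

definition ramp' :: "real \<Rightarrow> real \<Rightarrow> real" where
  "ramp' e x = 1 - e\<^sup>2 / (max 0 x + e)\<^sup>2"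

lemma ramp'_bounds: "e > 0 \<Longrightarrow> 0 \<le> ramp' e x \<and> ramp' e x \<le> 1"
  unfolding ramp'_def by (auto simp: divide_le_eq intro!: power_mono)

lemma ramp'_lipschitz:
  assumes e: "e > 0"
  shows "\<bar>ramp' e x - ramp' e y\<bar> \<le> 2 / e * \<bar>x - y\<bar>"
proof -
  define a b where "a = e / (max 0 x + e)" and "b = e / (max 0 y + e)"
  have ab: "0 \<le> a" "a \<le> 1" "0 \<le> b" "b \<le> 1" unfolding a_def b_def using e by (auto simp: divide_le_eq)
  have "a - b = e * (max 0 y - max 0 x) / ((max 0 x + e) * (max 0 y + e))"
    unfolding a_def b_def using e by (simp add: field_simps max_def add_pos_nonneg)
  then have "\<bar>a - b\<bar> = e * \<bar>max 0 y - max 0 x\<bar> / ((max 0 x + e) * (max 0 y + e))"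
    using e by (simp add: abs_mult)
  also have "\<dots> \<le> e * \<bar>x - y\<bar> / (e * e)"
    using e by (intro frac_le mult_mono) auto
  finally have "\<bar>a - b\<bar> \<le> \<bar>x - y\<bar> / e" using e by simp
  moreover have "ramp' e x - ramp' e y = (b - a) * (a + b)"
    unfolding ramp'_def a_def b_def by (simp add: power_divide algebra_simps power2_eq_square)
  ultimately have "\<bar>ramp' e x - ramp' e y\<bar> \<le> \<bar>x - y\<bar> / e * 2"
    using ab by (simp only: abs_mult) (rule mult_mono, auto simp: abs_minus_commute)
  then show ?thesis by (simp add: mult.commute)
qed

lemma ramp_deriv:
  assumes e: "e > 0"
  shows "(ramp e has_real_derivative ramp' e x) (at x)"
proof -
  have pos: "((\<lambda>x. x - e + e\<^sup>2 / (x + e)) has_real_derivative ramp' e y) (at y within S)"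
    if "y \<ge> 0" for y S
    unfolding ramp'_def using that e
    by (auto intro!: derivative_eq_intros simp: max_def power2_eq_square)
  consider "x > 0" | "x < 0" | "x = 0" by linarith
  then show ?thesis
  proof cases
    case 1
    show ?thesis
      by (rule has_field_derivative_transform_within_open[OF pos, where S = "{0<..}"])
        (use 1 in \<open>auto simp: ramp_def max_def\<close>)
  next
    case 2
    have "((\<lambda>x. 0) has_real_derivative ramp' e x) (at x)"
      using 2 e by (simp add: ramp'_def)
    then show ?thesis
      by (rule has_field_derivative_transform_within_open[where S = "{..<0}"])
        (use 2 e in \<open>auto simp: ramp_def power2_eq_square\<close>)
  next
    case 3
    have "((\<lambda>y. (ramp e y - ramp e 0) / (y - 0)) \<longlongrightarrow> 0) (at 0)"
    proof (rule Lim_null_comparison[where g = "\<lambda>y. \<bar>y\<bar> / e"])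
      have "norm ((ramp e y - ramp e 0) / (y - 0)) \<le> \<bar>y\<bar> / e" for y
      proof (cases "y > 0")
        case True
        then have "ramp e y - ramp e 0 = y\<^sup>2 / (y + e)"
          using e by (simp add: ramp_def field_simps power2_eq_square)
        then have "(ramp e y - ramp e 0) / (y - 0) = y / (y + e)"
          using True by (simp add: power2_eq_square)
        then show ?thesis using True e by (simp add: frac_le)
      next
        case False
        then have "ramp e y = 0" using e by (simp add: ramp_def power2_eq_square)
        moreover have "ramp e 0 = 0" using e by (simp add: ramp_def power2_eq_square)
        ultimately show ?thesis using e by simp
      qed
      then show "\<forall>\<^sub>F y in at 0. norm ((ramp e y - ramp e 0) / (y - 0)) \<le> \<bar>y\<bar> / e" by simp
      show "((\<lambda>y. \<bar>y\<bar> / e) \<longlongrightarrow> 0) (at 0)" using e by (auto intro!: tendsto_eq_intros)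
    qed
    then show ?thesis unfolding 3 has_field_derivative_iff using e by (simp add: ramp'_def)
  qed
qed

lemma ramp_taylor:
  assumes e: "e > 0"
  shows "\<bar>ramp e y - ramp e x - ramp' e x * (y - x)\<bar> \<le> 2 / e * (y - x)\<^sup>2"
proof -
  have *: "\<exists>z. \<bar>z - x\<bar> \<le> \<bar>y - x\<bar> \<and> ramp e y - ramp e x = ramp' e z * (y - x)"
  proof (cases x y rule: linorder_cases)
    case less
    then obtain z where "z > x" "z < y" "ramp e y - ramp e x = (y - x) * ramp' e z"
      using MVT2[of x y "ramp e" "ramp' e"] ramp_deriv[OF e] by blast
    then show ?thesis by (intro exI[of _ z]) auto
  next
    case greater
    then obtain z where "z > y" "z < x" "ramp e x - ramp e y = (x - y) * ramp' e z"
      using MVT2[of y x "ramp e" "ramp' e"] ramp_deriv[OF e] by blast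
    then show ?thesis by (intro exI[of _ z]) (auto simp: algebra_simps)
  qed auto
  then obtain z where z: "\<bar>z - x\<bar> \<le> \<bar>y - x\<bar>" "ramp e y - ramp e x = ramp' e z * (y - x)" by blast
  have "\<bar>ramp e y - ramp e x - ramp' e x * (y - x)\<bar> = \<bar>ramp' e z - ramp' e x\<bar> * \<bar>y - x\<bar>"
    unfolding z(2) by (simp add: abs_mult[symmetric] algebra_simps)
  also have "\<dots> \<le> (2 / e * \<bar>y - x\<bar>) * \<bar>y - x\<bar>"
    using ramp'_lipschitz[OF e, of z x] z(1) e
    by (intro mult_right_mono order_trans[OF ramp'_lipschitz[OF e]]) (auto simp: divide_right_mono)
  finally show ?thesis by (simp add: power2_eq_square)
qed

lemma ramp_limits:
  assumes e: "\<And>n. e n > 0" "e \<longlonglongrightarrow> 0"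
  shows "(\<lambda>n. ramp (e n) x) \<longlonglongrightarrow> max 0 x"
    and "(\<lambda>n. ramp' (e n) x) \<longlonglongrightarrow> (if x > 0 then 1 else 0)"
proof -
  show "(\<lambda>n. ramp (e n) x) \<longlonglongrightarrow> max 0 x"
  proof (cases "x > 0")
    case True
    then show ?thesis unfolding ramp_def using e(2) by (auto intro!: tendsto_eq_intros)
  next
    case False
    then have "ramp (e n) x = 0" for n using e(1)[of n] by (simp add: ramp_def power2_eq_square)
    then show ?thesis using False by simp
  qed
  show "(\<lambda>n. ramp' (e n) x) \<longlonglongrightarrow> (if x > 0 then 1 else 0)"
  proof (cases "x > 0")
    case True
    then show ?thesis unfolding ramp'_def using e(2) by (auto intro!: tendsto_eq_intros)
  next
    case False
    then have "ramp' (e n) x = 0" for n using e(1)[of n] by (simp add: ramp'_def)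
    then show ?thesis using False by simp
  qed
qed

text \<open>
  The chain rule for the positive part of an absolutely continuous function, which identifies the
  drift of the maximum of two states.  For the smoothed positive part, the two sides differ by a
  function with quadratically small increments: Taylor's formula for \<open>ramp e\<close> bounds the increments
  of \<open>ramp e \<circ> D\<close>, and the Lipschitz bound for \<open>ramp' e\<close> bounds those of the integral.  Then \<open>e\<close>
  tends to \<open>0\<close> by dominated convergence.
\<close>

lemma positive_part_of_integral:
  fixes d :: "real \<Rightarrow> real"
  assumes d_m: "set_borel_measurable borel {0..T} d" and d_bd: "\<And>s. s \<in> {0..T} \<Longrightarrow> \<bar>d s\<bar> \<le> K"
    and D: "\<And>t. t \<in> {0..T} \<Longrightarrow> D t = (LINT s:{0..t}|lborel. d s)"
    and t: "t \<in> {0..T}"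
  shows "max 0 (D t) = (LINT s:{0..t}|lborel. (if D s > 0 then d s else 0))"
proof -
  have K: "0 \<le> K" using d_bd[OF t] by linarith
  have d_int: "set_integrable lborel A d" if "A \<subseteq> {0..T}" "A \<in> sets lborel" for A
    by (rule set_integrable_subset[OF integrable_on_Icc_of_bounded[OF d_m d_bd]]) (use that in auto)
  note split = set_integral_Icc_split
  have D_lip: "\<bar>D t - D s\<bar> \<le> K * (t - s)" if "0 \<le> s" "s \<le> t" "t \<le> T" for s t
    using set_integral_Icc_lipschitz[OF d_m d_bd that] D that by simp
  \<comment> \<open>A version of \<open>D\<close> that is continuous on the whole line, hence Borel measurable.\<close>
  define D' where "D' s = D (max 0 (min T s))" for s
  have D'_lip: "\<bar>D' x - D' y\<bar> \<le> K * \<bar>x - y\<bar>" for x y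
  proof -
    define x' y' where "x' = max 0 (min T x)" and "y' = max 0 (min T y)"
    have xy: "0 \<le> x'" "x' \<le> T" "0 \<le> y'" "y' \<le> T" "\<bar>x' - y'\<bar> \<le> \<bar>x - y\<bar>"
      using t unfolding x'_def y'_def by auto
    have "\<bar>D x' - D y'\<bar> \<le> K * \<bar>x' - y'\<bar>"
      using D_lip[of x' y'] D_lip[of y' x'] xy by (cases "x' \<le> y'") auto
    also have "\<dots> \<le> K * \<bar>x - y\<bar>" using K xy by (intro mult_left_mono)
    finally show ?thesis unfolding D'_def x'_def y'_def .
  qed
  have "continuous_on UNIV D'"
    by (rule lipschitz_on_continuous_on[of K]) (use D'_lip K in \<open>auto simp: lipschitz_on_def
        dist_real_def\<close>)
  then have D'_m: "D' \<in> borel_measurable borel" by (rule borel_measurable_continuous_onI)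
  have D'_D: "D' s = D s" if "s \<in> {0..T}" for s using that unfolding D'_def by auto
  have prod_m: "set_borel_measurable borel {0..T} (\<lambda>s. h (D s) * d s)"
    if h: "h \<in> borel_measurable borel" for h :: "real \<Rightarrow> real"
  proof -
    have "(\<lambda>s. h (D' s) * (indicator {0..T} s *\<^sub>R d s)) \<in> borel_measurable borel"
      using d_m D'_m h unfolding set_borel_measurable_def by measurable
    also have "(\<lambda>s. h (D' s) * (indicator {0..T} s *\<^sub>R d s))
        = (\<lambda>s. indicator {0..T} s *\<^sub>R (h (D s) * d s))"
      using D'_D by (auto simp: indicator_def)
    finally show ?thesis unfolding set_borel_measurable_def .
  qed
  have ramp'_m: "ramp' e \<in> borel_measurable borel" for e
    unfolding ramp'_def[abs_def] by measurable
  have ramp_eq: "ramp e (D t) = (LINT s:{0..t}|lborel. ramp' e (D s) * d s)" if e: "e > 0" for e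
  proof -
    define G where "G x = ramp e (D x) - (LINT s:{0..x}|lborel. ramp' e (D s) * d s)" for x
    have int: "set_integrable lborel {0..T} (\<lambda>s. ramp' e (D s) * d s)"
    proof (rule integrable_on_Icc_of_bounded[OF prod_m[OF ramp'_m]])
      show "\<bar>ramp' e (D s) * d s\<bar> \<le> K" if "s \<in> {0..T}" for s
        using mult_mono[of "\<bar>ramp' e (D s)\<bar>" 1 "\<bar>d s\<bar>" K] d_bd[OF that] ramp'_bounds[OF e, of "D s"]
        by (auto simp: abs_mult)
    qed simp
    have "G t = G 0"
    proof (rule constant_of_quadratic_increments[where T = T and c = "4 * K\<^sup>2 / e"])
      fix s t assume st: "0 \<le> s" "s \<le> t" "t \<le> T"
      have si: "set_integrable lborel {s<..t} d"
          "set_integrable lborel {s<..t} (\<lambda>s. ramp' e (D s) * d s)"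
        using st by (auto intro: d_int set_integrable_subset[OF int])
      have "G t - G s = ramp e (D t) - ramp e (D s) - (LINT r:{s<..t}|lborel. ramp' e (D r) * d r)"
        unfolding G_def using split[OF st int] by simp
      also have "\<dots> = (ramp e (D t) - ramp e (D s) - ramp' e (D s) * (D t - D s))
          - (LINT r:{s<..t}|lborel. ramp' e (D r) * d r - ramp' e (D s) * d r)"
        using D split[OF st d_int] st si by (simp add: algebra_simps)
      finally have "\<bar>G t - G s\<bar> \<le> \<bar>ramp e (D t) - ramp e (D s) - ramp' e (D s) * (D t - D s)\<bar>
          + \<bar>LINT r:{s<..t}|lborel. ramp' e (D r) * d r - ramp' e (D s) * d r\<bar>" by linarith
      also have "\<dots> \<le> 2 / e * (K * (t - s))\<^sup>2 + (2 / e * (K * (t - s)) * K) * (t - s)"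
      proof (intro add_mono order_trans[OF ramp_taylor[OF e]] abs_integral_Ioc_le)
        have "\<bar>D t - D s\<bar>\<^sup>2 \<le> (K * (t - s))\<^sup>2" using D_lip[OF st] by (intro power_mono) auto
        then show "2 / e * (D t - D s)\<^sup>2 \<le> 2 / e * (K * (t - s))\<^sup>2"
          using e by (intro mult_left_mono) auto
        fix r assume r: "s < r" "r \<le> t"
        have "\<bar>ramp' e (D r) - ramp' e (D s)\<bar> \<le> 2 / e * \<bar>D r - D s\<bar>" by (rule ramp'_lipschitz[OF e])
        also have "\<dots> \<le> 2 / e * (K * (t - s))"
          using D_lip[of s r] r st K e
          by (intro mult_left_mono order_trans[OF D_lip[of s r]]) auto
        finally have "\<bar>ramp' e (D r) - ramp' e (D s)\<bar> * \<bar>d r\<bar> \<le> 2 / e * (K * (t - s)) * K"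
          using d_bd[of r] r st K e by (intro mult_mono) auto
        then show "\<bar>ramp' e (D r) * d r - ramp' e (D s) * d r\<bar> \<le> 2 / e * (K * (t - s)) * K"
          by (simp add: abs_mult[symmetric] left_diff_distrib)
      qed (use st in auto)
      also have "\<dots> = 4 * K\<^sup>2 / e * (t - s)\<^sup>2"
        using e by (simp add: power2_eq_square field_simps)
      finally show "\<bar>G t - G s\<bar> \<le> 4 * K\<^sup>2 / e * (t - s)\<^sup>2" .
    qed (use t in auto)
    moreover have null: "(LINT s:{0..0}|lborel. h s) = 0" for h :: "real \<Rightarrow> real"
      unfolding set_lebesgue_integral_def
      by (rule integral_eq_zero_AE, use AE_lborel_singleton[of 0] in eventually_elim) auto
    moreover have "D 0 = 0" using D[of 0] t null[of d] by simp
    ultimately show ?thesis using e null[of "\<lambda>s. ramp' e (D s) * d s"]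
      by (simp only: G_def) (simp add: ramp_def power2_eq_square)
  qed
  define e :: "nat \<Rightarrow> real" where "e n = inverse (real (Suc n))" for n
  have e: "\<And>n. e n > 0" "e \<longlonglongrightarrow> 0" unfolding e_def using LIMSEQ_inverse_real_of_nat by simp_all
  have m0t: "set_borel_measurable borel {0..t} f" if "set_borel_measurable borel {0..T} f" for f ::
      "real \<Rightarrow> real"
    by (rule set_borel_measurable_subset[OF that]) (use t in auto)
  define p where "p s = (if D s > 0 then 1 else 0) * d s" for s
  have pos_eq: "(\<lambda>s. if D s > 0 then d s else 0) = p" unfolding p_def by auto
  have lb: "borel_measurable lborel = (borel_measurable borel :: (real \<Rightarrow> real) set)" by simp
  have sgn_m: "(\<lambda>x. if x > 0 then 1 else 0 :: real) \<in> borel_measurable (borel :: real measure)"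
      by measurable
  have lim: "(\<lambda>n. LINT s:{0..t}|lborel. ramp' (e n) (D s) * d s) \<longlonglongrightarrow>
      (LINT s:{0..t}|lborel. p s)"
    unfolding set_lebesgue_integral_def
  proof (rule integral_dominated_convergence[where w = "\<lambda>s. indicator {0..t} s * K"
        and f = "\<lambda>s. indicator {0..t} s *\<^sub>R p s"
        and s = "\<lambda>n s. indicator {0..t} s *\<^sub>R (ramp' (e n) (D s) * d s)"])
    show "(\<lambda>s. indicat_real {0..t} s *\<^sub>R p s) \<in> borel_measurable lborel"
      using m0t[OF prod_m[OF sgn_m]] unfolding set_borel_measurable_def p_def lb .
    show "(\<lambda>s. indicat_real {0..t} s *\<^sub>R (ramp' (e n) (D s) * d s)) \<in> borel_measurable lborel" for n
      using m0t[OF prod_m[OF ramp'_m[of "e n"]]] unfolding set_borel_measurable_def lb .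
    show "integrable lborel (\<lambda>s. indicat_real {0..t} s * K)" using t by simp
    show "AE s in lborel. (\<lambda>n. indicat_real {0..t} s *\<^sub>R (ramp' (e n) (D s) * d s))
        \<longlonglongrightarrow> indicat_real {0..t} s *\<^sub>R p s"
      unfolding p_def by (intro AE_I2 tendsto_scaleR[OF tendsto_const] tendsto_mult[OF
          ramp_limits(2)[OF e] tendsto_const])
    show "AE s in lborel. norm (indicat_real {0..t} s *\<^sub>R (ramp' (e n) (D s) * d s))
        \<le> indicat_real {0..t} s * K" for n
    proof (rule AE_I2)
      fix s
      show "norm (indicat_real {0..t} s *\<^sub>R (ramp' (e n) (D s) * d s)) \<le> indicat_real {0..t} s * K"
      proof (cases "s \<in> {0..t}")
        case True
        have "\<bar>ramp' (e n) (D s)\<bar> * \<bar>d s\<bar> \<le> 1 * K"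
          using ramp'_bounds[OF e(1)[of n], of "D s"] d_bd[of s] True t by (intro mult_mono) auto
        then show ?thesis using True by (simp add: abs_mult)
      qed simp
    qed
  qed
  show ?thesis
    unfolding pos_eq by (rule LIMSEQ_unique[OF ramp_limits(1)[OF e, of "D t"]])
      (use lim in \<open>simp add: ramp_eq[OF e(1)]\<close>)
qed

section \<open>Extended integrals\<close>

lemma ext_integral_gt_minf_iff: "- \<infinity> < ext_integral M h \<longleftrightarrow> (\<integral>\<^sup>+x. e2ennreal (- h x) \<partial>M) \<noteq> \<infinity>"
proof (cases "(\<integral>\<^sup>+x. e2ennreal (- h x) \<partial>M)")
  case (real r)
  then show ?thesis unfolding ext_integral_def Let_def
    by (cases "\<integral>\<^sup>+x. e2ennreal (h x) \<partial>M") (auto simp: enn2ereal_ennreal)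
qed (simp add: ext_integral_def Let_def)

lemma ext_integral_gt_minf_AE:
  assumes "h \<in> borel_measurable M" "- \<infinity> < ext_integral M h"
  shows "AE x in M. - \<infinity> < h x"
proof -
  have "AE x in M. e2ennreal (- h x) \<noteq> \<infinity>"
    using assms unfolding ext_integral_gt_minf_iff by (intro nn_integral_PInf_AE) measurable
  then show ?thesis
  proof eventually_elim
    case (elim x)
    then show ?case by (cases "h x") auto
  qed
qed

lemma ext_integral_eq_integral:
  assumes h: "h \<in> borel_measurable M"
    and p: "(\<integral>\<^sup>+x. e2ennreal (h x) \<partial>M) \<noteq> \<infinity>" and n: "(\<integral>\<^sup>+x. e2ennreal (- h x) \<partial>M) \<noteq> \<infinity>"
  shows "AE x in M. \<bar>h x\<bar> \<noteq> \<infinity>"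
    and "integrable M (\<lambda>x. real_of_ereal (h x))"
    and "ext_integral M h = ereal (\<integral>x. real_of_ereal (h x) \<partial>M)"
proof -
  have "AE x in M. e2ennreal (h x) \<noteq> \<infinity>" using p h by (intro nn_integral_PInf_AE) measurable
  moreover have "AE x in M. e2ennreal (- h x) \<noteq> \<infinity>" using n h by (intro nn_integral_PInf_AE) measurable
  ultimately show fin: "AE x in M. \<bar>h x\<bar> \<noteq> \<infinity>"
  proof eventually_elim
    case (elim x)
    then show ?case by (cases "h x") auto
  qed
  have eq: "(\<integral>\<^sup>+x. ennreal (real_of_ereal (h x)) \<partial>M) = (\<integral>\<^sup>+x. e2ennreal (h x) \<partial>M)"
    "(\<integral>\<^sup>+x. ennreal (- real_of_ereal (h x)) \<partial>M) = (\<integral>\<^sup>+x. e2ennreal (- h x) \<partial>M)"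
    by (rule nn_integral_cong_AE, use fin in eventually_elim, auto simp: ereal_real'
        e2ennreal_ereal[symmetric] simp del: e2ennreal_ereal)+
  show int: "integrable M (\<lambda>x. real_of_ereal (h x))"
    unfolding real_integrable_def eq using h p n by auto
  show "ext_integral M h = ereal (\<integral>x. real_of_ereal (h x) \<partial>M)"
    unfolding real_lebesgue_integral_def[OF int] eq ext_integral_def Let_def using p n
    by (cases "\<integral>\<^sup>+x. e2ennreal (h x) \<partial>M"; cases
        "\<integral>\<^sup>+x. e2ennreal (- h x) \<partial>M") (auto simp: enn2ereal_ennreal)
qed

lemma ext_integral_finite_parts:
  assumes "- \<infinity> < ext_integral M h" "ext_integral M h < \<infinity>"
  shows "(\<integral>\<^sup>+x. e2ennreal (h x) \<partial>M) \<noteq> \<infinity>" "(\<integral>\<^sup>+x. e2ennreal (- h x) \<partial>M) \<noteq> \<infinity>"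
proof -
  show n: "(\<integral>\<^sup>+x. e2ennreal (- h x) \<partial>M) \<noteq> \<infinity>" using assms(1) unfolding ext_integral_gt_minf_iff .
  show "(\<integral>\<^sup>+x. e2ennreal (h x) \<partial>M) \<noteq> \<infinity>"
  proof
    assume "(\<integral>\<^sup>+x. e2ennreal (h x) \<partial>M) = \<infinity>"
    then have "ext_integral M h = \<infinity>"
      using n unfolding ext_integral_def Let_def
      by (cases "\<integral>\<^sup>+x. e2ennreal (- h x) \<partial>M") (auto simp: enn2ereal_ennreal)
    then show False using assms(2) by simp
  qed
qed

text \<open>
  The only way in which the submodularity of the costs is integrated.  An upper bound for \<open>k1 + k2\<close> by
  an integrable function, together with integrable negative parts of \<open>k1\<close> and \<open>k2\<close>, makes both of
  them integrable.  It is used twice, first in time and then on the sample space, where the integrands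
  are themselves extended integrals and may be infinite; hence the extended real values.
\<close>

lemma ext_integral_exchange:
  fixes h1 h2 k1 k2 :: "'a \<Rightarrow> ereal"
  assumes m: "h1 \<in> borel_measurable M" "h2 \<in> borel_measurable M" "k1 \<in> borel_measurable M"
      "k2 \<in> borel_measurable M"
    and h: "- \<infinity> < ext_integral M h1" "ext_integral M h1 < \<infinity>" "- \<infinity> < ext_integral M h2"
        "ext_integral M h2 < \<infinity>"
    and k: "- \<infinity> < ext_integral M k1" "- \<infinity> < ext_integral M k2"
    and le: "AE x in M. k1 x + k2 x \<le> h1 x + h2 x"
  shows "\<bar>ext_integral M k1\<bar> \<noteq> \<infinity>" "\<bar>ext_integral M k2\<bar> \<noteq> \<infinity>"
    and "ext_integral M k1 + ext_integral M k2 \<le> ext_integral M h1 + ext_integral M h2"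
proof -
  note e1 = ext_integral_eq_integral[OF m(1) ext_integral_finite_parts[OF h(1,2)]]
  note e2 = ext_integral_eq_integral[OF m(2) ext_integral_finite_parts[OF h(3,4)]]
  note kn = k[unfolded ext_integral_gt_minf_iff]
  have fin: "AE x in M. \<bar>h1 x\<bar> \<noteq> \<infinity> \<and> \<bar>h2 x\<bar> \<noteq> \<infinity> \<and> \<bar>k1 x\<bar> \<noteq> \<infinity> \<and> \<bar>k2 x\<bar> \<noteq> \<infinity>"
    using e1(1) e2(1) le ext_integral_gt_minf_AE[OF m(3) k(1)] ext_integral_gt_minf_AE[OF m(4) k(2)]
  proof eventually_elim
    case (elim x)
    then show ?case by (cases "h1 x"; cases "h2 x"; cases "k1 x"; cases "k2 x") auto
  qed
  have pos_part: "ennreal (max 0 r) = ennreal r" for r by (simp add: max_def ennreal_neg)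
  have kp: "(\<integral>\<^sup>+x. e2ennreal (k x) \<partial>M) \<noteq> \<infinity>"
    if km: "k \<in> borel_measurable M" "k' \<in> borel_measurable M" and k'n:
        "(\<integral>\<^sup>+x. e2ennreal (- k' x) \<partial>M) \<noteq> \<infinity>"
      and AEk: "AE x in M. \<bar>k x\<bar> \<noteq> \<infinity> \<and> \<bar>k' x\<bar> \<noteq> \<infinity> \<and> k x + k' x \<le> h1 x + h2 x" for k k'
  proof -
    have "(\<integral>\<^sup>+x. e2ennreal (k x) \<partial>M) \<le> (\<integral>\<^sup>+x. e2ennreal (h1 x) + e2ennreal (h2 x) + e2ennreal (- k'
        x) \<partial>M)"
    proof (rule nn_integral_mono_AE, use fin AEk in eventually_elim)
      case (elim x)
      then obtain a b c d where r: "h1 x = ereal a" "h2 x = ereal b" "k x = ereal c" "k' x = ereal d"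
        by (cases "h1 x"; cases "h2 x"; cases "k x"; cases "k' x") auto
      then have "c \<le> a + b - d" using elim by auto
      then have "ennreal c \<le> ennreal (max 0 a + max 0 b + max 0 (- d))" by (intro ennreal_leI) auto
      also have "\<dots> = ennreal a + ennreal b + ennreal (- d)"
        by (simp add: pos_part)
      finally show ?case by (simp add: r)
    qed
    also have "\<dots> = (\<integral>\<^sup>+x. e2ennreal (h1 x) \<partial>M) + (\<integral>\<^sup>+x. e2ennreal (h2 x)
        \<partial>M) + (\<integral>\<^sup>+x. e2ennreal (- k' x) \<partial>M)"
      using m km by (simp add: nn_integral_add)
    also have "\<dots> < \<infinity>"
      using ext_integral_finite_parts(1)[OF h(1,2)] ext_integral_finite_parts(1)[OF h(3,4)] k'n
          by (simp add: less_top)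
    finally show ?thesis by simp
  qed
  have AE1: "AE x in M. \<bar>k1 x\<bar> \<noteq> \<infinity> \<and> \<bar>k2 x\<bar> \<noteq> \<infinity> \<and> k1 x + k2 x \<le> h1 x + h2 x"
    using fin le by eventually_elim auto
  have AE2: "AE x in M. \<bar>k2 x\<bar> \<noteq> \<infinity> \<and> \<bar>k1 x\<bar> \<noteq> \<infinity> \<and> k2 x + k1 x \<le> h1 x + h2 x"
    using fin le by eventually_elim (auto simp: add.commute)
  note f1 = ext_integral_eq_integral[OF m(3) kp[OF m(3,4) kn(2) AE1] kn(1)]
  note f2 = ext_integral_eq_integral[OF m(4) kp[OF m(4,3) kn(1) AE2] kn(2)]
  show "\<bar>ext_integral M k1\<bar> \<noteq> \<infinity>" "\<bar>ext_integral M k2\<bar> \<noteq> \<infinity>" unfolding f1(3) f2(3) by simp_all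
  have "(\<integral>x. real_of_ereal (k1 x) + real_of_ereal (k2 x) \<partial>M)
      \<le> (\<integral>x. real_of_ereal (h1 x) + real_of_ereal (h2 x) \<partial>M)"
  proof (rule integral_mono_AE)
    show "AE x in M. real_of_ereal (k1 x) + real_of_ereal (k2 x)
        \<le> real_of_ereal (h1 x) + real_of_ereal (h2 x)"
      using fin le
    proof eventually_elim
      case (elim x)
      then show ?case by (cases "h1 x"; cases "h2 x"; cases "k1 x"; cases "k2 x") auto
    qed
  qed (use e1 e2 f1 f2 in auto)
  then show "ext_integral M k1 + ext_integral M k2 \<le> ext_integral M h1 + ext_integral M h2"
    unfolding e1(3) e2(3) f1(3) f2(3) using e1(2) e2(2) f1(2) f2(2) by simp
qed

lemma (in sigma_finite_measure) borel_measurable_ext_integral: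
  assumes "(\<lambda>(x, y). f x y) \<in> borel_measurable (N \<Otimes>\<^sub>M M)"
  shows "(\<lambda>x. ext_integral M (f x)) \<in> borel_measurable N"
proof -
  have [measurable]: "(\<lambda>x. \<integral>\<^sup>+y. e2ennreal (f x y) \<partial>M) \<in> borel_measurable N"
    "(\<lambda>x. \<integral>\<^sup>+y. e2ennreal (- f x y) \<partial>M) \<in> borel_measurable N"
    using assms by (auto intro!: borel_measurable_nn_integral simp: case_prod_beta')
  show ?thesis unfolding ext_integral_def Let_def by measurable
qed

section \<open>Conditioning on the common noise\<close>

text \<open>
  What is known at the earlier time can be kept fixed while the independent increment \<open>N\<close> is integrated
  out: \<open>\<omega>\<close>, seen through the sub-\<open>\<sigma>\<close>-algebra \<open>F\<close>, and \<open>N\<close> have the product of their laws as joint law.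
\<close>

lemma (in prob_space) nn_integral_freezing:
  fixes N Y :: "'a \<Rightarrow> real" and Z :: "'a \<Rightarrow> ennreal" and h :: "real \<Rightarrow> ennreal"
  assumes F: "subalgebra M F" and N: "N \<in> borel_measurable M"
    and indep: "indep_set (sets F) (sets (vimage_algebra (space M) N borel))"
    and Z: "Z \<in> borel_measurable F" and Y: "Y \<in> borel_measurable F" and h: "h \<in> borel_measurable borel"
  shows "(\<integral>\<^sup>+\<omega>. Z \<omega> * h (Y \<omega> + N \<omega>) \<partial>M)
       = (\<integral>\<^sup>+\<omega>. Z \<omega> * (\<integral>\<^sup>+z. h (Y \<omega> + z) \<partial>distr M borel N) \<partial>M)"
proof -
  have spF: "space F = space M" and setsF: "sets F \<subseteq> sets M" using F unfolding subalgebra_def by auto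
  have idm: "(\<lambda>x. x) \<in> measurable M F" using measurable_from_subalg[OF F, of "\<lambda>x. x" F] by simp
  have pm: "(\<lambda>x. (x, N x)) \<in> measurable M (F \<Otimes>\<^sub>M borel)" using idm N by measurable
  interpret F: prob_space "distr M F (\<lambda>x. x)" by (rule prob_space_distr[OF idm])
  interpret Np: prob_space "distr M borel N" by (rule prob_space_distr[OF N])
  have eq: "distr M F (\<lambda>x. x) \<Otimes>\<^sub>M distr M borel N = distr M (F \<Otimes>\<^sub>M borel) (\<lambda>x. (x, N x))"
  proof (rule pair_measure_eqI)
    fix A B assume "A \<in> sets (distr M F (\<lambda>x. x))" "B \<in> sets (distr M borel N)"
    then have A: "A \<in> sets F" "A \<in> sets M" and B: "B \<in> sets borel" using setsF by auto
    have "N -` B \<inter> space M \<in> sets (vimage_algebra (space M) N borel)"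
      using B by (rule in_vimage_algebra)
    then have "prob (A \<inter> (N -` B \<inter> space M)) = prob A * prob (N -` B \<inter> space M)"
      using indep A(1) by (rule indep_setD[rotated 2])
    moreover have "(\<lambda>x. (x, N x)) -` (A \<times> B) \<inter> space M = A \<inter> (N -` B \<inter> space M)"
      using sets.sets_into_space[OF A(2)] by auto
    moreover have "(\<lambda>x. x) -` A \<inter> space M = A" using sets.sets_into_space[OF A(2)] by auto
    ultimately show "emeasure (distr M F (\<lambda>x. x)) A * emeasure (distr M borel N) B =
        emeasure (distr M (F \<Otimes>\<^sub>M borel) (\<lambda>x. (x, N x))) (A \<times> B)"
      using A B idm N pm by (simp add: emeasure_distr emeasure_eq_measure ennreal_mult'[symmetric])
  qed (auto intro: F.sigma_finite_measure_axioms Np.sigma_finite_measure_axioms cong: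
      sets_pair_measure_cong)
  define k where "k = (\<lambda>(\<omega>, z). Z \<omega> * h (Y \<omega> + z))"
  have km: "k \<in> borel_measurable (F \<Otimes>\<^sub>M borel)" unfolding k_def using Z Y h by measurable
  then have km': "k \<in> borel_measurable (distr M F (\<lambda>x. x) \<Otimes>\<^sub>M distr M borel N)"
    by (simp cong: measurable_cong_sets)
  have im: "(\<lambda>\<omega>. \<integral>\<^sup>+z. k (\<omega>, z) \<partial>distr M borel N) \<in> borel_measurable F"
    using Np.borel_measurable_nn_integral_fst[OF km'] by (simp cong: measurable_cong_sets)
  have "(\<integral>\<^sup>+\<omega>. Z \<omega> * h (Y \<omega> + N \<omega>) \<partial>M) = (\<integral>\<^sup>+x. k x \<partial>distr M (F \<Otimes>\<^sub>M borel) (\<lambda>x. (x, N x)))"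
    by (subst nn_integral_distr[OF pm]) (use km in \<open>auto simp: k_def\<close>)
  also have "\<dots> = (\<integral>\<^sup>+\<omega>. \<integral>\<^sup>+z. k (\<omega>, z) \<partial>distr M borel N \<partial>distr M F (\<lambda>x. x))"
    unfolding eq[symmetric] using Np.nn_integral_fst[OF km'] by simp
  also have "\<dots> = (\<integral>\<^sup>+\<omega>. \<integral>\<^sup>+z. k (\<omega>, z) \<partial>distr M borel N \<partial>M)"
    using im by (intro nn_integral_distr idm) simp
  also have "\<dots> = (\<integral>\<^sup>+\<omega>. Z \<omega> * (\<integral>\<^sup>+z. h (Y \<omega> + z) \<partial>distr M borel N) \<partial>M)"
  proof (rule nn_integral_cong)
    fix \<omega> assume "\<omega> \<in> space M"
    show "(\<integral>\<^sup>+z. k (\<omega>, z) \<partial>distr M borel N) = Z \<omega> * (\<integral>\<^sup>+z. h (Y \<omega> + z) \<partial>distr M borel N)"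
      unfolding k_def using h by (simp add: nn_integral_cmult)
  qed
  finally show ?thesis .
qed

lemma progressive_adapted:
  assumes "progressive T F X" "t \<in> {0..T}"
  shows "X t \<in> borel_measurable (F t)"
proof -
  have "(\<lambda>\<omega>. (\<omega>, t)) \<in> measurable (F t) (F t \<Otimes>\<^sub>M restrict_space borel {0..t})"
    using assms(2) by (intro measurable_Pair) (auto simp: space_restrict_space)
  moreover have "(\<lambda>(\<omega>, s). X s \<omega>) \<in> borel_measurable (F t \<Otimes>\<^sub>M restrict_space borel {0..t})"
    using assms unfolding progressive_def by simp
  ultimately have "(\<lambda>\<omega>. (\<lambda>(\<omega>, s). X s \<omega>) (\<omega>, t)) \<in> borel_measurable (F t)"
    by (rule measurable_compose)
  then show ?thesis by simp
qed

lemma progressive_jointly_measurable: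
  assumes "progressive T F X" "0 \<le> T" "subalgebra M (F T)"
  shows "(\<lambda>(\<omega>, s). X s \<omega>) \<in> borel_measurable (M \<Otimes>\<^sub>M restrict_space borel {0..T})"
proof -
  have "(\<lambda>x. x) \<in> measurable M (F T)" using measurable_from_subalg[OF assms(3), of "\<lambda>x. x" "F T"]
      by simp
  then have "(\<lambda>p. (fst p, snd p)) \<in> measurable (M \<Otimes>\<^sub>M restrict_space borel {0..T}) (F T \<Otimes>\<^sub>M
      restrict_space borel {0..T})"
    by measurable
  moreover have "(\<lambda>(\<omega>, s). X s \<omega>) \<in> borel_measurable (F T \<Otimes>\<^sub>M restrict_space borel {0..T})"
    using assms unfolding progressive_def by simp
  ultimately have "(\<lambda>p. (\<lambda>(\<omega>, s). X s \<omega>) (fst p, snd p))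
      \<in> borel_measurable (M \<Otimes>\<^sub>M restrict_space borel {0..T})"
    by (rule measurable_compose)
  then show ?thesis by simp
qed

context mfg_setting
begin

sublocale prob_space "Pm D" by (rule prob)

lemma Filt_measurable_mono:
  "X \<in> borel_measurable (Filt D s) \<Longrightarrow> 0 \<le> s \<Longrightarrow> s \<le> t \<Longrightarrow> t \<le> horizon D \<Longrightarrow> X \<in> borel_measurable (Filt D t)"
  using measurable_from_subalg[OF filt_mono] by blast

lemma Filt_measurable:
  "X \<in> borel_measurable (Filt D s) \<Longrightarrow> s \<in> {0..horizon D} \<Longrightarrow> X \<in> borel_measurable (Pm D)"
  using measurable_from_subalg[OF filt_sub] by blast

lemma common_adapted: "s \<in> {0..horizon D} \<Longrightarrow> common D s \<in> borel_measurable (Filt D s)"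
  using BM_common unfolding brownian_motion_def by blast

text \<open>
  The augmented filtration of the common noise is smaller than the given filtration, as the latter contains
  all null sets from time \<open>0\<close> on.
\<close>

lemma FB_generator_subset:
  assumes t: "t \<in> {0..horizon D}"
  shows "{common D s -` A \<inter> space (Pm D) | s A. s \<in> {0..t} \<and> A \<in> sets borel} \<union> null_sets (Pm D)
    \<subseteq> sets (Filt D t)"
proof -
  have "common D s -` A \<inter> space (Pm D) \<in> sets (Filt D t)" if "s \<in> {0..t}" "A \<in> sets borel"
      for s and A :: "real set"
  proof -
    have "common D s \<in> borel_measurable (Filt D t)"
      using Filt_measurable_mono[OF common_adapted, of s t] that t by auto
    from measurable_sets[OF this that(2)] show ?thesis
      using filt_sub[OF t] by (simp add: subalgebra_def)
  qed
  moreover have "null_sets (Pm D) \<subseteq> sets (Filt D t)"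
    using filt_null filt_mono[of 0 t] t unfolding subalgebra_def by auto
  ultimately show ?thesis by blast
qed

lemma space_FB [simp]: "space (FB D t) = space (Pm D)"
  unfolding FB_def by (rule space_measure_of) (auto dest: null_setsD2 sets.sets_into_space)

lemma sets_FB: "sets (FB D t) = sigma_sets (space (Pm D))
   ({common D s -` A \<inter> space (Pm D) | s A. s \<in> {0..t} \<and> A \<in> sets borel} \<union> null_sets (Pm D))"
  unfolding FB_def by (rule sets_measure_of) (auto dest: null_setsD2 sets.sets_into_space)

lemma FB_sub_Filt: assumes "t \<in> {0..horizon D}" shows "subalgebra (Filt D t) (FB D t)"
proof -
  have "sets (FB D t) \<subseteq> sets (Filt D t)"
    unfolding sets_FB using sets.sigma_sets_subset[OF FB_generator_subset[OF assms]] filt_sub[OF assms]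
    by (simp add: subalgebra_def)
  then show ?thesis using filt_sub[OF assms] by (simp add: subalgebra_def)
qed

lemma FB_sub: assumes "t \<in> {0..horizon D}" shows "subalgebra (Pm D) (FB D t)"
  using FB_sub_Filt[OF assms] filt_sub[OF assms] unfolding subalgebra_def by auto

lemma FB_mono: assumes "s \<le> t" shows "subalgebra (FB D t) (FB D s)"
proof -
  have "sets (FB D s) \<subseteq> sets (FB D t)"
    unfolding sets_FB by (rule sigma_sets_mono') (use assms in fastforce)
  then show ?thesis by (simp add: subalgebra_def)
qed

lemma common_FB_measurable: "0 \<le> s \<Longrightarrow> s \<le> t \<Longrightarrow> common D s \<in> borel_measurable (FB D t)"
  by (rule measurableI) (auto simp: sets_FB intro!: sigma_sets.Basic)

lemma sigma_finite_FB: "t \<in> {0..horizon D} \<Longrightarrow> sigma_finite_subalgebra (Pm D) (FB D t)"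
  using FB_sub finite_measure_axioms
  by (intro finite_measure_subalgebra_is_sigma_finite) (simp add: finite_measure_subalgebra_def
      finite_measure_subalgebra_axioms_def)

lemma brownian_expectation_given_past:
  fixes h :: "real \<Rightarrow> ennreal" and Z :: "'w \<Rightarrow> ennreal"
  assumes "0 \<le> r" "r < b" "b \<le> horizon D" and h: "h \<in> borel_measurable borel"
    and Z: "Z \<in> borel_measurable (Filt D r)"
  shows "(\<integral>\<^sup>+\<omega>. Z \<omega> * h (common D b \<omega>) \<partial>Pm D) =
    (\<integral>\<^sup>+\<omega>. Z \<omega> * (\<integral>\<^sup>+z. h (common D r \<omega> + z)
        \<partial>distr (Pm D) borel (\<lambda>\<omega>. common D b \<omega> - common D r \<omega>)) \<partial>Pm D)"
proof -
  have "common D b \<in> borel_measurable (Pm D)" "common D r \<in> borel_measurable (Pm D)"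
    using assms by (auto intro!: Filt_measurable[OF common_adapted])
  then have N: "(\<lambda>\<omega>. common D b \<omega> - common D r \<omega>) \<in> borel_measurable (Pm D)" by measurable
  show ?thesis
    using nn_integral_freezing[OF filt_sub[of r] N _ Z common_adapted[of r] h] assms BM_common
    unfolding brownian_motion_def by simp
qed

text \<open>
  The conditional expectation, given the \<^emph>\<open>large\<close> \<open>\<sigma>\<close>-algebra at time \<open>t\<close>, of a functional of finitely
  many values of the common noise depends on the common noise up to time \<open>t\<close> only.  This is the Markov
  property: as long as the last time \<open>b\<close> exceeds \<open>t\<close>, the increment from the last but one time
  (or from \<open>t\<close>) to \<open>b\<close> is integrated out, and the resulting function \<open>q\<close> is absorbed in an earlier factor.
\<close>

lemma cylinder_projection:
  assumes "finite S" "S \<subseteq> {0..horizon D}" and t: "t \<in> {0..horizon D}"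
    and "\<And>s. s \<in> S \<Longrightarrow> h s \<in> borel_measurable borel"
  shows "\<exists>V\<in>borel_measurable (FB D t). \<forall>Z\<in>borel_measurable (Filt D t).
    (\<integral>\<^sup>+\<omega>. Z \<omega> * (\<Prod>s\<in>S. h s (common D s \<omega>) :: ennreal) \<partial>Pm D) = (\<integral>\<^sup>+\<omega>. Z \<omega> * V \<omega> \<partial>Pm D)"
  using assms(1,2,4)
proof (induction S arbitrary: h rule: finite_linorder_max_induct)
  case empty
  show ?case by (rule bexI[of _ "\<lambda>_. 1"]) auto
next
  case (insert b S)
  have notin: "b \<notin> S" using insert.hyps by auto
  show ?case
  proof (cases "b \<le> t")
    case True
    have "(\<lambda>\<omega>. \<Prod>s\<in>insert b S. h s (common D s \<omega>)) \<in> borel_measurable (FB D t)"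
    proof (rule borel_measurable_prod_ennreal)
      fix s assume s: "s \<in> insert b S"
      then have "common D s \<in> borel_measurable (FB D t)"
        using insert.hyps(2) insert.prems(1) True
            by (intro common_FB_measurable) (auto dest: less_imp_le)
      from measurable_compose[OF this insert.prems(2)[OF s]]
      show "(\<lambda>\<omega>. h s (common D s \<omega>)) \<in> borel_measurable (FB D t)" .
    qed
    then show ?thesis by (intro bexI[of _ "\<lambda>\<omega>. \<Prod>s\<in>insert b S. h s (common D s \<omega>)"]) auto
  next
    case False
    \<comment> \<open>The latest time in \<open>S\<close>, but not before \<open>t\<close>: the increment from \<open>r\<close> to \<open>b\<close> is independent of all other factors.\<close>
    define r where "r = (if \<exists>s\<in>S. t \<le> s then Max S else t)"
    have r: "t \<le> r" "r < b" "\<And>s. s \<in> S \<Longrightarrow> s \<le> r" "r \<in> S \<or> r = t"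
    proof -
      have "t \<le> r \<and> r < b \<and> (\<forall>s\<in>S. s \<le> r) \<and> (r \<in> S \<or> r = t)"
      proof (cases "\<exists>s\<in>S. t \<le> s")
        case True
        then obtain s where s: "s \<in> S" "t \<le> s" by blast
        have "Max S \<in> S" "\<And>s. s \<in> S \<Longrightarrow> s \<le> Max S"
          using insert.hyps(1) s Max_in[of S] Max_ge[of S] by blast+
        then show ?thesis using True s insert.hyps(2) unfolding r_def by force
      next
        case ne: False
        then show ?thesis using False unfolding r_def by force
      qed
      then show "t \<le> r" "r < b" "\<And>s. s \<in> S \<Longrightarrow> s \<le> r" "r \<in> S \<or> r = t" by auto
    qed
    have rT: "0 \<le> r" "r \<le> horizon D" "b \<le> horizon D" using r t insert.prems(1) by auto
    define N where "N = distr (Pm D) borel (\<lambda>\<omega>. common D b \<omega> - common D r \<omega>)"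
    define q where "q x = (\<integral>\<^sup>+z. h b (x + z) \<partial>N)" for x
    have hb: "h b \<in> borel_measurable borel" using insert.prems(2) by simp
    have "common D b \<in> borel_measurable (Pm D)" "common D r \<in> borel_measurable (Pm D)"
      using rT r t by (auto intro!: Filt_measurable[OF common_adapted])
    then have "prob_space N" unfolding N_def by (intro prob_space_distr) measurable
    then interpret N: prob_space N .
    have q_m: "q \<in> borel_measurable borel"
    proof -
      have "(\<lambda>(x, z). h b (x + z)) \<in> borel_measurable (borel \<Otimes>\<^sub>M N)"
        unfolding N_def using hb by measurable
      from N.borel_measurable_nn_integral_fst[OF this] show ?thesis unfolding q_def by simp
    qed
    have step: "(\<integral>\<^sup>+\<omega>. Z \<omega> * (\<Prod>s\<in>insert b S. h s (common D s \<omega>)) \<partial>Pm D) =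
        (\<integral>\<^sup>+\<omega>. Z \<omega> * ((\<Prod>s\<in>S. h s (common D s \<omega>)) * q (common D r \<omega>)) \<partial>Pm D)"
      if Z: "Z \<in> borel_measurable (Filt D t)" for Z
    proof -
      have m1: "(\<lambda>\<omega>. Z \<omega> * (\<Prod>s\<in>S. h s (common D s \<omega>))) \<in> borel_measurable (Filt D r)"
      proof (intro borel_measurable_times_ennreal borel_measurable_prod_ennreal)
        show "Z \<in> borel_measurable (Filt D r)"
          using measurable_from_subalg[OF filt_mono Z] t r rT by auto
        fix s assume s: "s \<in> S"
        then have "common D s \<in> borel_measurable (Filt D r)"
          using insert.prems(1) r(3) rT by (intro Filt_measurable_mono[OF common_adapted]) auto
        from measurable_compose[OF this] insert.prems(2) s
        show "(\<lambda>\<omega>. h s (common D s \<omega>)) \<in> borel_measurable (Filt D r)" by auto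
      qed
      show ?thesis
        using brownian_expectation_given_past[OF rT(1) r(2) rT(3) hb m1] insert.hyps(1) notin
        by (simp add: q_def N_def mult_ac)
    qed
    show ?thesis
    proof (cases "r \<in> S")
      case True
      define h' where "h' = h(r := \<lambda>x. h r x * q x)"
      have h'_m: "h' s \<in> borel_measurable borel" if "s \<in> S" for s
        unfolding h'_def using insert.prems(2) that True q_m by auto
      have "(\<Prod>s\<in>S. h' s (common D s \<omega>)) = (\<Prod>s\<in>S. h s (common D s \<omega>)) * q (common D r \<omega>)" for \<omega>
        using True insert.hyps(1) by (simp add: prod.remove[of S r] h'_def mult_ac)
      moreover obtain V where "V \<in> borel_measurable (FB D t)" "\<forall>Z\<in>borel_measurable (Filt D t).
          (\<integral>\<^sup>+\<omega>. Z \<omega> * (\<Prod>s\<in>S. h' s (common D s \<omega>)) \<partial>Pm D) = (\<integral>\<^sup>+\<omega>. Z \<omega> * V \<omega> \<partial>Pm D)"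
        using insert.IH[of h', OF _ h'_m] insert.prems(1) by auto
      ultimately show ?thesis
        by (intro bexI[of _ V]) (simp_all add: step)
    next
      case False
      then have rt: "r = t" using r by auto
      have "(\<lambda>\<omega>. (\<Prod>s\<in>S. h s (common D s \<omega>)) * q (common D r \<omega>)) \<in> borel_measurable (FB D t)"
      proof (intro borel_measurable_times_ennreal borel_measurable_prod_ennreal)
        show "(\<lambda>\<omega>. q (common D r \<omega>)) \<in> borel_measurable (FB D t)"
          using measurable_compose[OF common_FB_measurable[of r t] q_m] rt rT by simp
        fix s assume s: "s \<in> S"
        then have "common D s \<in> borel_measurable (FB D t)"
          using insert.prems(1) r(3) rt by (intro common_FB_measurable) auto
        from measurable_compose[OF this] insert.prems(2) s
        show "(\<lambda>\<omega>. h s (common D s \<omega>)) \<in> borel_measurable (FB D t)" by auto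
      qed
      then show ?thesis
        by (rule bexI[rotated]) (auto intro: step)
    qed
  qed
qed

text \<open>
  The future of the common noise contains no information on what is known at time \<open>t\<close>.  Both sides have
  the same integrals over cylinder sets by the previous lemma; these sets and the null sets
  form a generator of the \<open>\<sigma>\<close>-algebra at the horizon that is stable under intersections.
\<close>

lemma nn_cond_exp_FB_horizon:
  assumes t: "t \<in> {0..horizon D}" and U: "U \<in> borel_measurable (Filt D t)"
    and fin: "(\<integral>\<^sup>+\<omega>. U \<omega> \<partial>Pm D) < \<infinity>"
  shows "AE \<omega> in Pm D. nn_cond_exp (Pm D) (FB D (horizon D)) U \<omega> = nn_cond_exp (Pm D) (FB D t) U \<omega>"
proof -
  let ?T = "horizon D"
  have T: "?T \<in> {0..?T}" using horizon_pos by simp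
  interpret t: sigma_finite_subalgebra "Pm D" "FB D t" by (rule sigma_finite_FB[OF t])
  interpret T: sigma_finite_subalgebra "Pm D" "FB D ?T" by (rule sigma_finite_FB[OF T])
  have U_m: "U \<in> borel_measurable (Pm D)" using measurable_from_subalg[OF filt_sub[OF t] U] .
  define Z where "Z = nn_cond_exp (Pm D) (FB D t) U"
  have Z_t: "Z \<in> borel_measurable (FB D t)" unfolding Z_def by simp
  have Z_F: "Z \<in> borel_measurable (Filt D t)" using measurable_from_subalg[OF FB_sub_Filt[OF t] Z_t] .
  have Z_m: "Z \<in> borel_measurable (Pm D)" using measurable_from_subalg[OF FB_sub[OF t] Z_t] .
  define cyl where "cyl S A = {\<omega> \<in> space (Pm D). \<forall>s\<in>S. common D s \<omega> \<in> A s}"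
    for S :: "real set" and A :: "real \<Rightarrow> real set"
  define E0 where "E0 = {cyl S A | S A. finite S \<and> S \<subseteq> {0..?T} \<and> (\<forall>s. A s \<in> sets borel) \<and> (\<forall>s. s \<notin> S
      \<longrightarrow> A s = UNIV)}"
  define E where "E = E0 \<union> null_sets (Pm D)"
  have cyl_m: "X \<in> sets (FB D ?T)" if "X \<in> E0" for X
  proof -
    obtain S A where SA: "X = cyl S A" "finite S" "S \<subseteq> {0..?T}" "\<And>s. A s \<in> sets borel"
      using \<open>X \<in> E0\<close> unfolding E0_def by blast
    have "{\<omega> \<in> space (FB D ?T). \<forall>s\<in>S. common D s \<omega> \<in> A s} \<in> sets (FB D ?T)"
    proof (rule sets.sets_Collect_finite_All[OF _ SA(2)])
      fix s assume "s \<in> S"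
      then have "common D s \<in> borel_measurable (FB D ?T)"
        using SA(3) by (intro common_FB_measurable) auto
      from measurable_sets_Collect[OF this, of "\<lambda>x. x \<in> A s"]
      show "{\<omega> \<in> space (FB D ?T). common D s \<omega> \<in> A s} \<in> sets (FB D ?T)" using SA(4) by simp
    qed
    then show ?thesis unfolding SA(1) cyl_def by simp
  qed
  have null_m: "X \<in> sets (FB D ?T)" if "X \<in> null_sets (Pm D)" for X
    using that unfolding sets_FB by blast
  have gen: "sets (FB D ?T) = sigma_sets (space (Pm D)) E"
  proof (rule antisym)
    show "sigma_sets (space (Pm D)) E \<subseteq> sets (FB D ?T)"
      using sets.sigma_sets_subset[of E "FB D ?T"] cyl_m null_m unfolding E_def by auto
    have "common D s -` A \<inter> space (Pm D) \<in> E0" if s: "s \<in> {0..?T}" and A: "A \<in> sets borel"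
        for s and A :: "real set"
      unfolding E0_def
    proof (intro CollectI exI conjI)
      show "common D s -` A \<inter> space (Pm D) = cyl {s} ((\<lambda>_. UNIV)(s := A))" unfolding cyl_def by auto
    qed (use s A in auto)
    then show "sets (FB D ?T) \<subseteq> sigma_sets (space (Pm D)) E"
      unfolding sets_FB E_def by (intro sigma_sets_mono') blast
  qed
  have "E0 \<subseteq> Pow (space (Pm D))" unfolding E0_def cyl_def by blast
  then have EP: "E \<subseteq> Pow (space (Pm D))"
    unfolding E_def by (auto dest: null_setsD2 sets.sets_into_space)
  have E0_sets: "X \<in> sets (Pm D)" if "X \<in> E0" for X
    using cyl_m[OF that] FB_sub[OF T] unfolding subalgebra_def by blast
  have stable: "Int_stable E"
    unfolding Int_stable_def
  proof (intro ballI)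
    fix X Y assume XY: "X \<in> E" "Y \<in> E"
    show "X \<inter> Y \<in> E"
    proof (cases "X \<in> E0 \<and> Y \<in> E0")
      case True
      then obtain S A S' A' where SA: "X = cyl S A" "finite S" "S \<subseteq> {0..?T}" "\<And>s. A s \<in> sets borel"
          "\<And>s. s \<notin> S \<Longrightarrow> A s = UNIV"
        "Y = cyl S' A'" "finite S'" "S' \<subseteq> {0..?T}" "\<And>s. A' s \<in> sets borel" "\<And>s. s \<notin> S' \<Longrightarrow> A' s = UNIV"
        unfolding E0_def by blast
      have "X \<inter> Y = cyl (S \<union> S') (\<lambda>s. A s \<inter> A' s)"
        unfolding SA(1) SA(6) cyl_def using SA(5,10) by blast
      then have "X \<inter> Y \<in> E0" unfolding E0_def
        using SA by (intro CollectI exI[of _ "S \<union> S'"] exI[of _ "\<lambda>s. A s \<inter> A' s"]) auto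
      then show ?thesis unfolding E_def by blast
    next
      case False
      then have "X \<inter> Y \<in> null_sets (Pm D)"
        using XY E0_sets unfolding E_def
        by (auto intro: null_set_Int1 null_set_Int2 dest: null_setsD2)
      then show ?thesis unfolding E_def by blast
    qed
  qed
  have eq: "(\<integral>\<^sup>+\<omega>. U \<omega> * indicator X \<omega> \<partial>Pm D) = (\<integral>\<^sup>+\<omega>. Z \<omega> * indicator X \<omega> \<partial>Pm D)" if X: "X \<in> E" for X
  proof (cases "X \<in> null_sets (Pm D)")
    case True
    then show ?thesis by (simp add: nn_integral_null_set)
  next
    case False
    then have "X \<in> E0" using X unfolding E_def by blast
    then obtain S A where SA: "X = cyl S A" "finite S" "S \<subseteq> {0..?T}" "\<And>s. A s \<in> sets borel"
      unfolding E0_def by blast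
    have ind: "indicator X \<omega> = (\<Prod>s\<in>S. indicator (A s) (common D s \<omega>) :: ennreal)"
      if "\<omega> \<in> space (Pm D)" for \<omega>
    proof (cases "\<omega> \<in> X")
      case True
      then show ?thesis unfolding SA(1) cyl_def by simp
    next
      case False
      then obtain s where "s \<in> S" "common D s \<omega> \<notin> A s"
        using \<open>\<omega> \<in> space (Pm D)\<close> unfolding SA(1) cyl_def by blast
      then have "\<exists>s\<in>S. indicator (A s) (common D s \<omega>) = (0 :: ennreal)" by (auto simp: indicator_def)
      then show ?thesis using False SA(2) by (simp add: prod_zero_iff)
    qed
    obtain V where V: "V \<in> borel_measurable (FB D t)" "\<And>Y. Y \<in> borel_measurable (Filt D t) \<Longrightarrow>
        (\<integral>\<^sup>+\<omega>. Y \<omega> * (\<Prod>s\<in>S. indicator (A s) (common D s \<omega>) :: ennreal) \<partial>Pm D) = (\<integral>\<^sup>+\<omega>. Y \<omega> * V \<omega> \<partial>Pm D)"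
      using cylinder_projection[OF SA(2,3) t, of "\<lambda>s. indicator (A s)"] SA(4) by auto
    have *: "(\<integral>\<^sup>+\<omega>. Y \<omega> * indicator X \<omega> \<partial>Pm D) = (\<integral>\<^sup>+\<omega>. Y \<omega> * V \<omega> \<partial>Pm D)"
      if "Y \<in> borel_measurable (Filt D t)" for Y
      unfolding V(2)[OF that, symmetric] by (intro nn_integral_cong) (simp add: ind)
    show ?thesis
      unfolding *[OF U] *[OF Z_F] using t.nn_cond_exp_intg[OF V(1) U_m] unfolding Z_def
          by (simp add: mult.commute)
  qed
  have "(\<integral>\<^sup>+\<omega>\<in>X. U \<omega> \<partial>Pm D) = (\<integral>\<^sup>+\<omega>\<in>X. Z \<omega> \<partial>Pm D)" if X: "X \<in> sets (FB D ?T)" for X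
  proof -
    have sub: "subalgebra (density (Pm D) f) (FB D ?T)" for f
      using FB_sub[OF T] unfolding subalgebra_def by simp
    have em: "emeasure (restr_to_subalg (density (Pm D) f) (FB D ?T)) X = (\<integral>\<^sup>+\<omega>. f \<omega> * indicator X \<omega>
        \<partial>Pm D)"
      if "f \<in> borel_measurable (Pm D)" "X \<in> sets (FB D ?T)" for f X
      using emeasure_restr_to_subalg[OF sub that(2)] emeasure_density[OF that(1), of X] that(2)
          FB_sub[OF T]
      unfolding subalgebra_def by auto
    have EFB: "X \<in> sets (FB D ?T)" if "X \<in> E" for X using that cyl_m null_m unfolding E_def by blast
    have top: "space (Pm D) \<in> E"
    proof -
      have "space (Pm D) = cyl {} (\<lambda>_. UNIV)" unfolding cyl_def by auto
      then show ?thesis unfolding E_def E0_def by fastforce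
    qed
    have "restr_to_subalg (density (Pm D) U) (FB D ?T) = restr_to_subalg (density (Pm D) Z) (FB D ?T)"
    proof (rule measure_eqI_generator_eq[OF stable EP, where A = "\<lambda>_. space (Pm D)"])
      fix X assume "X \<in> E"
      then show "emeasure (restr_to_subalg (density (Pm D) U) (FB D ?T)) X
          = emeasure (restr_to_subalg (density (Pm D) Z) (FB D ?T)) X"
        by (simp add: em[OF U_m EFB] em[OF Z_m EFB] eq)
    next
      have "(\<integral>\<^sup>+\<omega>. U \<omega> * indicator (space (Pm D)) \<omega> \<partial>Pm D) = (\<integral>\<^sup>+\<omega>. U \<omega> \<partial>Pm D)"
        by (intro nn_integral_cong) simp
      then show "emeasure (restr_to_subalg (density (Pm D) U) (FB D ?T)) (space (Pm D)) \<noteq> \<infinity>"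
        using fin by (simp add: em[OF U_m EFB[OF top]])
    qed (use top in \<open>auto simp: sets_restr_to_subalg[OF sub] gen\<close>)
    then show ?thesis using em[OF U_m X] em[OF Z_m X] by simp
  qed
  then have "AE \<omega> in Pm D. Z \<omega> = nn_cond_exp (Pm D) (FB D ?T) U \<omega>"
    using measurable_from_subalg[OF FB_mono Z_t, of ?T] t U_m by (intro T.nn_cond_exp_charact) auto
  then show ?thesis unfolding Z_def by eventually_elim simp
qed

text \<open>
  It is this identity that makes \<open>E[X\<^sub>t | F\<^sup>B\<^sub>T]\<close> an adapted process in \<open>t\<close>.
\<close>

lemma real_cond_exp_FB_horizon:
  assumes t: "t \<in> {0..horizon D}" and U: "U \<in> borel_measurable (Filt D t)" and int:
      "integrable (Pm D) U"
  shows "AE \<omega> in Pm D. real_cond_exp (Pm D) (FB D (horizon D)) U \<omega> = real_cond_exp (Pm D) (FB D t) U \<omega>"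
proof -
  have "(\<integral>\<^sup>+\<omega>. ennreal (U \<omega>) \<partial>Pm D) < \<infinity>" "(\<integral>\<^sup>+\<omega>. ennreal (- U \<omega>) \<partial>Pm D) < \<infinity>"
    using int unfolding real_integrable_def by (auto simp: less_top)
  then show ?thesis
    using nn_cond_exp_FB_horizon[OF t, of "\<lambda>\<omega>. ennreal (U \<omega>)"]
      nn_cond_exp_FB_horizon[OF t, of "\<lambda>\<omega>. ennreal (- U \<omega>)"] U
    unfolding real_cond_exp_def by auto
qed

end

section \<open>Time regularity of the state\<close>

lemma (in sigma_finite_subalgebra) nn_integral_abs_real_cond_exp_le:
  assumes V: "integrable M V"
  shows "(\<integral>\<^sup>+\<omega>. ennreal \<bar>real_cond_exp M F V \<omega>\<bar> \<partial>M) \<le> ennreal (\<integral>\<omega>. \<bar>V \<omega>\<bar> \<partial>M)"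
proof -
  have "(\<integral>\<^sup>+\<omega>. ennreal \<bar>real_cond_exp M F V \<omega>\<bar> \<partial>M) \<le> (\<integral>\<^sup>+\<omega>. nn_cond_exp M F (\<lambda>\<omega>. ennreal \<bar>V \<omega>\<bar>) \<omega> \<partial>M)"
    using real_cond_exp_abs[of V] V by (intro nn_integral_mono_AE) auto
  also have "\<dots> = (\<integral>\<^sup>+\<omega>. ennreal \<bar>V \<omega>\<bar> \<partial>M)"
    using nn_cond_exp_intg[of "\<lambda>_. 1" "\<lambda>\<omega>. ennreal \<bar>V \<omega>\<bar>"] V by simp
  also have "\<dots> = ennreal (\<integral>\<omega>. \<bar>V \<omega>\<bar> \<partial>M)"
    using V by (intro nn_integral_eq_integral) auto
  finally show ?thesis .
qed

text \<open>
  Summable \<open>L\<^sup>1\<close>-distances to the limit give almost sure convergence along the whole sequence.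
\<close>

lemma AE_tendsto_of_summable_L1:
  fixes f :: "nat \<Rightarrow> 'a \<Rightarrow> real"
  assumes m: "\<And>n. f n \<in> borel_measurable M" "g \<in> borel_measurable M"
    and le: "\<And>n. (\<integral>\<^sup>+\<omega>. ennreal \<bar>f n \<omega> - g \<omega>\<bar> \<partial>M) \<le> ennreal (c n)"
    and c: "summable c" "\<And>n. 0 \<le> c n"
  shows "AE \<omega> in M. (\<lambda>n. f n \<omega>) \<longlonglongrightarrow> g \<omega>"
proof -
  have "(\<integral>\<^sup>+\<omega>. (\<Sum>n. ennreal \<bar>f n \<omega> - g \<omega>\<bar>) \<partial>M) = (\<Sum>n. \<integral>\<^sup>+\<omega>. ennreal \<bar>f n \<omega> - g \<omega>\<bar> \<partial>M)"
    using m by (intro nn_integral_suminf) measurable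
  also have "\<dots> \<le> (\<Sum>n. ennreal (c n))" by (intro suminf_le le) auto
  also have "\<dots> = ennreal (\<Sum>n. c n)" using c by (intro suminf_ennreal2) auto
  finally have "(\<integral>\<^sup>+\<omega>. (\<Sum>n. ennreal \<bar>f n \<omega> - g \<omega>\<bar>) \<partial>M) \<noteq> \<infinity>"
    by (auto simp: top_unique)
  moreover have "(\<lambda>\<omega>. \<Sum>n. ennreal \<bar>f n \<omega> - g \<omega>\<bar>) \<in> borel_measurable M" using m by measurable
  ultimately have "AE \<omega> in M. (\<Sum>n. ennreal \<bar>f n \<omega> - g \<omega>\<bar>) \<noteq> \<infinity>"
    by (intro nn_integral_PInf_AE)
  then show ?thesis
  proof eventually_elim
    case (elim \<omega>)
    then have "summable (\<lambda>n. \<bar>f n \<omega> - g \<omega>\<bar>)" by (intro summable_suminf_not_top) auto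
    then have "(\<lambda>n. \<bar>f n \<omega> - g \<omega>\<bar>) \<longlonglongrightarrow> 0" by (rule summable_LIMSEQ_zero)
    then show ?case using LIM_zero_cancel tendsto_rabs_zero_iff by blast
  qed
qed

context mfg_setting
begin

lemma brownian_increment:
  assumes W: "brownian_motion (Pm D) (horizon D) (Filt D) W" and st: "0 \<le> s" "s \<le> t" "t \<le> horizon D"
  shows "integrable (Pm D) (\<lambda>\<omega>. \<bar>W t \<omega> - W s \<omega>\<bar>)" "(\<integral>\<omega>. \<bar>W t \<omega> - W s \<omega>\<bar> \<partial>Pm D) \<le> sqrt (t - s)"
proof -
  have "integrable (Pm D) (\<lambda>\<omega>. \<bar>W t \<omega> - W s \<omega>\<bar>) \<and> (\<integral>\<omega>. \<bar>W t \<omega> - W s \<omega>\<bar> \<partial>Pm D) \<le> sqrt (t - s)"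
  proof (cases "s = t")
    case False
    then have lt: "s < t" using st by simp
    then have d: "distributed (Pm D) lborel (\<lambda>\<omega>. W t \<omega> - W s \<omega>) (normal_density 0 (sqrt (t - s)))"
      using W st unfolding brownian_motion_def by auto
    have hb: "has_bochner_integral lborel (\<lambda>x. normal_density 0 (sqrt (t - s)) x * \<bar>x\<bar>) (sqrt (t -
        s) * sqrt (2 / pi))"
      using normal_moment_abs_odd[of "sqrt (t - s)" 0 0] lt by simp
    have "integrable (Pm D) (\<lambda>\<omega>. \<bar>W t \<omega> - W s \<omega>\<bar>)"
      using distributed_integrable[OF d, of abs] hb by (auto simp: has_bochner_integral_iff)
    moreover have "(\<integral>\<omega>. \<bar>W t \<omega> - W s \<omega>\<bar> \<partial>Pm D) = sqrt (t - s) * sqrt (2 / pi)"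
      using distributed_integral[OF d, of abs] hb by (auto simp: has_bochner_integral_iff)
    moreover have "sqrt (2 / pi) \<le> 1" using pi_ge_two by simp
    ultimately show ?thesis using mult_left_mono[of "sqrt (2 / pi)" 1 "sqrt (t - s)"] lt by simp
  qed simp
  then show "integrable (Pm D) (\<lambda>\<omega>. \<bar>W t \<omega> - W s \<omega>\<bar>)" "(\<integral>\<omega>. \<bar>W t \<omega> - W s \<omega>\<bar> \<partial>Pm D) \<le> sqrt (t - s)"
    by auto
qed

lemma brownian_integrable:
  assumes W: "brownian_motion (Pm D) (horizon D) (Filt D) W" and t: "t \<in> {0..horizon D}"
  shows "integrable (Pm D) (\<lambda>\<omega>. \<bar>W t \<omega>\<bar>)"
proof (rule Bochner_Integration.integrable_bound[OF brownian_increment(1)[OF W, of 0 t]])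
  have "W t \<in> borel_measurable (Pm D)"
    using W t Filt_measurable unfolding brownian_motion_def by blast
  then show "(\<lambda>\<omega>. \<bar>W t \<omega>\<bar>) \<in> borel_measurable (Pm D)" by measurable
  have "AE \<omega> in Pm D. W 0 \<omega> = 0" using W unfolding brownian_motion_def by blast
  then show "AE \<omega> in Pm D. norm \<bar>W t \<omega>\<bar> \<le> norm \<bar>W t \<omega> - W 0 \<omega>\<bar>" by eventually_elim simp
qed (use t in auto)

lemma drift_values_bdd:
  "bdd_above (insert 0 {\<bar>drift D \<omega> t x a\<bar> |\<omega> t x a.
     \<omega> \<in> space (Pm D) \<and> t \<in> {0..horizon D} \<and> a \<in> ctrls D})"
proof -
  obtain K where K: "\<forall>\<omega>\<in>space (Pm D). \<forall>t\<in>{0..horizon D}. \<forall>x. \<forall>a\<in>ctrls D. \<bar>drift D \<omega> t x a\<bar> \<le> K"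
    using drift_bounded by blast
  then show ?thesis by (auto intro!: bdd_aboveI[of _ "max 0 K"] simp: le_max_iff_disj)
qed

lemma drift_le_norm:
  assumes "\<omega> \<in> space (Pm D)" "t \<in> {0..horizon D}" "a \<in> ctrls D"
  shows "\<bar>drift D \<omega> t x a\<bar> \<le> drift_norm D"
  unfolding drift_norm_def by (rule cSup_upper[OF _ drift_values_bdd]) (use assms in blast)

lemma drift_norm_nonneg: "0 \<le> drift_norm D"
  unfolding drift_norm_def by (rule cSup_upper[OF _ drift_values_bdd]) simp

lemma progressive_path_measurable:
  assumes "progressive (horizon D) (Filt D) X" "\<omega> \<in> space (Pm D)"
  shows "(\<lambda>s. X s \<omega>) \<in> borel_measurable (restrict_space borel {0..horizon D})"
proof -
  have 1: "(\<lambda>(\<omega>, s). X s \<omega>) \<in> borel_measurable (Pm D \<Otimes>\<^sub>M restrict_space borel {0..horizon D})"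
    using progressive_jointly_measurable[OF assms(1) _ filt_sub] horizon_pos by simp
  have "(\<lambda>s. (\<omega>, s)) \<in> measurable (restrict_space borel {0..horizon D}) (Pm D \<Otimes>\<^sub>M restrict_space
      borel {0..horizon D})"
    using assms(2) by simp
  from measurable_compose[OF this 1] show ?thesis by simp
qed

lemma admissible_ctrls: "\<alpha> \<in> admissible D \<Longrightarrow> t \<in> {0..horizon D} \<Longrightarrow> \<omega> \<in> space (Pm D) \<Longrightarrow> \<alpha> t \<omega> \<in> ctrls D"
  unfolding admissible_def by blast

lemma drift_path_measurable:
  assumes X: "progressive (horizon D) (Filt D) X" and \<alpha>: "\<alpha> \<in> admissible D" and \<omega>: "\<omega> \<in> space (Pm D)"
  shows "set_borel_measurable borel {0..horizon D} (\<lambda>s. drift D \<omega> s (X s \<omega>) (\<alpha> s \<omega>))"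
proof -
  let ?R = "restrict_space borel {0..horizon D}"
  have "progressive (horizon D) (Filt D) \<alpha>" using \<alpha> unfolding admissible_def by blast
  from progressive_path_measurable[OF this \<omega>] have
      "(\<lambda>s. \<alpha> s \<omega>) \<in> measurable ?R (restrict_space borel (ctrls D))"
    using admissible_ctrls[OF \<alpha> _ \<omega>] by (intro measurable_restrict_space2) (auto simp:
        space_restrict_space)
  then have "(\<lambda>s. (\<omega>, s, X s \<omega>, \<alpha> s \<omega>)) \<in> measurable ?R (Pm D \<Otimes>\<^sub>M ?R \<Otimes>\<^sub>M borel \<Otimes>\<^sub>M restrict_space
      borel (ctrls D))"
    using progressive_path_measurable[OF X \<omega>] \<omega> by simp
  from measurable_compose[OF this drift_meas]
  have "(\<lambda>s. drift D \<omega> s (X s \<omega>) (\<alpha> s \<omega>)) \<in> borel_measurable ?R" by simp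
  then show ?thesis
    unfolding set_borel_measurable_def by (subst (asm) borel_measurable_restrict_space_iff) auto
qed

lemma state_adapted: "strong_solution D \<alpha> X \<Longrightarrow> t \<in> {0..horizon D} \<Longrightarrow> X t \<in> borel_measurable (Filt D t)"
  unfolding strong_solution_def using progressive_adapted by blast

lemma state_measurable: "strong_solution D \<alpha> X \<Longrightarrow> t \<in> {0..horizon D} \<Longrightarrow> X t \<in> borel_measurable (Pm D)"
  using state_adapted Filt_measurable by blast

lemma state_increment:
  assumes \<alpha>: "\<alpha> \<in> admissible D" and X: "strong_solution D \<alpha> X"
    and st: "0 \<le> s" "s \<le> t" "t \<le> horizon D"
  shows "AE \<omega> in Pm D. \<bar>X t \<omega> - X s \<omega>\<bar> \<le> drift_norm D * (t - s)
    + vol D * \<bar>idio D t \<omega> - idio D s \<omega>\<bar> + vol0 D * \<bar>common D t \<omega> - common D s \<omega>\<bar>"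
proof -
  have p: "progressive (horizon D) (Filt D) X" using X unfolding strong_solution_def by blast
  have "AE \<omega> in Pm D. \<omega> \<in> space (Pm D) \<and> (\<forall>t\<in>{0..horizon D}.
        X t \<omega> = initial D \<omega> + (LINT s:{0..t}|lborel. drift D \<omega> s (X s \<omega>) (\<alpha> s \<omega>))
                + vol D * idio D t \<omega> + vol0 D * common D t \<omega>)"
    using X unfolding strong_solution_def by simp
  then show ?thesis
  proof eventually_elim
    case (elim \<omega>)
    let ?I = "\<lambda>t. LINT s:{0..t}|lborel. drift D \<omega> s (X s \<omega>) (\<alpha> s \<omega>)"
    have I: "\<bar>?I t - ?I s\<bar> \<le> drift_norm D * (t - s)"
      using elim st drift_le_norm admissible_ctrls[OF \<alpha>]
      by (intro set_integral_Icc_lipschitz[OF drift_path_measurable[OF p \<alpha>]]) auto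
    have "X t \<omega> = initial D \<omega> + ?I t + vol D * idio D t \<omega> + vol0 D * common D t \<omega>"
      "X s \<omega> = initial D \<omega> + ?I s + vol D * idio D s \<omega> + vol0 D * common D s \<omega>"
      using elim st by auto
    then have "X t \<omega> - X s \<omega> = (?I t - ?I s) + vol D * (idio D t \<omega> - idio D s \<omega>) + vol0 D * (common
        D t \<omega> - common D s \<omega>)"
      by (simp add: algebra_simps)
    also have "\<bar>\<dots>\<bar> \<le> \<bar>?I t - ?I s\<bar> + \<bar>vol D * (idio D t \<omega> - idio D s \<omega>)\<bar> + \<bar>vol0 D * (common D t \<omega> -
        common D s \<omega>)\<bar>"
      by linarith
    also have "\<dots> \<le> drift_norm D * (t - s) + vol D * \<bar>idio D t \<omega> - idio D s \<omega>\<bar> + vol0 D * \<bar>common D t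
        \<omega> - common D s \<omega>\<bar>"
      using I vol_nonneg vol0_pos by (simp add: abs_mult)
    finally show ?case .
  qed
qed

lemma state_bound:
  assumes \<alpha>: "\<alpha> \<in> admissible D" and X: "strong_solution D \<alpha> X" and t: "t \<in> {0..horizon D}"
  shows "AE \<omega> in Pm D. \<bar>X t \<omega>\<bar> \<le> Ybound D t \<omega>"
proof -
  have p: "progressive (horizon D) (Filt D) X" using X unfolding strong_solution_def by blast
  have "AE \<omega> in Pm D. \<omega> \<in> space (Pm D) \<and> (\<forall>t\<in>{0..horizon D}.
        X t \<omega> = initial D \<omega> + (LINT s:{0..t}|lborel. drift D \<omega> s (X s \<omega>) (\<alpha> s \<omega>))
                + vol D * idio D t \<omega> + vol0 D * common D t \<omega>)"
    using X unfolding strong_solution_def by simp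
  then show ?thesis
  proof eventually_elim
    case (elim \<omega>)
    let ?I = "\<lambda>t. LINT s:{0..t}|lborel. drift D \<omega> s (X s \<omega>) (\<alpha> s \<omega>)"
    have "\<bar>?I t - ?I 0\<bar> \<le> drift_norm D * (t - 0)"
      using elim t drift_le_norm admissible_ctrls[OF \<alpha>]
      by (intro set_integral_Icc_lipschitz[OF drift_path_measurable[OF p \<alpha>]]) auto
    moreover have "?I 0 = 0"
      unfolding set_lebesgue_integral_def
      by (rule integral_eq_zero_AE, use AE_lborel_singleton[of 0] in eventually_elim) auto
    ultimately have I: "\<bar>?I t\<bar> \<le> t * drift_norm D" by (simp add: mult.commute)
    have "\<bar>X t \<omega>\<bar> \<le> \<bar>initial D \<omega>\<bar> + \<bar>?I t\<bar> + \<bar>vol D * idio D t \<omega>\<bar> + \<bar>vol0 D * common D t \<omega>\<bar>"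
      using elim t by auto
    then show ?case unfolding Ybound_def using I vol_nonneg vol0_pos by (simp add: abs_mult)
  qed
qed

lemma Ybound_integrable:
  assumes t: "t \<in> {0..horizon D}"
  shows "integrable (Pm D) (Ybound D t)"
proof -
  have "initial D \<in> borel_measurable (Pm D)" using Filt_measurable[OF initial_meas] horizon_pos by simp
  then have "integrable (Pm D) (initial D)"
    using initial_L2 square_integrable_imp_integrable by blast
  then show ?thesis
    unfolding Ybound_def[abs_def] using brownian_integrable[OF BM_idio t] brownian_integrable[OF
        BM_common t]
    by simp
qed

lemma Ybound_nonneg: "t \<in> {0..horizon D} \<Longrightarrow> 0 \<le> Ybound D t \<omega>"
  unfolding Ybound_def using drift_norm_nonneg vol_nonneg vol0_pos by simp

lemma state_integrable:
  assumes "\<alpha> \<in> admissible D" "strong_solution D \<alpha> X" and t: "t \<in> {0..horizon D}"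
  shows "integrable (Pm D) (X t)"
  by (rule Bochner_Integration.integrable_bound[OF Ybound_integrable[OF t] state_measurable[OF
      assms(2) t]])
    (use state_bound[OF assms] Ybound_nonneg[OF t] in \<open>auto elim: eventually_mono\<close>)

text \<open>
  The constant in the bound \<open>E|X\<^sub>t - X\<^sub>s| \<le> modulus * sqrt (t - s)\<close> for all states; the drift contributes
  \<open>t - s \<le> sqrt (horizon D) * sqrt (t - s)\<close>.
\<close>

definition modulus where "modulus = drift_norm D * sqrt (horizon D) + vol D + vol0 D"

lemma modulus_nonneg: "0 \<le> modulus"
  unfolding modulus_def using drift_norm_nonneg vol_nonneg vol0_pos horizon_pos by simp

lemma state_L1_increment:
  assumes \<alpha>: "\<alpha> \<in> admissible D" and X: "strong_solution D \<alpha> X"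
    and st: "0 \<le> s" "s \<le> t" "t \<le> horizon D"
  shows "(\<integral>\<omega>. \<bar>X t \<omega> - X s \<omega>\<bar> \<partial>Pm D) \<le> modulus * sqrt (t - s)"
proof -
  note iW = brownian_increment[OF BM_idio st] and iB = brownian_increment[OF BM_common st]
  have iX: "integrable (Pm D) (X t)" "integrable (Pm D) (X s)"
    using st by (auto intro!: state_integrable[OF \<alpha> X])
  have "(\<integral>\<omega>. \<bar>X t \<omega> - X s \<omega>\<bar> \<partial>Pm D) \<le> (\<integral>\<omega>. drift_norm D * (t - s)
    + vol D * \<bar>idio D t \<omega> - idio D s \<omega>\<bar> + vol0 D * \<bar>common D t \<omega> - common D s \<omega>\<bar> \<partial>Pm D)"
    using iX iW iB by (intro integral_mono_AE state_increment[OF \<alpha> X st]) auto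
  also have "\<dots> = drift_norm D * (t - s) + vol D * (\<integral>\<omega>. \<bar>idio D t \<omega> - idio D s \<omega>\<bar> \<partial>Pm D)
      + vol0 D * (\<integral>\<omega>. \<bar>common D t \<omega> - common D s \<omega>\<bar> \<partial>Pm D)"
    using iW iB by (simp add: prob_space)
  also have "\<dots> \<le> drift_norm D * (sqrt (horizon D) * sqrt (t - s)) + vol D * sqrt (t - s) + vol0 D *
      sqrt (t - s)"
  proof (intro add_mono mult_left_mono iW iB)
    have "t - s = sqrt (t - s) * sqrt (t - s)" using st by simp
    also have "\<dots> \<le> sqrt (horizon D) * sqrt (t - s)" using st by (intro mult_right_mono) auto
    finally show "t - s \<le> sqrt (horizon D) * sqrt (t - s)" .
  qed (use drift_norm_nonneg vol_nonneg vol0_pos in auto)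
  also have "\<dots> = modulus * sqrt (t - s)" unfolding modulus_def by (simp add: algebra_simps)
  finally show ?thesis .
qed

end

section \<open>Progressive projections\<close>

context mfg_setting
begin

text \<open>
  The value at the last grid point before \<open>t\<close> is used, so that sampling an adapted process on a grid
  looks into the past only and yields a progressive process.
\<close>

lemma progressive_FB_approximation:
  assumes "0 < c" and Z: "\<And>t. t \<in> {0..horizon D} \<Longrightarrow> Z t \<in> borel_measurable (FB D t)"
  shows "progressive (horizon D) (FB D) (\<lambda>t \<omega>. Z (real (nat \<lfloor>t * c\<rfloor>) / c) \<omega>)"
  unfolding progressive_def
proof
  fix t assume t: "t \<in> {0..horizon D}"
  let ?N = "FB D t \<Otimes>\<^sub>M restrict_space borel {0..t}"
  define f where "f i p = (if real i / c \<le> t then Z (real i / c) (fst p) else 0)"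
      for i :: nat and p :: "'w \<times> real"
  have "(\<lambda>p. f (nat \<lfloor>snd p * c\<rfloor>) p) \<in> borel_measurable ?N"
  proof (rule measurable_compose_countable)
    fix i
    show "f i \<in> borel_measurable ?N"
    proof (cases "real i / c \<le> t")
      case True
      have "Z (real i / c) \<in> borel_measurable (FB D (real i / c))"
        using True t \<open>0 < c\<close> by (intro Z) auto
      from measurable_from_subalg[OF FB_mono[OF True] this]
      have "(\<lambda>p. Z (real i / c) (fst p)) \<in> borel_measurable ?N" by measurable
      then show ?thesis using True unfolding f_def[abs_def] by simp
    next
      case False
      then show ?thesis unfolding f_def[abs_def] by simp
    qed
  next
    have "(\<lambda>s. s) \<in> measurable (restrict_space borel {0..t}) (borel :: real measure)"
        by (rule measurable_restrict_space1) simp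
    then show "(\<lambda>p. nat \<lfloor>snd p * c\<rfloor>) \<in> measurable ?N (count_space UNIV)" by measurable
  qed
  moreover have "f (nat \<lfloor>snd p * c\<rfloor>) p = (case p of (\<omega>, s) \<Rightarrow> Z (real (nat \<lfloor>s * c\<rfloor>) / c) \<omega>)" if p:
      "p \<in> space ?N" for p
  proof -
    have s: "0 \<le> snd p" "snd p \<le> t" using p by (auto simp: space_pair_measure space_restrict_space)
    then have "real (nat \<lfloor>snd p * c\<rfloor>) \<le> snd p * c" using \<open>0 < c\<close> by simp
    also have "\<dots> \<le> t * c" using s \<open>0 < c\<close> by (intro mult_right_mono) auto
    finally have "real (nat \<lfloor>snd p * c\<rfloor>) / c \<le> t" using \<open>0 < c\<close> by (simp only: pos_divide_le_eq)
    then show ?thesis unfolding f_def by (simp add: case_prod_beta)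
  qed
  ultimately show "(\<lambda>(\<omega>, s). Z (real (nat \<lfloor>s * c\<rfloor>) / c) \<omega>) \<in> borel_measurable ?N"
    by (subst measurable_cong[where g = "\<lambda>p. f (nat \<lfloor>snd p * c\<rfloor>) p"]) auto
qed

text \<open>
  The conditional expectations \<open>E[U\<^sub>t | F\<^sup>B\<^sub>T]\<close> are defined for each \<open>t\<close> separately, up to null sets; a version
  that is progressive in \<open>(\<omega>, t)\<close> has to be constructed.  It is the limit of the processes obtained by sampling on
  the grids of mesh \<open>4\<^sup>-\<^sup>n\<close>, which are at \<open>L\<^sup>1\<close>-distance at most \<open>c 2\<^sup>-\<^sup>n\<close> from \<open>E[U\<^sub>t | F\<^sup>B\<^sub>T]\<close> at every single time \<open>t\<close>.
\<close>

lemma progressive_projection: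
  assumes U: "\<And>t. t \<in> {0..horizon D} \<Longrightarrow> U t \<in> borel_measurable (Filt D t)"
    and int: "\<And>t. t \<in> {0..horizon D} \<Longrightarrow> integrable (Pm D) (U t)"
    and L1: "\<And>s t. 0 \<le> s \<Longrightarrow> s \<le> t \<Longrightarrow> t \<le> horizon D \<Longrightarrow> (\<integral>\<omega>. \<bar>U t \<omega> - U s \<omega>\<bar> \<partial>Pm D) \<le> c * sqrt (t - s)"
    and c: "0 \<le> c"
  shows "\<exists>\<rho>. progressive (horizon D) (FB D) \<rho> \<and>
    (\<forall>t\<in>{0..horizon D}. AE \<omega> in Pm D. \<rho> t \<omega> = real_cond_exp (Pm D) (FB D (horizon D)) (U t) \<omega>)"
proof -
  let ?T = "horizon D"
  interpret T: sigma_finite_subalgebra "Pm D" "FB D ?T" using horizon_pos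
      by (intro sigma_finite_FB) simp
  define Z where "Z t = real_cond_exp (Pm D) (FB D t) (U t)" for t
  have Z_m: "Z t \<in> borel_measurable (FB D t)" if "t \<in> {0..?T}" for t
    unfolding Z_def by simp
  have Z_M: "Z t \<in> borel_measurable (Pm D)" if "t \<in> {0..?T}" for t
    using measurable_from_subalg[OF FB_sub[OF that] Z_m[OF that]] .
  have ZT: "AE \<omega> in Pm D. Z t \<omega> = real_cond_exp (Pm D) (FB D ?T) (U t) \<omega>" if "t \<in> {0..?T}" for t
    unfolding Z_def using real_cond_exp_FB_horizon[OF that U[OF that] int[OF that]]
        by eventually_elim simp
  define g where "g n t = real (nat \<lfloor>t * 4 ^ n\<rfloor>) / 4 ^ n" for n :: nat and t :: real
  have g: "0 \<le> g n t" "g n t \<le> t" "t - g n t \<le> 1 / 4 ^ n" if "0 \<le> t" for n t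
  proof -
    have "real (nat \<lfloor>t * 4 ^ n\<rfloor>) = of_int \<lfloor>t * 4 ^ n\<rfloor>" using that by simp
    then have "real (nat \<lfloor>t * 4 ^ n\<rfloor>) \<le> t * 4 ^ n" "t * 4 ^ n \<le> real (nat \<lfloor>t * 4 ^ n\<rfloor>) + 1"
      by linarith+
    then show "0 \<le> g n t" "g n t \<le> t" "t - g n t \<le> 1 / 4 ^ n"
      unfolding g_def using divide_right_mono[of "t * 4 ^ n" "real (nat \<lfloor>t * 4 ^ n\<rfloor>) + 1" "4 ^ n"]
      by (simp_all add: pos_divide_le_eq add_divide_distrib del: of_nat_nat)
  qed
  \<comment> \<open>Where the limit does not exist, \<open>lim\<close> takes an unspecified value, but still measurably so.\<close>
  define \<rho> where "\<rho> t \<omega> = lim (\<lambda>n. Z (g n t) \<omega>)" for t \<omega>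
  have "progressive ?T (FB D) \<rho>"
    unfolding progressive_def
  proof
    fix t assume t: "t \<in> {0..?T}"
    have "(\<lambda>p. (\<lambda>(\<omega>, s). Z (g n s) \<omega>) p) \<in> borel_measurable (FB D t \<Otimes>\<^sub>M restrict_space borel
        {0..t})" for n
      using progressive_FB_approximation[of "4 ^ n" Z, OF _ Z_m] t unfolding progressive_def g_def
          by simp
    then have "(\<lambda>p. lim (\<lambda>n. (\<lambda>(\<omega>, s). Z (g n s) \<omega>) p))
        \<in> borel_measurable (FB D t \<Otimes>\<^sub>M restrict_space borel {0..t})"
      by (rule borel_measurable_lim_metric)
    also have "(\<lambda>p. lim (\<lambda>n. (\<lambda>(\<omega>, s). Z (g n s) \<omega>) p)) = (\<lambda>(\<omega>, s). \<rho> s \<omega>)"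
      unfolding \<rho>_def by auto
    finally show "(\<lambda>(\<omega>, s). \<rho> s \<omega>) \<in> borel_measurable (FB D t \<Otimes>\<^sub>M restrict_space borel {0..t})" .
  qed
  moreover have "AE \<omega> in Pm D. \<rho> t \<omega> = real_cond_exp (Pm D) (FB D ?T) (U t) \<omega>" if t: "t \<in> {0..?T}" for t
  proof -
    have gt: "g n t \<in> {0..?T}" "g n t \<in> {0..t}" for n using g[of t n] t by auto
    have "AE \<omega> in Pm D. (\<lambda>n. Z (g n t) \<omega>) \<longlonglongrightarrow> Z t \<omega>"
    proof (rule AE_tendsto_of_summable_L1[where c = "\<lambda>n. c * (1 / 2) ^ n"])
      fix n
      have "(\<integral>\<^sup>+\<omega>. ennreal \<bar>Z (g n t) \<omega> - Z t \<omega>\<bar> \<partial>Pm D)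
          = (\<integral>\<^sup>+\<omega>. ennreal \<bar>real_cond_exp (Pm D) (FB D ?T) (\<lambda>\<omega>. U t \<omega> - U (g n t) \<omega>) \<omega>\<bar> \<partial>Pm D)"
        by (rule nn_integral_cong_AE,
            use ZT[OF t] ZT[OF gt(1)[of n]] T.real_cond_exp_diff[OF int[OF t] int[OF gt(1)[of n]]]
            in eventually_elim) (simp add: abs_minus_commute)
      also have "\<dots> \<le> ennreal (\<integral>\<omega>. \<bar>U t \<omega> - U (g n t) \<omega>\<bar> \<partial>Pm D)"
        using int t gt by (intro T.nn_integral_abs_real_cond_exp_le) auto
      also have "\<dots> \<le> ennreal (c * (1 / 2) ^ n)"
      proof (rule ennreal_leI)
        have "(\<integral>\<omega>. \<bar>U t \<omega> - U (g n t) \<omega>\<bar> \<partial>Pm D) \<le> c * sqrt (t - g n t)" using L1 gt[of n] t by auto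
        also have "\<dots> \<le> c * sqrt (1 / 4 ^ n)" using c g(3)[of t n] t by (intro mult_left_mono) auto
        also have "sqrt (1 / 4 ^ n) = (1 / 2) ^ n"
        proof -
          have "(1 / 4 ^ n :: real) = ((1 / 2) ^ n)\<^sup>2"
            by (simp add: power_divide power2_eq_square power_mult_distrib[symmetric])
          then show ?thesis by (simp only: real_sqrt_abs) simp
        qed
        finally show "(\<integral>\<omega>. \<bar>U t \<omega> - U (g n t) \<omega>\<bar> \<partial>Pm D) \<le> c * (1 / 2) ^ n" .
      qed
      finally show "(\<integral>\<^sup>+\<omega>. ennreal \<bar>Z (g n t) \<omega> - Z t \<omega>\<bar> \<partial>Pm D) \<le> ennreal (c * (1 / 2) ^ n)" .
    qed (use Z_M gt t c in \<open>auto intro!: summable_mult summable_geometric\<close>)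
    with ZT[OF t] show ?thesis unfolding \<rho>_def by eventually_elim (simp add: limI)
  qed
  ultimately show ?thesis by blast
qed

end

section \<open>The lattice of flows\<close>

context mfg_setting
begin

text \<open>
  The cost of a flow \<open>\<mu>\<close> depends on its terminal value, which the order \<open>mfg_le\<close> does not see, as it ignores
  null sets of times.  Flows that are equivalent for \<open>mfg_le\<close> can therefore have different
  responses, while flows that are equivalent for this finer preorder have the same ones.
\<close>

definition terminal_le :: "(real \<Rightarrow> 'w \<Rightarrow> real) \<Rightarrow> (real \<Rightarrow> 'w \<Rightarrow> real) \<Rightarrow> bool" where
  "terminal_le \<mu> \<nu> \<longleftrightarrow> mfg_le D \<mu> \<nu> \<and> (AE \<omega> in Pm D. \<mu> (horizon D) \<omega> \<le> \<nu> (horizon D) \<omega>)"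

lemma space_time [simp]: "space (time_measure D) = {0..horizon D}"
  unfolding time_measure_def by (simp add: space_restrict_space)

lemma sets_time: "sets (time_measure D) = sets (restrict_space borel {0..horizon D})"
  unfolding time_measure_def by (auto simp: sets_restrict_space)

lemma emeasure_time: "A \<in> sets borel \<Longrightarrow> A \<subseteq> {0..horizon D}
    \<Longrightarrow> emeasure (time_measure D) A = emeasure lborel A"
  unfolding time_measure_def by (subst emeasure_restrict_space) auto

lemma finite_time: "finite_measure (time_measure D)"
  by (rule finite_measureI) (simp add: emeasure_time emeasure_lborel_Icc_eq)

lemma pair_time: "pair_sigma_finite (Pm D) (time_measure D)"
  using finite_time unfolding finite_measure_def
  by (intro pair_sigma_finite.intro sigma_finite_measure_axioms) auto

lemma finite_prod: "finite_measure (prod_measure D)"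
  unfolding prod_measure_def by (intro finite_measure_pair_measure finite_time finite_measure_axioms)

lemma borel_measurable_prod_iff:
  "borel_measurable (prod_measure D) = borel_measurable (Pm D \<Otimes>\<^sub>M restrict_space borel {0..horizon D})"
  unfolding prod_measure_def by (intro measurable_cong_sets sets_pair_measure_cong sets_time refl)

lemma progressive_prod_measurable:
  assumes "progressive (horizon D) (Filt D) X"
  shows "(\<lambda>(\<omega>, t). X t \<omega>) \<in> borel_measurable (prod_measure D)"
  unfolding borel_measurable_prod_iff using progressive_jointly_measurable[OF assms _ filt_sub]
      horizon_pos by simp

lemma mfg_L_measurable:
  assumes "\<mu> \<in> mfg_L D"
  shows "(\<lambda>(\<omega>, t). \<mu> t \<omega>) \<in> borel_measurable (prod_measure D)"
  unfolding borel_measurable_prod_iff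
  by (rule progressive_jointly_measurable[OF _ _ FB_sub]) (use horizon_pos assms in \<open>auto simp:
      mfg_L_def\<close>)

lemma mfg_L_measurable_time:
  assumes "\<mu> \<in> mfg_L D" "t \<in> {0..horizon D}"
  shows "\<mu> t \<in> borel_measurable (Pm D)"
  using progressive_adapted[of "horizon D" "FB D" \<mu> t] measurable_from_subalg[OF FB_sub] assms
  unfolding mfg_L_def by blast

text \<open>
  Fubini's theorem allows the two almost sure quantifiers to be interchanged.
\<close>

lemma mfg_le_iff_AE_time:
  assumes m: "(\<lambda>(\<omega>, t). \<mu> t \<omega>) \<in> borel_measurable (prod_measure D)"
      "(\<lambda>(\<omega>, t). \<nu> t \<omega>) \<in> borel_measurable (prod_measure D)"
  shows "mfg_le D \<mu> \<nu> \<longleftrightarrow> (AE t in time_measure D. AE \<omega> in Pm D. \<mu> t \<omega> \<le> \<nu> t \<omega>)"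
proof -
  interpret pair_sigma_finite "Pm D" "time_measure D" by (rule pair_time)
  have s: "{p \<in> space (Pm D \<Otimes>\<^sub>M time_measure D). \<mu> (snd p) (fst p) \<le> \<nu> (snd p) (fst p)}
      \<in> sets (Pm D \<Otimes>\<^sub>M time_measure D)"
    using m unfolding prod_measure_def[symmetric] case_prod_beta' by (intro borel_measurable_le)
  show ?thesis
    unfolding mfg_le_def prod_measure_def
    using AE_commute[OF s] AE_pair_iff[OF s] by (simp add: case_prod_beta)
qed

lemma terminal_le_of_timewise:
  assumes "(\<lambda>(\<omega>, t). \<mu> t \<omega>) \<in> borel_measurable (prod_measure D)"
      "(\<lambda>(\<omega>, t). \<nu> t \<omega>) \<in> borel_measurable (prod_measure D)"
    and "\<And>t. t \<in> {0..horizon D} \<Longrightarrow> AE \<omega> in Pm D. \<mu> t \<omega> \<le> \<nu> t \<omega>"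
  shows "terminal_le \<mu> \<nu>"
proof -
  have "AE t in time_measure D. AE \<omega> in Pm D. \<mu> t \<omega> \<le> \<nu> t \<omega>"
    by (rule AE_I2, rule assms(3)) simp
  then show ?thesis
    unfolding terminal_le_def mfg_le_iff_AE_time[OF assms(1,2)] using assms(3) horizon_pos by simp
qed

text \<open>
  For flows that are \<open>L\<^sup>1\<close>-continuous at the horizon, the two preorders agree: times \<open>t\<close> with
  \<open>\<mu>\<^sub>t \<le> \<nu>\<^sub>t\<close> almost surely exist arbitrarily close to the horizon.
\<close>

lemma mfg_le_imp_terminal_le:
  assumes m: "\<mu> \<in> mfg_L D" "\<nu> \<in> mfg_L D" and le: "mfg_le D \<mu> \<nu>"
    and L1: "\<And>t. t \<in> {0..horizon D} \<Longrightarrow> (\<integral>\<^sup>+\<omega>. ennreal \<bar>\<mu> (horizon D) \<omega> - \<mu> t \<omega>\<bar> \<partial>Pm D)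
        \<le> ennreal (c * sqrt (horizon D - t))"
      "\<And>t. t \<in> {0..horizon D} \<Longrightarrow> (\<integral>\<^sup>+\<omega>. ennreal \<bar>\<nu> (horizon D) \<omega> - \<nu> t \<omega>\<bar> \<partial>Pm D)
          \<le> ennreal (c * sqrt (horizon D - t))"
    and c: "0 \<le> c"
  shows "terminal_le \<mu> \<nu>"
proof -
  let ?T = "horizon D"
  note meas = mfg_L_measurable_time[OF m(1)] mfg_L_measurable_time[OF m(2)]
  define I where "I = (\<integral>\<^sup>+\<omega>. ennreal (\<mu> ?T \<omega> - \<nu> ?T \<omega>) \<partial>Pm D)"
  have T: "?T \<in> {0..?T}" using horizon_pos by simp
  have AEt: "AE t in time_measure D. AE \<omega> in Pm D. \<mu> t \<omega> \<le> \<nu> t \<omega>"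
    using le mfg_le_iff_AE_time[OF mfg_L_measurable[OF m(1)] mfg_L_measurable[OF m(2)]] by simp
  have "I \<le> ennreal (2 * c * sqrt e)" if e: "0 < e" "e \<le> ?T" for e
  proof -
    have "\<exists>t\<in>{?T - e..?T}. AE \<omega> in Pm D. \<mu> t \<omega> \<le> \<nu> t \<omega>"
    proof (rule ccontr)
      assume "\<not> ?thesis"
      with AEt have "AE t in time_measure D. t \<notin> {?T - e..?T}" by (auto elim!: eventually_mono)
      then have "emeasure (time_measure D) {?T - e..?T} = 0"
        using e by (subst (asm) AE_iff_measurable[where N =
            "{?T - e..?T}"]) (auto simp: sets_time sets_restrict_space_iff)
      then show False using e by (simp add: emeasure_time)
    qed
    then obtain t where t: "t \<in> {?T - e..?T}" "AE \<omega> in Pm D. \<mu> t \<omega> \<le> \<nu> t \<omega>" by blast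
    then have tT: "t \<in> {0..?T}" using e by auto
    have "I \<le> (\<integral>\<^sup>+\<omega>. ennreal \<bar>\<mu> ?T \<omega> - \<mu> t \<omega>\<bar> + ennreal \<bar>\<nu> ?T \<omega> - \<nu> t \<omega>\<bar> \<partial>Pm D)"
      unfolding I_def
      by (rule nn_integral_mono_AE, use t(2) in eventually_elim) (auto simp flip: ennreal_plus
          intro!: ennreal_leI)
    also have "\<dots> = (\<integral>\<^sup>+\<omega>. ennreal \<bar>\<mu> ?T \<omega> - \<mu> t \<omega>\<bar> \<partial>Pm D) + (\<integral>\<^sup>+\<omega>. ennreal \<bar>\<nu> ?T \<omega> - \<nu> t \<omega>\<bar> \<partial>Pm D)"
      using meas[OF T] meas[OF tT] by (intro nn_integral_add) auto
    also have "\<dots> \<le> ennreal (c * sqrt (?T - t)) + ennreal (c * sqrt (?T - t))"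
      by (intro add_mono L1 tT)
    also have "\<dots> = ennreal (2 * c * sqrt (?T - t))" using c tT by (simp flip: ennreal_plus)
    also have "\<dots> \<le> ennreal (2 * c * sqrt e)" using c t by (intro ennreal_leI mult_left_mono) auto
    finally show ?thesis .
  qed
  then have lim: "eventually (\<lambda>e. I \<le> ennreal (2 * c * sqrt e)) (at_right 0)"
    using horizon_pos unfolding eventually_at_right_field by (intro exI[of _ ?T]) auto
  have "((\<lambda>e. ennreal (2 * c * sqrt e)) \<longlongrightarrow> ennreal (2 * c * sqrt 0)) (at_right 0)"
    by (intro tendsto_intros)
  then have "I \<le> ennreal (2 * c * sqrt 0)"
    using lim by (rule tendsto_lowerbound) simp
  then have "AE \<omega> in Pm D. ennreal (\<mu> ?T \<omega> - \<nu> ?T \<omega>) = 0"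
    unfolding I_def using meas[OF T] nn_integral_0_iff_AE[of "\<lambda>\<omega>. ennreal (\<mu> ?T \<omega> - \<nu> ?T \<omega>)" "Pm D"]
        by simp
  then have "AE \<omega> in Pm D. \<mu> ?T \<omega> \<le> \<nu> ?T \<omega>" by eventually_elim (simp add: ennreal_eq_0_iff)
  then show ?thesis using le unfolding terminal_le_def by simp
qed

lemma terminal_le_refl: "terminal_le \<mu> \<mu>"
  unfolding terminal_le_def mfg_le_def by (auto simp: case_prod_beta)

lemma terminal_le_trans: "terminal_le \<mu> \<nu> \<Longrightarrow> terminal_le \<nu> \<kappa> \<Longrightarrow> terminal_le \<mu> \<kappa>"
  unfolding terminal_le_def mfg_le_def by (auto simp: case_prod_beta elim!: eventually_elim2)

lemma zero_in_mfg_L: "(\<lambda>t \<omega>. 0) \<in> mfg_L D"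
proof -
  have "AE \<omega> in Pm D. 0 \<le> real_cond_exp (Pm D) (FB D (horizon D)) (Ybound D t) \<omega>" if t:
      "t \<in> {0..horizon D}" for t
  proof -
    interpret T: sigma_finite_subalgebra "Pm D" "FB D (horizon D)" using horizon_pos
        by (intro sigma_finite_FB) simp
    show ?thesis using Ybound_nonneg[OF t] Ybound_integrable[OF t] by (intro T.real_cond_exp_pos) auto
  qed
  then show ?thesis unfolding mfg_L_def progressive_def by (auto simp: case_prod_beta)
qed

lemma mfg_L_uminus: "\<mu> \<in> mfg_L D \<Longrightarrow> (\<lambda>t \<omega>. - \<mu> t \<omega>) \<in> mfg_L D"
  unfolding mfg_L_def progressive_def by (auto simp: case_prod_beta)

text \<open>
  Two countable subfamilies, one for \<open>P \<otimes> dt\<close> and one for the horizon, realise the essential infima; the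
  pointwise infimum of their union is progressive, and it inherits the bound on \<open>L\<close> at \<^emph>\<open>every\<close> time, which an
  essential infimum with respect to \<open>P \<otimes> dt\<close> alone would not determine.
\<close>

lemma mfg_L_Inf:
  assumes UL: "U \<subseteq> mfg_L D" and ne: "U \<noteq> {}"
  shows "\<exists>w\<in>mfg_L D. (\<forall>u\<in>U. terminal_le w u) \<and> (\<forall>v\<in>mfg_L D. (\<forall>u\<in>U. terminal_le v u) \<longrightarrow> terminal_le v w)"
proof -
  let ?T = "horizon D" and ?f = "\<lambda>\<mu> (\<omega>, t). (\<mu> :: real \<Rightarrow> 'w \<Rightarrow> real) t \<omega>"
  have T: "?T \<in> {0..?T}" using horizon_pos by simp
  interpret P: finite_measure "prod_measure D" by (rule finite_prod)
  have "\<exists>C\<subseteq>U. countable C \<and> C \<noteq> {} \<and>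
      (\<forall>u\<in>U. AE p in prod_measure D. \<forall>y. (\<forall>c\<in>C. y \<le> ?f c p) \<longrightarrow> y \<le> ?f u p)"
    by (rule P.essential_infimum_countable[OF mfg_L_measurable[OF subsetD[OF UL]] ne])
  then obtain C1 where C1: "C1 \<subseteq> U" "countable C1" "C1 \<noteq> {}"
    "\<forall>u\<in>U. AE p in prod_measure D. \<forall>y. (\<forall>c\<in>C1. y \<le> ?f c p) \<longrightarrow> y \<le> ?f u p"
    by (elim exE conjE)
  have "\<exists>C\<subseteq>U. countable C \<and> C \<noteq> {} \<and>
      (\<forall>u\<in>U. AE \<omega> in Pm D. \<forall>y. (\<forall>c\<in>C. y \<le> c ?T \<omega>) \<longrightarrow> y \<le> u ?T \<omega>)"
    by (rule essential_infimum_countable[OF mfg_L_measurable_time[OF subsetD[OF UL] T] ne])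
  then obtain C2 where C2: "C2 \<subseteq> U" "countable C2"
    "\<forall>u\<in>U. AE \<omega> in Pm D. \<forall>y. (\<forall>c\<in>C2. y \<le> c ?T \<omega>) \<longrightarrow> y \<le> u ?T \<omega>"
    by (elim exE conjE)
  define C where "C = C1 \<union> C2"
  have C: "C \<subseteq> U" "countable C" "C \<noteq> {}" using C1 C2 unfolding C_def by auto
  \<comment> \<open>The infimum is taken in the extended reals, as it may be \<open>-\<infinity>\<close> on a null set at each time.\<close>
  define w where "w t \<omega> = real_of_ereal (INF c\<in>C. ereal (c t \<omega>))" for t \<omega>
  have prog: "progressive ?T (FB D) w"
    unfolding progressive_def
  proof
    fix t assume t: "t \<in> {0..?T}"
    let ?N = "FB D t \<Otimes>\<^sub>M restrict_space borel {0..t}"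
    have "(\<lambda>p. ereal (?f c p)) \<in> borel_measurable ?N" if "c \<in> C" for c
      using that C UL t unfolding mfg_L_def progressive_def by (intro borel_measurable_ereal) auto
    then have "(\<lambda>p. real_of_ereal (INF c\<in>C. ereal (?f c p))) \<in> borel_measurable ?N"
      using C(2) by (intro borel_measurable_real_of_ereal borel_measurable_INF)
    also have "(\<lambda>p. real_of_ereal (INF c\<in>C. ereal (?f c p))) = (\<lambda>(\<omega>, s). w s \<omega>)" unfolding w_def by auto
    finally show "(\<lambda>(\<omega>, s). w s \<omega>) \<in> borel_measurable ?N" .
  qed
  have w_eq: "ereal (w t \<omega>) = (INF c\<in>C. ereal (c t \<omega>))" if y: "\<forall>c\<in>C. y \<le> c t \<omega>" for t \<omega> y
  proof -
    have "ereal y \<le> (INF c\<in>C. ereal (c t \<omega>))" using y by (intro INF_greatest) simp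
    moreover obtain c where "c \<in> C" using C by blast
    then have "(INF c\<in>C. ereal (c t \<omega>)) \<le> ereal (c t \<omega>)" by (rule INF_lower)
    ultimately show ?thesis unfolding w_def by (cases "INF c\<in>C. ereal (c t \<omega>)") auto
  qed
  have w_low: "w t \<omega> \<le> c t \<omega>" if y: "\<forall>c\<in>C. y \<le> c t \<omega>" and c: "c \<in> C" for t \<omega> y c
  proof -
    have "ereal (w t \<omega>) \<le> ereal (c t \<omega>)" unfolding w_eq[OF y] by (rule INF_lower[OF c])
    then show ?thesis by simp
  qed
  have w_gr: "y \<le> w t \<omega>" if y: "\<forall>c\<in>C. y \<le> c t \<omega>" for t \<omega> y
  proof -
    have "ereal y \<le> ereal (w t \<omega>)" unfolding w_eq[OF y] using y by (intro INF_greatest) simp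
    then show ?thesis by simp
  qed
  let ?Y = "\<lambda>t. real_cond_exp (Pm D) (FB D ?T) (Ybound D t)"
  have bd: "AE \<omega> in Pm D. \<forall>c\<in>C. \<bar>c t \<omega>\<bar> \<le> ?Y t \<omega>" if "t \<in> {0..?T}" for t
    using that C UL unfolding mfg_L_def by (subst AE_ball_countable) auto
  have w_bd: "AE \<omega> in Pm D. \<bar>w t \<omega>\<bar> \<le> ?Y t \<omega>" if t: "t \<in> {0..?T}" for t
    using bd[OF t]
  proof eventually_elim
    case (elim \<omega>)
    obtain c where c: "c \<in> C" using C by blast
    have low: "\<forall>c\<in>C. - ?Y t \<omega> \<le> c t \<omega>" using elim by fastforce
    show ?case using w_gr[OF low] w_low[OF low c] elim c by fastforce
  qed
  have wL: "w \<in> mfg_L D" unfolding mfg_L_def using prog w_bd by auto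
  have wC: "terminal_le w c" if c: "c \<in> C" for c
  proof (rule terminal_le_of_timewise[OF mfg_L_measurable[OF wL] mfg_L_measurable])
    show "c \<in> mfg_L D" using c C UL by blast
    fix t assume t: "t \<in> {0..?T}"
    show "AE \<omega> in Pm D. w t \<omega> \<le> c t \<omega>"
      using bd[OF t]
    proof eventually_elim
      case (elim \<omega>)
      have low: "\<forall>c\<in>C. - ?Y t \<omega> \<le> c t \<omega>" using elim by fastforce
      show ?case by (rule w_low[OF low c])
    qed
  qed
  have "terminal_le w u" if u: "u \<in> U" for u
  proof -
    have "AE p in prod_measure D. \<forall>c\<in>C. ?f w p \<le> ?f c p"
      using wC C(2) unfolding terminal_le_def mfg_le_def
          by (subst AE_ball_countable) (auto simp: case_prod_beta)
    with C1(4)[rule_format, OF u] have "AE p in prod_measure D. ?f w p \<le> ?f u p"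
      by eventually_elim (auto simp: C_def)
    moreover have "AE \<omega> in Pm D. \<forall>c\<in>C. w ?T \<omega> \<le> c ?T \<omega>"
      using wC C(2) unfolding terminal_le_def by (subst AE_ball_countable) auto
    with C2(3)[rule_format, OF u] have "AE \<omega> in Pm D. w ?T \<omega> \<le> u ?T \<omega>"
      by eventually_elim (auto simp: C_def)
    ultimately show ?thesis unfolding terminal_le_def mfg_le_def by (simp add: case_prod_beta)
  qed
  moreover have "terminal_le v w" if v: "v \<in> mfg_L D" "\<forall>u\<in>U. terminal_le v u" for v
  proof -
    have vC: "terminal_le v c" if "c \<in> C" for c using v(2) C(1) that by blast
    have "AE p in prod_measure D. \<forall>c\<in>C. ?f v p \<le> ?f c p"
      using vC C(2) unfolding terminal_le_def mfg_le_def
          by (subst AE_ball_countable) (auto simp: case_prod_beta)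
    then have "AE p in prod_measure D. ?f v p \<le> ?f w p"
      by eventually_elim (auto intro!: w_gr)
    moreover have "AE \<omega> in Pm D. \<forall>c\<in>C. v ?T \<omega> \<le> c ?T \<omega>"
      using vC C(2) unfolding terminal_le_def by (subst AE_ball_countable) auto
    then have "AE \<omega> in Pm D. v ?T \<omega> \<le> w ?T \<omega>"
      by eventually_elim (auto intro!: w_gr)
    ultimately show ?thesis unfolding terminal_le_def mfg_le_def by (simp add: case_prod_beta)
  qed
  ultimately show ?thesis using wL by blast
qed

text \<open>
  \<open>L\<close> is symmetric, so its largest element is the negative of its smallest one.
\<close>

lemma mfg_L_top: "\<exists>m\<in>mfg_L D. \<forall>\<mu>\<in>mfg_L D. terminal_le \<mu> m"
proof -
  obtain w where w: "w \<in> mfg_L D" "\<And>u. u \<in> mfg_L D \<Longrightarrow> terminal_le w u"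
    using mfg_L_Inf[OF order_refl] zero_in_mfg_L by blast
  have "terminal_le \<mu> (\<lambda>t \<omega>. - w t \<omega>)" if "\<mu> \<in> mfg_L D" for \<mu>
    using w(2)[OF mfg_L_uminus[OF that]] unfolding terminal_le_def mfg_le_def
    by (auto simp: case_prod_beta elim!: eventually_mono)
  then show ?thesis using mfg_L_uminus[OF w(1)] by blast
qed

end

section \<open>Switching between two controls\<close>

context mfg_setting
begin

lemma strong_solution_unique:
  assumes \<alpha>: "\<alpha> \<in> admissible D" and X: "strong_solution D \<alpha> X" and X': "strong_solution D \<alpha> X'"
  shows "indistinguishable D X X'"
proof -
  let ?T = "horizon D"
  obtain C where C: "0 < C" "\<forall>\<omega>\<in>space (Pm D). \<forall>t\<in>{0..?T}. \<forall>a\<in>ctrls D. \<forall>x y.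
      \<bar>drift D \<omega> t x a - drift D \<omega> t y a\<bar> \<le> C * \<bar>x - y\<bar>"
    using drift_lipschitz by blast
  have p: "progressive ?T (Filt D) X" "progressive ?T (Filt D) X'"
    using X X' unfolding strong_solution_def by blast+
  have "AE \<omega> in Pm D. \<omega> \<in> space (Pm D)" by simp
  moreover have "AE \<omega> in Pm D. continuous_on {0..?T} (\<lambda>t. X t \<omega>)"
      "AE \<omega> in Pm D. continuous_on {0..?T} (\<lambda>t. X' t \<omega>)"
    using X X' unfolding strong_solution_def by blast+
  moreover have "AE \<omega> in Pm D. \<forall>t\<in>{0..?T}.
        X t \<omega> = initial D \<omega> + (LINT s:{0..t}|lborel. drift D \<omega> s (X s \<omega>) (\<alpha> s \<omega>))
                + vol D * idio D t \<omega> + vol0 D * common D t \<omega>"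
    "AE \<omega> in Pm D. \<forall>t\<in>{0..?T}.
        X' t \<omega> = initial D \<omega> + (LINT s:{0..t}|lborel. drift D \<omega> s (X' s \<omega>) (\<alpha> s \<omega>))
                + vol D * idio D t \<omega> + vol0 D * common D t \<omega>"
    using X X' unfolding strong_solution_def by blast+
  ultimately show ?thesis
    unfolding indistinguishable_def
  proof eventually_elim
    case (elim \<omega>)
    define u where "u t = \<bar>X t \<omega> - X' t \<omega>\<bar>" for t
    let ?b = "\<lambda>s. drift D \<omega> s (X s \<omega>) (\<alpha> s \<omega>)" and ?b' = "\<lambda>s. drift D \<omega> s (X' s \<omega>) (\<alpha> s \<omega>)"
    have cont: "continuous_on {0..?T} u" unfolding u_def using elim by (intro continuous_intros)
    have bd: "\<bar>drift D \<omega> s x (\<alpha> s \<omega>)\<bar> \<le> drift_norm D" if "s \<in> {0..?T}" for s x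
      using drift_le_norm admissible_ctrls[OF \<alpha>] elim(1) that by blast
    have "u t = 0" if t: "t \<in> {0..?T}" for t
    proof (rule gronwall_zero[OF C(1) cont _ _ t])
      fix t assume t: "t \<in> {0..?T}"
      show "0 \<le> u t" unfolding u_def by simp
      have i: "set_integrable lborel {0..t} ?b" "set_integrable lborel {0..t} ?b'"
        using drift_path_measurable[OF p(1) \<alpha> elim(1)] drift_path_measurable[OF p(2) \<alpha> elim(1)] t
        by (auto intro!: integrable_on_Icc_of_bounded[OF _ bd])
      have iu: "set_integrable lborel {0..t} u"
        using t by (intro borel_integrable_atLeastAtMost' continuous_on_subset[OF cont]) auto
      have "X t \<omega> - X' t \<omega> = (LINT s:{0..t}|lborel. ?b s) - (LINT s:{0..t}|lborel. ?b' s)"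
        using elim(4,5) t by simp
      also have "\<dots> = (LINT s:{0..t}|lborel. ?b s - ?b' s)" using i by simp
      finally have "u t \<le> (LINT s:{0..t}|lborel. \<bar>?b s - ?b' s\<bar>)"
        unfolding u_def using set_integral_norm_bound[OF set_integral_diff(1)[OF i]] by simp
      also have "\<dots> \<le> (LINT s:{0..t}|lborel. C * u s)"
      proof (rule set_integral_mono)
        show "\<bar>?b s - ?b' s\<bar> \<le> C * u s" if "s \<in> {0..t}" for s
          unfolding u_def using C(2) elim(1) admissible_ctrls[OF \<alpha> _ elim(1)] that t by auto
      qed (use i iu in \<open>auto intro!: set_integrable_abs set_integral_diff\<close>)
      finally show "u t \<le> C * (LINT s:{0..t}|lborel. u s)" by simp
    qed
    then show ?case unfolding u_def by simp
  qed
qed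

text \<open>
  The state of a control is chosen arbitrarily among its strong solutions, so it is one as soon as there is
  one.  For an optimal control this is part of optimality, and for a control composed of two optimal ones a
  solution is constructed below.
\<close>

lemma state_solution:
  assumes "strong_solution D \<alpha> X"
  shows "strong_solution D \<alpha> (state D \<alpha>)"
  unfolding state_def using assms by (rule someI[where P = "strong_solution D \<alpha>"])

text \<open>
  The process that follows \<open>p\<close> while \<open>X' < X\<close>, and \<open>p'\<close> otherwise.  In particular \<open>switch X X' X X'\<close> is the
  maximum of \<open>X\<close> and \<open>X'\<close>, and \<open>switch X X' X' X\<close> is their minimum.
\<close>

definition switch :: "(real \<Rightarrow> 'w \<Rightarrow> real) \<Rightarrow> (real \<Rightarrow> 'w \<Rightarrow> real) \<Rightarrow> (real \<Rightarrow> 'w \<Rightarrow> real)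
    \<Rightarrow> (real \<Rightarrow> 'w \<Rightarrow> real) \<Rightarrow> real \<Rightarrow> 'w \<Rightarrow> real" where
  "switch X X' p p' t \<omega> = (if X' t \<omega> < X t \<omega> then p t \<omega> else p' t \<omega>)"

lemma switch_progressive:
  assumes "progressive T F X" "progressive T F X'" "progressive T F p" "progressive T F p'"
  shows "progressive T F (switch X X' p p')"
  unfolding progressive_def
proof
  fix t assume t: "t \<in> {0..T}"
  let ?N = "F t \<Otimes>\<^sub>M restrict_space borel {0..t}"
  have [measurable]: "(\<lambda>(\<omega>, s). X s \<omega>) \<in> borel_measurable ?N" "(\<lambda>(\<omega>, s). X' s \<omega>) \<in> borel_measurable ?N"
    "(\<lambda>(\<omega>, s). p s \<omega>) \<in> borel_measurable ?N" "(\<lambda>(\<omega>, s). p' s \<omega>) \<in> borel_measurable ?N"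
    using assms t unfolding progressive_def by auto
  have "(\<lambda>q. if (\<lambda>(\<omega>, s). X' s \<omega>) q < (\<lambda>(\<omega>, s). X s \<omega>) q then (\<lambda>(\<omega>, s). p s \<omega>) q else (\<lambda>(\<omega>, s). p' s
      \<omega>) q)
      \<in> borel_measurable ?N"
    by measurable
  also have "(\<lambda>q. if (\<lambda>(\<omega>, s). X' s \<omega>) q < (\<lambda>(\<omega>, s). X s \<omega>) q then (\<lambda>(\<omega>, s). p s \<omega>) q else (\<lambda>(\<omega>, s).
      p' s \<omega>) q)
      = (\<lambda>(\<omega>, s). switch X X' p p' s \<omega>)"
    unfolding switch_def by auto
  finally show "(\<lambda>(\<omega>, s). switch X X' p p' s \<omega>) \<in> borel_measurable ?N" .
qed

lemma switch_admissible:
  assumes X: "progressive (horizon D) (Filt D) X" "progressive (horizon D) (Filt D) X'"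
    and \<alpha>: "\<alpha> \<in> admissible D" "\<alpha>' \<in> admissible D"
  shows "switch X X' \<alpha> \<alpha>' \<in> admissible D"
proof -
  have p: "progressive (horizon D) (Filt D) \<alpha>" "progressive (horizon D) (Filt D) \<alpha>'"
    and fin: "(\<integral>\<^sup>+\<omega>. (\<integral>\<^sup>+t. ennreal ((\<alpha> t \<omega>)\<^sup>2) \<partial>time_measure D) \<partial>Pm D) < \<infinity>"
      "(\<integral>\<^sup>+\<omega>. (\<integral>\<^sup>+t. ennreal ((\<alpha>' t \<omega>)\<^sup>2) \<partial>time_measure D) \<partial>Pm D) < \<infinity>"
    using \<alpha> unfolding admissible_def by auto
  interpret time: finite_measure "time_measure D" by (rule finite_time)
  have sq: "(\<lambda>(\<omega>, t). ennreal ((a t \<omega>)\<^sup>2)) \<in> borel_measurable (Pm D \<Otimes>\<^sub>M time_measure D)"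
    if "progressive (horizon D) (Filt D) a" for a
    using progressive_prod_measurable[OF that] unfolding prod_measure_def case_prod_beta' by measurable
  have path: "(\<lambda>t. ennreal ((a t \<omega>)\<^sup>2)) \<in> borel_measurable (time_measure D)"
    if "progressive (horizon D) (Filt D) a" "\<omega> \<in> space (Pm D)" for a \<omega>
    using measurable_compose[OF measurable_Pair1'[OF that(2)] sq[OF that(1)]] by simp
  have out: "(\<lambda>\<omega>. \<integral>\<^sup>+t. ennreal ((a t \<omega>)\<^sup>2) \<partial>time_measure D) \<in> borel_measurable (Pm D)"
    if "progressive (horizon D) (Filt D) a" for a
    using sq[OF that] by (intro time.borel_measurable_nn_integral) (simp add: case_prod_beta')
  have "(\<integral>\<^sup>+\<omega>. (\<integral>\<^sup>+t. ennreal ((switch X X' \<alpha> \<alpha>' t \<omega>)\<^sup>2) \<partial>time_measure D) \<partial>Pm D)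
      \<le> (\<integral>\<^sup>+\<omega>. (\<integral>\<^sup>+t. ennreal ((\<alpha> t \<omega>)\<^sup>2) + ennreal ((\<alpha>' t \<omega>)\<^sup>2) \<partial>time_measure D) \<partial>Pm D)"
    by (intro nn_integral_mono) (auto simp: switch_def)
  also have "\<dots> = (\<integral>\<^sup>+\<omega>. (\<integral>\<^sup>+t. ennreal ((\<alpha> t \<omega>)\<^sup>2) \<partial>time_measure D)
      + (\<integral>\<^sup>+t. ennreal ((\<alpha>' t \<omega>)\<^sup>2) \<partial>time_measure D) \<partial>Pm D)"
    by (intro nn_integral_cong nn_integral_add path p)
  also have "\<dots> = (\<integral>\<^sup>+\<omega>. (\<integral>\<^sup>+t. ennreal ((\<alpha> t \<omega>)\<^sup>2) \<partial>time_measure D) \<partial>Pm D)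
      + (\<integral>\<^sup>+\<omega>. (\<integral>\<^sup>+t. ennreal ((\<alpha>' t \<omega>)\<^sup>2) \<partial>time_measure D) \<partial>Pm D)"
    by (intro nn_integral_add out p)
  also have "\<dots> < \<infinity>" using fin by simp
  finally show ?thesis
    using switch_progressive[OF X p] admissible_ctrls[OF \<alpha>(1)] admissible_ctrls[OF \<alpha>(2)]
    unfolding admissible_def by (simp add: switch_def)
qed

text \<open>
  Using at each time the control that belongs to the larger state produces the maximum of the two states, and the
  opposite choice produces their minimum.  The noises cancel in \<open>X - X'\<close>, so its positive part is obtained by
  integrating the difference of the drifts over the times with \<open>X' < X\<close>.
\<close>

lemma switch_solution:
  assumes \<alpha>: "\<alpha> \<in> admissible D" "\<alpha>' \<in> admissible D"
    and X: "strong_solution D \<alpha> X" "strong_solution D \<alpha>' X'"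
  shows "strong_solution D (switch X X' \<alpha> \<alpha>') (switch X X' X X')"
    and "strong_solution D (switch X X' \<alpha>' \<alpha>) (switch X X' X' X)"
proof -
  let ?T = "horizon D"
  have p: "progressive ?T (Filt D) X" "progressive ?T (Filt D) X'"
    using X unfolding strong_solution_def by blast+
  have sw: "switch X X' X X' t \<omega> = max (X t \<omega>) (X' t \<omega>)"
      "switch X X' X' X t \<omega> = min (X t \<omega>) (X' t \<omega>)" for t \<omega>
    unfolding switch_def by auto
  have adm: "switch X X' \<alpha> \<alpha>' \<in> admissible D" "switch X X' \<alpha>' \<alpha> \<in> admissible D"
    by (intro switch_admissible p \<alpha>)+
  have prog: "progressive ?T (Filt D) (switch X X' X X')" "progressive ?T (Filt D) (switch X X' X' X)"
    by (intro switch_progressive p)+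
  have cont: "AE \<omega> in Pm D. continuous_on {0..?T} (\<lambda>t. X t \<omega>)"
      "AE \<omega> in Pm D. continuous_on {0..?T} (\<lambda>t. X' t \<omega>)"
    using X unfolding strong_solution_def by blast+
  have c: "AE \<omega> in Pm D. continuous_on {0..?T} (\<lambda>t. switch X X' X X' t \<omega>)"
    using cont unfolding sw by eventually_elim (intro continuous_intros)
  have c': "AE \<omega> in Pm D. continuous_on {0..?T} (\<lambda>t. switch X X' X' X t \<omega>)"
    using cont unfolding sw by eventually_elim (intro continuous_intros)
  let ?eq = "\<lambda>\<alpha> X \<omega>. \<forall>t\<in>{0..?T}. X t \<omega> = initial D \<omega> + (LINT s:{0..t}|lborel. drift D \<omega> s (X s \<omega>) (\<alpha>
      s \<omega>))
                + vol D * idio D t \<omega> + vol0 D * common D t \<omega>"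
  have "AE \<omega> in Pm D. \<omega> \<in> space (Pm D)" by simp
  moreover have "AE \<omega> in Pm D. ?eq \<alpha> X \<omega>" "AE \<omega> in Pm D. ?eq \<alpha>' X' \<omega>"
    using X unfolding strong_solution_def by blast+
  ultimately have "AE \<omega> in Pm D. ?eq (switch X X' \<alpha> \<alpha>') (switch X X' X X') \<omega>
      \<and> ?eq (switch X X' \<alpha>' \<alpha>) (switch X X' X' X) \<omega>"
  proof eventually_elim
    case (elim \<omega>)
    define b where "b \<alpha> X s = drift D \<omega> s (X s \<omega>) (\<alpha> s \<omega>)" for \<alpha> X :: "real \<Rightarrow> 'w \<Rightarrow> real" and s
    define d where "d s = b \<alpha> X s - b \<alpha>' X' s" for s
    have b_m: "set_borel_measurable borel {0..?T} (b \<alpha> X)" if "\<alpha> \<in> admissible D"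
        "progressive ?T (Filt D) X" for \<alpha> X
      unfolding b_def[abs_def] by (rule drift_path_measurable[OF that(2,1) elim(1)])
    have b_bd: "\<bar>b \<alpha> X s\<bar> \<le> drift_norm D" if "\<alpha> \<in> admissible D" "s \<in> {0..?T}" for \<alpha> X s
      unfolding b_def using drift_le_norm admissible_ctrls[OF that(1)] elim(1) that(2) by blast
    have b_i: "set_integrable lborel {0..t} (b \<alpha> X)"
      if "\<alpha> \<in> admissible D" "progressive ?T (Filt D) X" "t \<in> {0..?T}" for \<alpha> X t
      using that by (intro integrable_on_Icc_of_bounded[OF b_m b_bd]) auto
    note i = b_i[OF \<alpha>(1) p(1)] b_i[OF \<alpha>(2) p(2)] b_i[OF adm(1) prog(1)] b_i[OF adm(2) prog(2)]
    have dX: "X t \<omega> - X' t \<omega> = (LINT s:{0..t}|lborel. d s)" if t: "t \<in> {0..?T}" for t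
      unfolding d_def using elim(2,3) t i(1,2)[OF t] by (simp add: b_def[symmetric])
    have d_m: "set_borel_measurable borel {0..?T} d"
      using b_m[OF \<alpha>(1) p(1)] b_m[OF \<alpha>(2) p(2)]
      unfolding d_def[abs_def] set_borel_measurable_def by (simp add: algebra_simps)
    have d_bd: "\<bar>d s\<bar> \<le> 2 * drift_norm D" if "s \<in> {0..?T}" for s
      unfolding d_def using b_bd[OF \<alpha>(1) that, of X] b_bd[OF \<alpha>(2) that, of X'] by linarith
    have sw_b: "b (switch X X' \<alpha> \<alpha>') (switch X X' X X') s
        = b \<alpha>' X' s + (if X s \<omega> - X' s \<omega> > 0 then d s else 0)"
      "b (switch X X' \<alpha>' \<alpha>) (switch X X' X' X) s
          = b \<alpha> X s - (if X s \<omega> - X' s \<omega> > 0 then d s else 0)" for s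
      unfolding b_def d_def switch_def by auto
    have pos: "max 0 (X t \<omega> - X' t \<omega>) = (LINT s:{0..t}|lborel. (if X s \<omega> - X' s \<omega> > 0 then d s else 0))"
      if t: "t \<in> {0..?T}" for t
      by (rule positive_part_of_integral[OF d_m d_bd dX t])
    have I: "(LINT s:{0..t}|lborel. b (switch X X' \<alpha> \<alpha>') (switch X X' X X') s)
        = (LINT s:{0..t}|lborel. b \<alpha>' X' s) + max 0 (X t \<omega> - X' t \<omega>)"
      "(LINT s:{0..t}|lborel. b (switch X X' \<alpha>' \<alpha>) (switch X X' X' X) s)
        = (LINT s:{0..t}|lborel. b \<alpha> X s) - max 0 (X t \<omega> - X' t \<omega>)" if t: "t \<in> {0..?T}" for t
    proof -
      have pe: "(\<lambda>s. if X s \<omega> - X' s \<omega> > 0 then d s else 0)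
          = (\<lambda>s. b (switch X X' \<alpha> \<alpha>') (switch X X' X X') s - b \<alpha>' X' s)"
        unfolding sw_b(1) by simp
      have ip: "set_integrable lborel {0..t} (\<lambda>s. if X s \<omega> - X' s \<omega> > 0 then d s else 0)"
        unfolding pe using i[OF t] by (intro set_integral_diff)
      show "(LINT s:{0..t}|lborel. b (switch X X' \<alpha> \<alpha>') (switch X X' X X') s)
        = (LINT s:{0..t}|lborel. b \<alpha>' X' s) + max 0 (X t \<omega> - X' t \<omega>)"
        unfolding pos[OF t] sw_b(1) using i(2)[OF t] ip by (rule set_integral_add(2))
      show "(LINT s:{0..t}|lborel. b (switch X X' \<alpha>' \<alpha>) (switch X X' X' X) s)
        = (LINT s:{0..t}|lborel. b \<alpha> X s) - max 0 (X t \<omega> - X' t \<omega>)"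
        unfolding pos[OF t] sw_b(2) using i(1)[OF t] ip by (rule set_integral_diff(2))
    qed
    have "switch X X' X X' t \<omega> = X' t \<omega> + max 0 (X t \<omega> - X' t \<omega>)"
      "switch X X' X' X t \<omega> = X t \<omega> - max 0 (X t \<omega> - X' t \<omega>)" for t
      unfolding sw by auto
    with elim(2,3) I show ?case unfolding b_def[symmetric] by simp
  qed
  then show "strong_solution D (switch X X' \<alpha> \<alpha>') (switch X X' X X')"
    "strong_solution D (switch X X' \<alpha>' \<alpha>) (switch X X' X' X)"
    unfolding strong_solution_def using prog c c' by (auto elim: eventually_mono)
qed

end

section \<open>Submodularity and optimal states\<close>

definition submodular :: "(real \<Rightarrow> real \<Rightarrow> real) \<Rightarrow> bool" where
  "submodular \<phi> \<longleftrightarrow> (\<forall>x x' y y'. x \<le> x' \<longrightarrow> y \<le> y' \<longrightarrow> \<phi> x' y' - \<phi> x y' \<le> \<phi> x' y - \<phi> x y)"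

text \<open>
  Here \<open>x\<close> and \<open>x'\<close> are the values of two states, and their maximum is paired with the larger flow.
\<close>

lemma submodular_switch:
  assumes "submodular \<phi>" "y \<le> y'"
  shows "\<phi> (if x' < x then x else x') y' + \<phi> (if x' < x then x' else x) y \<le> \<phi> x y + \<phi> x' y'"
  using assms unfolding submodular_def by (fastforce simp: algebra_simps dest: spec[of _ x'])

lemma ereal_add_interchange_le:
  fixes a b c d :: ereal
  assumes "c + d \<le> a + b" "r3 + r4 \<le> r1 + r2"
  shows "(c + ereal r3) + (d + ereal r4) \<le> (a + ereal r1) + (b + ereal r2)"
proof -
  have "ereal r3 + ereal r4 \<le> ereal r1 + ereal r2" using assms(2) by simp
  from add_mono[OF assms(1) this] show ?thesis by (simp only: ac_simps)
qed

context mfg_setting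
begin

definition running_cost where
  "running_cost X \<alpha> \<mu> = (\<lambda>(\<omega>, t). cost_f D \<omega> t (X t \<omega>) (\<mu> t \<omega>) + cost_l D \<omega> t (X t \<omega>) (\<alpha> t \<omega>))"

definition total_cost where
  "total_cost X \<alpha> \<mu> \<omega> = ext_integral (time_measure D) (\<lambda>t. ereal (running_cost X \<alpha> \<mu> (\<omega>, t)))
     + ereal (cost_g D \<omega> (X (horizon D) \<omega>) (\<mu> (horizon D) \<omega>))"

lemma J_eq_total_cost: "J D \<alpha> \<mu> = ext_integral (Pm D) (total_cost (state D \<alpha>) \<alpha> \<mu>)"
  unfolding J_def total_cost_def[abs_def] running_cost_def by simp

lemma running_cost_measurable:
  assumes X: "progressive (horizon D) (Filt D) X" and \<alpha>: "\<alpha> \<in> admissible D" and \<mu>: "\<mu> \<in> mfg_L D"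
  shows "running_cost X \<alpha> \<mu> \<in> borel_measurable (prod_measure D)"
proof -
  let ?R = "restrict_space borel {0..horizon D}" and ?U = "restrict_space borel (ctrls D)"
  let ?N = "Pm D \<Otimes>\<^sub>M ?R"
  have p\<alpha>: "progressive (horizon D) (Filt D) \<alpha>" using \<alpha> unfolding admissible_def by blast
  have Xm: "(\<lambda>p. X (snd p) (fst p)) \<in> borel_measurable ?N"
    using progressive_prod_measurable[OF X] unfolding borel_measurable_prod_iff
        by (simp add: case_prod_beta')
  have \<mu>m: "(\<lambda>p. \<mu> (snd p) (fst p)) \<in> borel_measurable ?N"
    using mfg_L_measurable[OF \<mu>] unfolding borel_measurable_prod_iff by (simp add: case_prod_beta')
  have "(\<lambda>p. \<alpha> (snd p) (fst p)) \<in> borel_measurable ?N"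
    using progressive_prod_measurable[OF p\<alpha>] unfolding borel_measurable_prod_iff
        by (simp add: case_prod_beta')
  then have \<alpha>m: "(\<lambda>p. \<alpha> (snd p) (fst p)) \<in> measurable ?N ?U"
    using admissible_ctrls[OF \<alpha>] by (intro measurable_restrict_space2) (auto simp:
        space_pair_measure space_restrict_space)
  have "(\<lambda>p. (fst p, snd p, X (snd p) (fst p), \<mu> (snd p) (fst p)))
      \<in> measurable ?N (Pm D \<Otimes>\<^sub>M ?R \<Otimes>\<^sub>M borel \<Otimes>\<^sub>M borel)"
    using Xm \<mu>m by measurable
  from measurable_compose[OF this f_meas]
  have 1: "(\<lambda>p. cost_f D (fst p) (snd p) (X (snd p) (fst p)) (\<mu> (snd p) (fst p)))
      \<in> borel_measurable ?N" by simp
  have "(\<lambda>p. (fst p, snd p, X (snd p) (fst p), \<alpha> (snd p) (fst p)))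
      \<in> measurable ?N (Pm D \<Otimes>\<^sub>M ?R \<Otimes>\<^sub>M borel \<Otimes>\<^sub>M ?U)"
    using Xm \<alpha>m by measurable
  from measurable_compose[OF this l_meas]
  have 2: "(\<lambda>p. cost_l D (fst p) (snd p) (X (snd p) (fst p)) (\<alpha> (snd p) (fst p)))
      \<in> borel_measurable ?N" by simp
  show ?thesis
    unfolding running_cost_def borel_measurable_prod_iff case_prod_beta' using 1 2 by measurable
qed

lemma total_cost_measurable:
  assumes X: "progressive (horizon D) (Filt D) X" and \<alpha>: "\<alpha> \<in> admissible D" and \<mu>: "\<mu> \<in> mfg_L D"
  shows "total_cost X \<alpha> \<mu> \<in> borel_measurable (Pm D)"
proof -
  interpret time: finite_measure "time_measure D" by (rule finite_time)
  have T: "horizon D \<in> {0..horizon D}" using horizon_pos by simp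
  have "(\<lambda>\<omega>. ext_integral (time_measure D) (\<lambda>t. ereal (running_cost X \<alpha> \<mu> (\<omega>, t))))
      \<in> borel_measurable (Pm D)"
    using running_cost_measurable[OF X \<alpha> \<mu>] unfolding prod_measure_def
    by (intro time.borel_measurable_ext_integral) (simp add: case_prod_beta')
  moreover have "(\<lambda>\<omega>. (\<omega>, X (horizon D) \<omega>, \<mu> (horizon D) \<omega>))
      \<in> measurable (Pm D) (Pm D \<Otimes>\<^sub>M borel \<Otimes>\<^sub>M borel)"
    using Filt_measurable[OF progressive_adapted[OF X T] T] mfg_L_measurable_time[OF \<mu> T] by measurable
  from measurable_compose[OF this g_meas]
  have "(\<lambda>\<omega>. cost_g D \<omega> (X (horizon D) \<omega>) (\<mu> (horizon D) \<omega>)) \<in> borel_measurable (Pm D)" by simp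
  ultimately show ?thesis unfolding total_cost_def[abs_def] by measurable
qed

lemma AE_prod_sections:
  assumes "AE (\<omega>, t) in prod_measure D. P \<omega> t"
  shows "AE \<omega> in Pm D. AE t in time_measure D. P \<omega> t"
proof -
  interpret pair_sigma_finite "Pm D" "time_measure D" by (rule pair_time)
  show ?thesis using AE_pair[of "\<lambda>(\<omega>, t). P \<omega> t"] assms unfolding prod_measure_def by simp
qed

lemma AE_time_const: "(AE t in time_measure D. P) \<longleftrightarrow> P"
proof -
  have "ae_filter (time_measure D) \<noteq> bot"
    unfolding ae_filter_eq_bot_iff using horizon_pos by (simp add: emeasure_time)
  then show ?thesis by simp
qed

text \<open>
  The heart of the matter.  Replacing the controls \<open>\<alpha>\<close> and \<open>\<alpha>'\<close> by the two switched controls does not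
  increase the total cost \<open>J(\<alpha>, \<mu>) + J(\<alpha>', \<mu>')\<close> if the maximum of the states meets \<open>\<mu>'\<close> and the minimum meets \<open>\<mu>\<close>:
  the costs of control are just permuted, and submodularity takes care of the interaction with the flow.  As the
  control of the minimum is no better than the optimal \<open>\<alpha>\<close> for \<open>\<mu>\<close>, the control of the maximum is at
  least as good as the optimal \<open>\<alpha>'\<close> for \<open>\<mu>'\<close>.
\<close>

lemma switch_optimal:
  assumes \<mu>: "\<mu> \<in> mfg_L D" "\<mu>' \<in> mfg_L D" and le: "terminal_le \<mu> \<mu>'"
    and opt: "optimal_pair D \<mu> X \<alpha>" "optimal_pair D \<mu>' X' \<alpha>'"
    and fin: "J D \<alpha> \<mu> < \<infinity>" "J D \<alpha>' \<mu>' < \<infinity>"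
    and sub: "AE (\<omega>, t) in prod_measure D. submodular (cost_f D \<omega> t) \<and> submodular (cost_g D \<omega>)"
  shows "optimal_pair D \<mu>' (switch X X' X X') (switch X X' \<alpha> \<alpha>')"
proof -
  let ?T = "horizon D" and ?\<tau> = "time_measure D"
  define \<beta> \<gamma> where "\<beta> = switch X X' \<alpha> \<alpha>'" and "\<gamma> = switch X X' \<alpha>' \<alpha>"
  have \<alpha>: "\<alpha> \<in> admissible D" "\<alpha>' \<in> admissible D" and X: "strong_solution D \<alpha> X"
      "strong_solution D \<alpha>' X'"
    using opt unfolding optimal_pair_def by auto
  have pX: "progressive ?T (Filt D) X" "progressive ?T (Filt D) X'" using X
      unfolding strong_solution_def by auto
  have \<beta>: "\<beta> \<in> admissible D" "strong_solution D \<beta> (switch X X' X X')"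
    and \<gamma>: "\<gamma> \<in> admissible D" "strong_solution D \<gamma> (switch X X' X' X)"
    unfolding \<beta>_def \<gamma>_def using switch_admissible[OF pX] switch_solution[OF \<alpha> X] \<alpha> by auto
  \<comment> \<open>\<open>J\<close> is computed with the chosen versions of the states, which are indistinguishable from the given ones.\<close>
  define S where "S = state D"
  have S: "strong_solution D \<alpha> (S \<alpha>)" "strong_solution D \<alpha>' (S \<alpha>')" "strong_solution D \<beta> (S \<beta>)"
      "strong_solution D \<gamma> (S \<gamma>)"
    unfolding S_def using X \<beta> \<gamma> state_solution by blast+
  then have pS: "progressive ?T (Filt D) (S \<alpha>)" "progressive ?T (Filt D) (S \<alpha>')"
      "progressive ?T (Filt D) (S \<beta>)" "progressive ?T (Filt D) (S \<gamma>)"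
    unfolding strong_solution_def by auto
  have ind: "AE \<omega> in Pm D. \<forall>t\<in>{0..?T}. S \<alpha> t \<omega> = X t \<omega>" "AE \<omega> in Pm D. \<forall>t\<in>{0..?T}. S \<alpha>' t \<omega> = X' t \<omega>"
    "AE \<omega> in Pm D. \<forall>t\<in>{0..?T}. S \<beta> t \<omega> = switch X X' X X' t \<omega>"
        "AE \<omega> in Pm D. \<forall>t\<in>{0..?T}. S \<gamma> t \<omega> = switch X X' X' X t \<omega>"
    using strong_solution_unique[OF \<alpha>(1) S(1) X(1)] strong_solution_unique[OF \<alpha>(2) S(2) X(2)]
      strong_solution_unique[OF \<beta>(1) S(3) \<beta>(2)] strong_solution_unique[OF \<gamma>(1) S(4) \<gamma>(2)]
    unfolding indistinguishable_def by auto
  define h1 h2 k1 k2 where "h1 = total_cost (S \<alpha>) \<alpha> \<mu>" and "h2 = total_cost (S \<alpha>') \<alpha>' \<mu>'"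
    and "k1 = total_cost (S \<beta>) \<beta> \<mu>'" and "k2 = total_cost (S \<gamma>) \<gamma> \<mu>"
  have Jh: "J D \<alpha> \<mu> = ext_integral (Pm D) h1" "J D \<alpha>' \<mu>' = ext_integral (Pm D) h2"
    "J D \<beta> \<mu>' = ext_integral (Pm D) k1" "J D \<gamma> \<mu> = ext_integral (Pm D) k2"
    unfolding h1_def h2_def k1_def k2_def S_def J_eq_total_cost by simp_all
  have m: "h1 \<in> borel_measurable (Pm D)" "h2 \<in> borel_measurable (Pm D)"
      "k1 \<in> borel_measurable (Pm D)" "k2 \<in> borel_measurable (Pm D)"
    unfolding h1_def h2_def k1_def k2_def by (intro total_cost_measurable pS \<alpha> \<beta>(1) \<gamma>(1) \<mu>)+
  have low: "- \<infinity> < J D \<alpha> \<mu>" "- \<infinity> < J D \<alpha>' \<mu>'" using opt unfolding optimal_pair_def by auto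
  have opt_le: "J D \<alpha> \<mu> \<le> J D \<gamma> \<mu>" "J D \<alpha>' \<mu>' \<le> J D \<beta> \<mu>'" using opt \<beta>(1) \<gamma>(1)
      unfolding optimal_pair_def by auto
  note low' = low(1) low(2) less_le_trans[OF low(2) opt_le(2)] less_le_trans[OF low(1) opt_le(1)]
  have AEh: "AE \<omega> in Pm D. \<bar>h1 \<omega>\<bar> \<noteq> \<infinity>" "AE \<omega> in Pm D. \<bar>h2 \<omega>\<bar> \<noteq> \<infinity>"
    using ext_integral_eq_integral(1)[OF m(1) ext_integral_finite_parts]
        ext_integral_eq_integral(1)[OF m(2) ext_integral_finite_parts]
      low fin unfolding Jh by auto
  have AEk: "AE \<omega> in Pm D. - \<infinity> < k1 \<omega>" "AE \<omega> in Pm D. - \<infinity> < k2 \<omega>"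
    using ext_integral_gt_minf_AE[OF m(3)] ext_integral_gt_minf_AE[OF m(4)] low'(3,4) unfolding Jh
        by auto
  have AEs: "AE \<omega> in Pm D. AE t in ?\<tau>. submodular (cost_f D \<omega> t) \<and> submodular (cost_g D \<omega>)"
    by (rule AE_prod_sections[OF sub])
  have AEle: "AE \<omega> in Pm D. AE t in ?\<tau>. \<mu> t \<omega> \<le> \<mu>' t \<omega>" "AE \<omega> in Pm D. \<mu> ?T \<omega> \<le> \<mu>' ?T \<omega>"
    using le AE_prod_sections unfolding terminal_le_def mfg_le_def by auto
  have "AE \<omega> in Pm D. \<omega> \<in> space (Pm D)" by simp
  then have "AE \<omega> in Pm D. k1 \<omega> + k2 \<omega> \<le> h1 \<omega> + h2 \<omega>"
    using AEh AEk AEs AEle ind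
  proof eventually_elim
    case (elim \<omega>)
    let ?r = "\<lambda>X \<alpha> \<mu> t. ereal (running_cost X \<alpha> \<mu> (\<omega>, t))"
    have rm: "?r X \<alpha> \<mu> \<in> borel_measurable ?\<tau>"
      if "progressive ?T (Filt D) X" "\<alpha> \<in> admissible D" "\<mu> \<in> mfg_L D" for X \<alpha> \<mu>
      using measurable_compose[OF measurable_Pair1'[OF elim(1)] running_cost_measurable[OF that,
          unfolded prod_measure_def]]
      by (rule borel_measurable_ereal)
    have fin_sum: "- \<infinity> < a \<and> a < \<infinity>" if "\<bar>a + ereal r\<bar> \<noteq> \<infinity>" for a r
      using that by (cases a) auto
    have low_sum: "- \<infinity> < a" if "- \<infinity> < a + ereal r" for a r
      using that by (cases a) auto
    have Ih: "- \<infinity> < ext_integral ?\<tau> (?r (S \<alpha>) \<alpha> \<mu>)" "ext_integral ?\<tau> (?r (S \<alpha>) \<alpha> \<mu>) < \<infinity>"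
      "- \<infinity> < ext_integral ?\<tau> (?r (S \<alpha>') \<alpha>' \<mu>')" "ext_integral ?\<tau> (?r (S \<alpha>') \<alpha>' \<mu>') < \<infinity>"
      using fin_sum[OF elim(2)[unfolded h1_def total_cost_def]] fin_sum[OF elim(3)[unfolded h2_def
          total_cost_def]]
      by blast+
    have Ik: "- \<infinity> < ext_integral ?\<tau> (?r (S \<beta>) \<beta> \<mu>')" "- \<infinity> < ext_integral ?\<tau> (?r (S \<gamma>) \<gamma> \<mu>)"
      using low_sum[OF elim(4)[unfolded k1_def total_cost_def]] low_sum[OF elim(5)[unfolded k2_def
          total_cost_def]]
      by blast+
    have "AE t in ?\<tau>. t \<in> {0..?T}" using AE_space[of ?\<tau>] by simp
    then have "AE t in ?\<tau>. ?r (S \<beta>) \<beta> \<mu>' t + ?r (S \<gamma>) \<gamma> \<mu> t \<le> ?r (S \<alpha>) \<alpha> \<mu> t + ?r (S \<alpha>') \<alpha>' \<mu>' t"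
      using elim(6,7)
    proof eventually_elim
      case e: (elim t)
      have "cost_f D \<omega> t (S \<beta> t \<omega>) (\<mu>' t \<omega>) + cost_f D \<omega> t (S \<gamma> t \<omega>) (\<mu> t \<omega>)
          \<le> cost_f D \<omega> t (S \<alpha> t \<omega>) (\<mu> t \<omega>) + cost_f D \<omega> t (S \<alpha>' t \<omega>) (\<mu>' t \<omega>)"
        using submodular_switch[of "cost_f D \<omega> t" "\<mu> t \<omega>" "\<mu>' t \<omega>" "X' t \<omega>" "X t \<omega>"] e elim(9-12)
        by (simp add: switch_def)
      moreover have "cost_l D \<omega> t (S \<beta> t \<omega>) (\<beta> t \<omega>) + cost_l D \<omega> t (S \<gamma> t \<omega>) (\<gamma> t \<omega>)
          = cost_l D \<omega> t (S \<alpha> t \<omega>) (\<alpha> t \<omega>) + cost_l D \<omega> t (S \<alpha>' t \<omega>) (\<alpha>' t \<omega>)"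
        using e(1) elim(9-12) unfolding \<beta>_def \<gamma>_def by (simp add: switch_def)
      ultimately show ?case unfolding running_cost_def by simp
    qed
    note I = ext_integral_exchange[OF rm[OF pS(1) \<alpha>(1) \<mu>(1)] rm[OF pS(2) \<alpha>(2) \<mu>(2)]
        rm[OF pS(3) \<beta>(1) \<mu>(2)] rm[OF pS(4) \<gamma>(1) \<mu>(1)] Ih Ik this]
    have T: "?T \<in> {0..?T}" using horizon_pos by simp
    have "submodular (cost_g D \<omega>)" using elim(6) AE_time_const by (auto elim: eventually_mono)
    then have "cost_g D \<omega> (S \<beta> ?T \<omega>) (\<mu>' ?T \<omega>) + cost_g D \<omega> (S \<gamma> ?T \<omega>) (\<mu> ?T \<omega>)
          \<le> cost_g D \<omega> (S \<alpha> ?T \<omega>) (\<mu> ?T \<omega>) + cost_g D \<omega> (S \<alpha>' ?T \<omega>) (\<mu>' ?T \<omega>)"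
      using submodular_switch[of "cost_g D \<omega>" "\<mu> ?T \<omega>" "\<mu>' ?T \<omega>" "X' ?T \<omega>" "X ?T \<omega>"] T elim(8-12)
      by (simp add: switch_def)
    with I(3) show ?case unfolding h1_def h2_def k1_def k2_def total_cost_def
      by (rule ereal_add_interchange_le)
  qed
  note K = ext_integral_exchange[OF m low(1)[unfolded Jh] fin(1)[unfolded Jh] low(2)[unfolded Jh]
      fin(2)[unfolded Jh]
      low'(3)[unfolded Jh] low'(4)[unfolded Jh] this, folded Jh]
  have "J D \<beta> \<mu>' \<le> J D \<alpha>' \<mu>'"
    using K opt_le(1) low fin
    by (cases "J D \<alpha> \<mu>"; cases "J D \<alpha>' \<mu>'"; cases "J D \<beta> \<mu>'"; cases "J D \<gamma> \<mu>") auto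
  then show ?thesis
    using opt(2) \<beta> low'(3) unfolding optimal_pair_def \<beta>_def[symmetric] by (auto intro: order_trans)
qed

text \<open>
  By uniqueness, the maximum of the two optimal states is the optimal state for the larger flow.  If one of the
  optimal costs is \<open>\<infinity>\<close>, then every control is optimal for that flow, and uniqueness forces the states to agree.
\<close>

lemma optimal_state_mono:
  assumes \<mu>: "\<mu> \<in> mfg_L D" "\<mu>' \<in> mfg_L D" and le: "terminal_le \<mu> \<mu>'"
    and opt: "optimal_pair D \<mu> X \<alpha>" "optimal_pair D \<mu>' X' \<alpha>'"
    and uniq: "unique_optimal_pair D \<mu>" "unique_optimal_pair D \<mu>'"
    and sub: "AE (\<omega>, t) in prod_measure D. submodular (cost_f D \<omega> t) \<and> submodular (cost_g D \<omega>)"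
  shows "AE \<omega> in Pm D. \<forall>t\<in>{0..horizon D}. X t \<omega> \<le> X' t \<omega>"
proof (cases "J D \<alpha> \<mu> < \<infinity> \<and> J D \<alpha>' \<mu>' < \<infinity>")
  case True
  then have "optimal_pair D \<mu>' (switch X X' X X') (switch X X' \<alpha> \<alpha>')"
    using switch_optimal[OF \<mu> le opt _ _ sub] by blast
  then have "indistinguishable D (switch X X' X X') X'"
    using uniq(2) opt(2) unfolding unique_optimal_pair_def by blast
  then show ?thesis
    unfolding indistinguishable_def
  proof eventually_elim
    case (elim \<omega>)
    show ?case
    proof
      fix t assume "t \<in> {0..horizon D}"
      with elim have "switch X X' X X' t \<omega> = X' t \<omega>" by blast
      then show "X t \<omega> \<le> X' t \<omega>" unfolding switch_def by (auto split: if_splits)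
    qed
  qed
next
  case False
  have "indistinguishable D X X'"
  proof (cases "J D \<alpha> \<mu> = \<infinity>")
    case True
    then have "optimal_pair D \<mu> X' \<alpha>'" using opt unfolding optimal_pair_def by auto
    then show ?thesis using uniq(1) opt(1) unfolding unique_optimal_pair_def by blast
  next
    case False
    with \<open>\<not> (J D \<alpha> \<mu> < \<infinity> \<and> J D \<alpha>' \<mu>' < \<infinity>)\<close> have "J D \<alpha>' \<mu>' = \<infinity>" by simp
    then have "optimal_pair D \<mu>' X \<alpha>" using opt unfolding optimal_pair_def by auto
    then show ?thesis using uniq(2) opt(2) unfolding unique_optimal_pair_def by blast
  qed
  then show ?thesis unfolding indistinguishable_def by eventually_elim simp
qed

end

section \<open>Best responses and their fixed points\<close>

context mfg_setting
begin

text \<open>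
  The flow \<open>\<rho>\<close> of conditional means generated by an optimal response to \<open>\<mu>\<close>.  It is a relation because \<open>\<rho>\<close>
  is determined only up to null sets at each time.
\<close>

definition is_response :: "(real \<Rightarrow> 'w \<Rightarrow> real) \<Rightarrow> (real \<Rightarrow> 'w \<Rightarrow> real) \<Rightarrow> bool" where
  "is_response \<mu> \<rho> \<longleftrightarrow> \<rho> \<in> mfg_L D \<and> (\<exists>X \<alpha>. optimal_pair D \<mu> X \<alpha> \<and>
     (\<forall>t\<in>{0..horizon D}. AE \<omega> in Pm D. \<rho> t \<omega> = real_cond_exp (Pm D) (FB D (horizon D)) (X t) \<omega>))"

lemma mfg_solutions_iff: "\<mu> \<in> mfg_solutions D \<longleftrightarrow> is_response \<mu> \<mu>"
  unfolding mfg_solutions_def is_response_def by blast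

lemma response_exists:
  assumes "optimal_pair D \<mu> X \<alpha>"
  shows "\<exists>\<rho>. is_response \<mu> \<rho>"
proof -
  let ?T = "horizon D"
  have \<alpha>: "\<alpha> \<in> admissible D" and X: "strong_solution D \<alpha> X" using assms unfolding optimal_pair_def
      by auto
  interpret T: sigma_finite_subalgebra "Pm D" "FB D ?T" using horizon_pos
      by (intro sigma_finite_FB) simp
  note iX = state_integrable[OF \<alpha> X]
  obtain \<rho> where \<rho>: "progressive ?T (FB D) \<rho>"
    "\<And>t. t \<in> {0..?T} \<Longrightarrow> AE \<omega> in Pm D. \<rho> t \<omega> = real_cond_exp (Pm D) (FB D ?T) (X t) \<omega>"
    using progressive_projection[OF state_adapted[OF X] iX state_L1_increment[OF \<alpha> X]
        modulus_nonneg] by blast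
  have "AE \<omega> in Pm D. \<bar>\<rho> t \<omega>\<bar> \<le> real_cond_exp (Pm D) (FB D ?T) (Ybound D t) \<omega>" if t: "t \<in> {0..?T}" for t
  proof -
    note iY = Ybound_integrable[OF t]
    have "AE \<omega> in Pm D. real_cond_exp (Pm D) (FB D ?T) (X t) \<omega>
        \<le> real_cond_exp (Pm D) (FB D ?T) (Ybound D t) \<omega>"
      using state_bound[OF \<alpha> X t] by (intro T.real_cond_exp_mono iX[OF t] iY) (auto elim:
          eventually_mono)
    moreover have "AE \<omega> in Pm D. real_cond_exp (Pm D) (FB D ?T) (\<lambda>\<omega>. - 1 * X t \<omega>) \<omega>
        \<le> real_cond_exp (Pm D) (FB D ?T) (Ybound D t) \<omega>"
      using state_bound[OF \<alpha> X t] iX[OF t] iY by (intro T.real_cond_exp_mono) (auto elim: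
          eventually_mono)
    ultimately show ?thesis
      using \<rho>(2)[OF t] T.real_cond_exp_cmult[OF iX[OF t], of "- 1"] by eventually_elim auto
  qed
  then show ?thesis using \<rho> assms unfolding is_response_def mfg_L_def by blast
qed

text \<open>
  Conditional expectation is an \<open>L\<^sup>1\<close>-contraction, so responses, and in particular solutions, inherit the
  time regularity of the state.
\<close>

lemma response_L1_increment:
  assumes "is_response \<nu> \<mu>" and t: "t \<in> {0..horizon D}"
  shows "(\<integral>\<^sup>+\<omega>. ennreal \<bar>\<mu> (horizon D) \<omega> - \<mu> t \<omega>\<bar> \<partial>Pm D) \<le> ennreal (modulus * sqrt (horizon D - t))"
proof -
  let ?T = "horizon D"
  have T: "?T \<in> {0..?T}" using horizon_pos by simp
  interpret T: sigma_finite_subalgebra "Pm D" "FB D ?T" by (rule sigma_finite_FB[OF T])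
  obtain X \<alpha> where X: "\<alpha> \<in> admissible D" "strong_solution D \<alpha> X"
    and eq: "\<And>t. t \<in> {0..?T} \<Longrightarrow> AE \<omega> in Pm D. \<mu> t \<omega> = real_cond_exp (Pm D) (FB D ?T) (X t) \<omega>"
    using assms(1) unfolding is_response_def optimal_pair_def by blast
  note iX = state_integrable[OF X]
  have "(\<integral>\<^sup>+\<omega>. ennreal \<bar>\<mu> ?T \<omega> - \<mu> t \<omega>\<bar> \<partial>Pm D)
      = (\<integral>\<^sup>+\<omega>. ennreal \<bar>real_cond_exp (Pm D) (FB D ?T) (\<lambda>\<omega>. X ?T \<omega> - X t \<omega>) \<omega>\<bar> \<partial>Pm D)"
    by (rule nn_integral_cong_AE, use eq[OF T] eq[OF t] T.real_cond_exp_diff[OF iX[OF T] iX[OF t]]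
        in eventually_elim) simp
  also have "\<dots> \<le> ennreal (\<integral>\<omega>. \<bar>X ?T \<omega> - X t \<omega>\<bar> \<partial>Pm D)"
    using iX T t by (intro T.nn_integral_abs_real_cond_exp_le) auto
  also have "\<dots> \<le> ennreal (modulus * sqrt (?T - t))"
    using t by (intro ennreal_leI state_L1_increment[OF X]) auto
  finally show ?thesis .
qed

lemma mfg_le_solutions_iff:
  assumes "\<mu> \<in> mfg_solutions D" "\<nu> \<in> mfg_solutions D"
  shows "mfg_le D \<mu> \<nu> \<longleftrightarrow> terminal_le \<mu> \<nu>"
proof
  assume "mfg_le D \<mu> \<nu>"
  then show "terminal_le \<mu> \<nu>"
    using assms modulus_nonneg unfolding mfg_solutions_iff
    by (intro mfg_le_imp_terminal_le[of \<mu> \<nu> modulus] response_L1_increment) (auto simp: is_response_def)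
qed (simp add: terminal_le_def)

lemma mfg_eq_iff: "mfg_eq D \<mu> \<nu> \<longleftrightarrow> mfg_le D \<mu> \<nu> \<and> mfg_le D \<nu> \<mu>"
  unfolding mfg_eq_def mfg_le_def by (auto simp: eq_iff case_prod_beta)

end

locale submodular_mfg = mfg_setting +
  assumes uniq: "\<And>\<mu>. \<mu> \<in> mfg_L D \<Longrightarrow> unique_optimal_pair D \<mu>"
    and submod: "AE (\<omega>, t) in prod_measure D. submodular (cost_f D \<omega> t) \<and> submodular (cost_g D \<omega>)"
begin

lemma response_mono_timewise:
  assumes "\<mu> \<in> mfg_L D" "\<nu> \<in> mfg_L D" "terminal_le \<mu> \<nu>" and r: "is_response \<mu> \<rho>" "is_response \<nu> \<kappa>"
    and t: "t \<in> {0..horizon D}"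
  shows "AE \<omega> in Pm D. \<rho> t \<omega> \<le> \<kappa> t \<omega>"
proof -
  let ?T = "horizon D"
  interpret T: sigma_finite_subalgebra "Pm D" "FB D ?T" using horizon_pos
      by (intro sigma_finite_FB) simp
  obtain X \<alpha> X' \<alpha>' where opt: "optimal_pair D \<mu> X \<alpha>" "optimal_pair D \<nu> X' \<alpha>'"
    and eq: "AE \<omega> in Pm D. \<rho> t \<omega> = real_cond_exp (Pm D) (FB D ?T) (X t) \<omega>"
      "AE \<omega> in Pm D. \<kappa> t \<omega> = real_cond_exp (Pm D) (FB D ?T) (X' t) \<omega>"
    using r t unfolding is_response_def by blast
  have "AE \<omega> in Pm D. X t \<omega> \<le> X' t \<omega>"
    using optimal_state_mono[OF assms(1-3) opt uniq[OF assms(1)] uniq[OF assms(2)] submod]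
    by eventually_elim (use t in blast)
  then have "AE \<omega> in Pm D. real_cond_exp (Pm D) (FB D ?T) (X t) \<omega>
      \<le> real_cond_exp (Pm D) (FB D ?T) (X' t) \<omega>"
    using opt t unfolding optimal_pair_def by (intro T.real_cond_exp_mono) (auto intro:
        state_integrable)
  with eq show ?thesis by eventually_elim simp
qed

lemma response_mono:
  assumes "\<mu> \<in> mfg_L D" "\<nu> \<in> mfg_L D" "terminal_le \<mu> \<nu>" "is_response \<mu> \<rho>" "is_response \<nu> \<kappa>"
  shows "terminal_le \<rho> \<kappa>"
  using response_mono_timewise[OF assms] assms(4,5)
  by (intro terminal_le_of_timewise mfg_L_measurable) (auto simp: is_response_def)

text \<open>
  Tarski's theorem gives \<open>w\<close> with \<open>R w\<close> equivalent to \<open>w\<close>, which is not yet a solution, as it need not agree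
  with its response at each single time.  The response \<open>v = R w\<close> does: \<open>v\<close> and \<open>w\<close> are equivalent flows,
  hence their responses agree almost surely at every time.
\<close>

lemma solutions_Sup:
  assumes A: "A \<subseteq> mfg_solutions D"
  shows "\<exists>w\<in>mfg_solutions D. (\<forall>a\<in>A. terminal_le a w) \<and>
    (\<forall>v\<in>mfg_solutions D. (\<forall>a\<in>A. terminal_le a v) \<longrightarrow> terminal_le w v)"
proof -
  define R where "R \<mu> = (SOME \<rho>. is_response \<mu> \<rho>)" for \<mu>
  have R: "is_response \<mu> (R \<mu>)" if \<mu>: "\<mu> \<in> mfg_L D" for \<mu>
  proof -
    obtain X \<alpha> where "optimal_pair D \<mu> X \<alpha>" using uniq[OF \<mu>] unfolding unique_optimal_pair_def by blast
    from response_exists[OF this] show ?thesis unfolding R_def by (rule someI_ex)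
  qed
  then have RL: "R \<mu> \<in> mfg_L D" if "\<mu> \<in> mfg_L D" for \<mu> using that unfolding is_response_def by blast
  have SL: "\<mu> \<in> mfg_L D" "is_response \<mu> \<mu>" if "\<mu> \<in> mfg_solutions D" for \<mu>
    using that unfolding mfg_solutions_iff is_response_def by blast+
  obtain m where m: "m \<in> mfg_L D" "\<And>\<mu>. \<mu> \<in> mfg_L D \<Longrightarrow> terminal_le \<mu> m" using mfg_L_top by blast
  have "\<exists>w\<in>mfg_L D. terminal_le w (R w) \<and> terminal_le (R w) w \<and> (\<forall>a\<in>A. terminal_le a w) \<and>
      (\<forall>v\<in>mfg_L D. terminal_le (R v) v \<longrightarrow> (\<forall>a\<in>A. terminal_le a v) \<longrightarrow> terminal_le w v)"
  proof (rule preorder_Tarski[where m = m])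
    show "terminal_le (R x) (R y)" if "x \<in> mfg_L D" "y \<in> mfg_L D" "terminal_le x y" for x y
      by (rule response_mono[OF that R[OF that(1)] R[OF that(2)]])
    show "A \<subseteq> mfg_L D" using A SL by blast
    show "terminal_le a (R a)" if "a \<in> A" for a
    proof -
      have "a \<in> mfg_solutions D" using A that by blast
      from response_mono[OF SL(1)[OF this] SL(1)[OF this] terminal_le_refl SL(2)[OF this] R[OF
          SL(1)[OF this]]]
      show ?thesis .
    qed
    show "\<exists>w\<in>mfg_L D. (\<forall>u\<in>U. terminal_le w u) \<and> (\<forall>v\<in>mfg_L D. (\<forall>u\<in>U. terminal_le v u) \<longrightarrow> terminal_le v w)"
      if "U \<subseteq> mfg_L D" "U \<noteq> {}" for U
      by (rule mfg_L_Inf[OF that])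
    show "terminal_le x z" if "terminal_le x y" "terminal_le y z" for x y z
      by (rule terminal_le_trans[OF that])
  qed (fact m(1), rule m(2), assumption, rule RL, assumption)
  then obtain w where w: "w \<in> mfg_L D" "terminal_le w (R w)" "terminal_le (R w) w" "\<And>a. a \<in> A
      \<Longrightarrow> terminal_le a w"
    "\<And>v. v \<in> mfg_L D \<Longrightarrow> terminal_le (R v) v \<Longrightarrow> (\<forall>a\<in>A. terminal_le a v) \<Longrightarrow> terminal_le w v" by blast
  define v where "v = R w"
  have vL: "v \<in> mfg_L D" unfolding v_def by (rule RL[OF w(1)])
  have wv: "terminal_le w v" "terminal_le v w" using w(2,3) unfolding v_def by auto
  have rv: "is_response w v" unfolding v_def by (rule R[OF w(1)])
  obtain X \<alpha> where X: "optimal_pair D v X \<alpha>"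
    "\<And>t. t \<in> {0..horizon D} \<Longrightarrow> AE \<omega> in Pm D. R v t \<omega> = real_cond_exp (Pm D) (FB D (horizon D)) (X t) \<omega>"
    using R[OF vL] unfolding is_response_def by blast
  have "AE \<omega> in Pm D. v t \<omega> = real_cond_exp (Pm D) (FB D (horizon D)) (X t) \<omega>" if t:
      "t \<in> {0..horizon D}" for t
    using response_mono_timewise[OF w(1) vL wv(1) rv R[OF vL] t]
      response_mono_timewise[OF vL w(1) wv(2) R[OF vL] rv t] X(2)[OF t]
    by eventually_elim simp
  then have "v \<in> mfg_solutions D" unfolding mfg_solutions_iff is_response_def using vL X(1) by blast
  moreover have "terminal_le a v" if "a \<in> A" for a using terminal_le_trans[OF w(4)[OF that] wv(1)] .
  moreover have "terminal_le v s" if s: "s \<in> mfg_solutions D" "\<forall>a\<in>A. terminal_le a s" for s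
  proof -
    have "terminal_le (R s) s"
      by (rule response_mono[OF SL(1) SL(1) terminal_le_refl R[OF SL(1)] SL(2)]) (rule s(1))+
    then show ?thesis using w(5)[OF SL(1)[OF s(1)] _ s(2)] terminal_le_trans[OF wv(2)] by blast
  qed
  ultimately show ?thesis by blast
qed

lemma solutions_nonempty: "mfg_solutions D \<noteq> {}"
  using solutions_Sup[of "{}"] by blast

text \<open>
  On solutions the order \<open>mfg_le\<close> agrees with the finer preorder, for which suprema have been found.
\<close>

lemma solutions_complete_lattice: "complete_lattice (solution_order D)"
  unfolding solution_order_def
proof (rule quotient_complete_lattice)
  fix a b c assume a: "a \<in> mfg_solutions D"
  show "mfg_le D a a" using terminal_le_refl unfolding terminal_le_def by blast
  assume b: "b \<in> mfg_solutions D"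
  show "mfg_eq D a b \<longleftrightarrow> mfg_le D a b \<and> mfg_le D b a" by (rule mfg_eq_iff)
  assume c: "c \<in> mfg_solutions D"
  show "mfg_le D a c" if "mfg_le D a b" "mfg_le D b c"
    using that terminal_le_trans mfg_le_solutions_iff a b c by blast
next
  fix A assume A: "A \<subseteq> mfg_solutions D"
  obtain w where w: "w \<in> mfg_solutions D" "\<forall>a\<in>A. terminal_le a w"
    "\<forall>v\<in>mfg_solutions D. (\<forall>a\<in>A. terminal_le a v) \<longrightarrow> terminal_le w v"
    using solutions_Sup[OF A] by blast
  show "\<exists>w\<in>mfg_solutions D. (\<forall>a\<in>A. mfg_le D a w) \<and>
      (\<forall>v\<in>mfg_solutions D. (\<forall>a\<in>A. mfg_le D a v) \<longrightarrow> mfg_le D w v)"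
    using w A mfg_le_solutions_iff by (intro bexI[of _ w]) (auto simp: subset_iff)
qed

end

theorem theorem4p3:
  fixes D :: "'w mfg"
  assumes "mfg_setting D"
    and "\<forall>\<mu>\<in>mfg_L D. unique_optimal_pair D \<mu>"
    and "AE (\<omega>, t) in prod_measure D. \<forall>\<phi>\<in>{cost_f D \<omega> t, cost_g D \<omega>}.
           \<forall>x x' y y'. x \<le> x' \<longrightarrow> y \<le> y' \<longrightarrow> \<phi> x' y' - \<phi> x y' \<le> \<phi> x' y - \<phi> x y"
  shows "mfg_solutions D \<noteq> {} \<and> complete_lattice (solution_order D)"
proof -
  interpret mfg_setting D by (rule assms(1))
  interpret submodular_mfg D
    by unfold_locales (use assms(2,3) in \<open>auto simp: submodular_def\<close>)
  show ?thesis using solutions_nonempty solutions_complete_lattice by blast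
qed

end
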